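(* Let $\mathbb{F}$ be an algebraically closed field of characteristic $0$, let $n=n_1+\dots+n_s$ with all $n_i\ge1$, and let $U(\mathscr{F})=UT(n_1,\ldots,n_s)\subset M_n(\mathbb{F})$. If $n>2$, then $\mathrm{Aut}(U(\mathscr{F})^{(+)})\simeq\mathrm{Aut}(U(\mathscr{F})_0)$ as groups.
   Context: $UT(n_1,\ldots,n_s)$ is the algebra of upper block-triangular matrices with diagonal blocks of sizes $n_1,\ldots,n_s$. $U(\mathscr{F})^{(+)}$ is $U(\mathscr{F})$ viewed as a Jordan algebra with respect to $x\circ y=xy+yx$. $U(\mathscr{F})_0=\{x\in U(\mathscr{F})\mid\mathrm{tr}(x)=0\}$ is a Lie algebra with respect to $[x,y]=xy-yx$. $\mathrm{Aut}$ denotes the group of $\mathbb{F}$-linear automorphisms of the respective algebra. *)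

theory Defs
  imports "Jordan_Normal_Form.Matrix" "HOL-Algebra.Bij"
    "HOL-Computational_Algebra.Polynomial"
begin

text \<open>The index of the diagonal block containing row (equivalently column) \<open>i\<close>, rows and blocks
  being counted from 0. The value is only meaningful for \<open>i < sum_list ns\<close>.\<close>

fun block_index :: "nat list \<Rightarrow> nat \<Rightarrow> nat" where
  "block_index [] i = 0"
| "block_index (m # ns) i = (if i < m then 0 else Suc (block_index ns (i - m)))"

definition UT :: "nat list \<Rightarrow> 'a::zero mat set" where
  "UT ns = {A \<in> carrier_mat (sum_list ns) (sum_list ns).
     \<forall>i < sum_list ns. \<forall>j < sum_list ns. block_index ns j < block_index ns i \<longrightarrow> A $$ (i, j) = 0}"

definition mat_trace :: "'a::comm_monoid_add mat \<Rightarrow> 'a" where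
  "mat_trace A = (\<Sum>i < dim_row A. A $$ (i, i))"

definition UT0 :: "nat list \<Rightarrow> 'a::comm_monoid_add mat set" where
  "UT0 ns = {A \<in> UT ns. mat_trace A = 0}"

definition jordan_mult :: "'a::semiring_0 mat \<Rightarrow> 'a mat \<Rightarrow> 'a mat" where
  "jordan_mult A B = A * B + B * A"

definition lie_bracket :: "'a::ring mat \<Rightarrow> 'a mat \<Rightarrow> 'a mat" where
  "lie_bracket A B = A * B - B * A"

text \<open>A (not necessarily associative) algebra of matrices is given by a linear subspace \<open>V\<close> and a
  product \<open>p\<close> on it. As in \<^theory>\<open>HOL-Algebra.Bij\<close>, automorphisms are extensional on \<open>V\<close>, so that
  each is represented by exactly one function.\<close>

definition alg_auto :: "'a::semiring_0 mat set \<Rightarrow> ('a mat \<Rightarrow> 'a mat \<Rightarrow> 'a mat)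
    \<Rightarrow> ('a mat \<Rightarrow> 'a mat) set" where
  "alg_auto V p = {f \<in> Bij V.
     (\<forall>x\<in>V. \<forall>y\<in>V. f (x + y) = f x + f y) \<and>
     (\<forall>c. \<forall>x\<in>V. f (c \<cdot>\<^sub>m x) = c \<cdot>\<^sub>m f x) \<and>
     (\<forall>x\<in>V. \<forall>y\<in>V. f (p x y) = p (f x) (f y))}"

definition AlgAutGroup :: "'a::semiring_0 mat set \<Rightarrow> ('a mat \<Rightarrow> 'a mat \<Rightarrow> 'a mat)
    \<Rightarrow> ('a mat \<Rightarrow> 'a mat) monoid" where
  "AlgAutGroup V p = BijGroup V \<lparr>carrier := alg_auto V p\<rparr>"

lemma subgroup_alg_auto:
  assumes add: "\<And>x y. x \<in> V \<Longrightarrow> y \<in> V \<Longrightarrow> x + y \<in> V"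
    and smult: "\<And>c x. x \<in> V \<Longrightarrow> c \<cdot>\<^sub>m x \<in> V"
    and prod: "\<And>x y. x \<in> V \<Longrightarrow> y \<in> V \<Longrightarrow> p x y \<in> V"
  shows "subgroup (alg_auto V p) (BijGroup V)"
proof (rule subgroup.intro)
  show "alg_auto V p \<subseteq> carrier (BijGroup V)"
    by (auto simp: alg_auto_def BijGroup_def)
next
  fix f g assume f: "f \<in> alg_auto V p" and g: "g \<in> alg_auto V p"
  have B: "f \<in> Bij V" "g \<in> Bij V" using f g by (auto simp: alg_auto_def)
  have gV: "g x \<in> V" if "x \<in> V" for x
    using Bij_imp_funcset[OF B(2)] that by auto
  have "compose V f g \<in> alg_auto V p"
    using f g gV compose_Bij[OF B]
    by (simp add: alg_auto_def compose_eq add smult prod)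
  then show "f \<otimes>\<^bsub>BijGroup V\<^esub> g \<in> alg_auto V p"
    using B by (simp add: BijGroup_def)
next
  show "\<one>\<^bsub>BijGroup V\<^esub> \<in> alg_auto V p"
    using id_Bij[of V] by (simp add: BijGroup_def alg_auto_def add smult prod)
next
  fix f assume f: "f \<in> alg_auto V p"
  then have B: "f \<in> Bij V" by (simp add: alg_auto_def)
  have iV: "inv_into V f x \<in> V" if "x \<in> V" for x
    by (rule Bij_inv_into_mem[OF B that])
  have fi: "f (inv_into V f x) = x" if "x \<in> V" for x
    using B that unfolding Bij_def by (blast intro: bij_betw_inv_into_right)
  have eqI: "inv_into V f x = y" if "y \<in> V" "f y = x" for x y
    using B that unfolding Bij_def by (blast intro: bij_betw_inv_into_left)
  have "restrict (inv_into V f) V \<in> alg_auto V p"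
    using f restrict_inv_into_Bij[OF B]
    by (auto simp: alg_auto_def add smult prod iV fi intro!: eqI)
  then show "inv\<^bsub>BijGroup V\<^esub> f \<in> alg_auto V p"
    by (simp add: inv_BijGroup[OF B])
qed

lemma UT_closed:
  fixes A B :: "'a::comm_ring_1 mat"
  assumes A: "A \<in> UT ns" and B: "B \<in> UT ns"
  shows "A + B \<in> UT ns" "A - B \<in> UT ns" "c \<cdot>\<^sub>m A \<in> UT ns" "A * B \<in> UT ns"
proof -
  show "A + B \<in> UT ns" "A - B \<in> UT ns" "c \<cdot>\<^sub>m A \<in> UT ns"
    using A B by (auto simp: UT_def)
  have "A $$ (i, k) * B $$ (k, j) = 0"
    if "i < sum_list ns" "j < sum_list ns" "k < sum_list ns" "block_index ns j < block_index ns i"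
    for i j k
    using A B that by (cases "block_index ns k < block_index ns i") (auto simp: UT_def)
  then show "A * B \<in> UT ns"
    using A B by (auto simp: UT_def scalar_prod_def intro!: sum.neutral)
qed

lemma UT0_closed:
  fixes A B :: "'a::comm_ring_1 mat"
  assumes A: "A \<in> UT0 ns" and B: "B \<in> UT0 ns"
  shows "A + B \<in> UT0 ns" "c \<cdot>\<^sub>m A \<in> UT0 ns" "lie_bracket A B \<in> UT0 ns"
proof -
  have U: "A \<in> UT ns" "B \<in> UT ns" using A B by (auto simp: UT0_def)
  then have d: "A \<in> carrier_mat (sum_list ns) (sum_list ns)"
      "B \<in> carrier_mat (sum_list ns) (sum_list ns)"
    by (auto simp: UT_def)
  show "A + B \<in> UT0 ns"
    using A B d UT_closed(1)[OF U] by (auto simp: UT0_def mat_trace_def sum.distrib)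
  show "c \<cdot>\<^sub>m A \<in> UT0 ns"
    using A d UT_closed(3)[OF U] by (auto simp: UT0_def mat_trace_def simp flip: sum_distrib_left)
  have "(\<Sum>i<sum_list ns. (A * B) $$ (i, i)) = (\<Sum>i<sum_list ns. (B * A) $$ (i, i))"
    using d by (simp add: scalar_prod_def, subst sum.swap)
      (auto simp: atLeast0LessThan mult.commute intro!: sum.cong)
  moreover have "lie_bracket A B \<in> UT ns"
    using UT_closed[OF U] UT_closed[OF U(2) U(1)] UT_closed
    by (auto simp: lie_bracket_def)
  ultimately show "lie_bracket A B \<in> UT0 ns"
    using d by (auto simp: UT0_def mat_trace_def lie_bracket_def sum_subtractf)
qed

lemma group_Aut_UT_jordan: "group (AlgAutGroup (UT ns :: 'a::comm_ring_1 mat set) jordan_mult)"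
  unfolding AlgAutGroup_def
  by (intro subgroup.subgroup_is_group subgroup_alg_auto group_BijGroup)
    (auto simp: jordan_mult_def UT_closed)

lemma group_Aut_UT0_lie: "group (AlgAutGroup (UT0 ns :: 'a::comm_ring_1 mat set) lie_bracket)"
  unfolding AlgAutGroup_def
  by (intro subgroup.subgroup_is_group subgroup_alg_auto group_BijGroup)
    (auto simp: UT0_closed)

end

theory Submission
  imports Defs "Jordan_Normal_Form.Char_Poly"
begin

text \<open>
  Write \<open>U\<close> for the block-triangular algebra, \<open>U0\<close> for its trace-zero part and \<open>E i j\<close> for the matrix
  units. Both groups are copies of the group of all linear bijections of \<open>U\<close> that preserve products
  or reverse them. Such a map \<open>f\<close> always preserves the Jordan product, and it preserves the trace;
  on \<open>U0\<close> the bracket is preserved by \<open>f\<close> if \<open>f\<close> preserves products and by \<open>-f\<close> if \<open>f\<close> reverses them.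
  The isomorphism (\<open>lie_of_jordan\<close>) therefore sends \<open>f\<close> to \<open>f\<close> or \<open>-f\<close>, restricted to \<open>U0\<close>. The
  sign is a character because a composite preserves products exactly if none or both of its factors
  reverse them.

  The size \<open>n > 2\<close> enters through \<open>E 0 1 * E 1 2 = E 0 2\<close> and \<open>E 1 2 * E 0 1 = 0\<close>: these show that no
  map both preserves and reverses products, and that \<open>f\<close> and \<open>-g\<close> cannot agree on \<open>U0\<close> if \<open>f\<close>
  preserves and \<open>g\<close> reverses them. For 2 by 2 matrices the map \<open>x \<mapsto> tr(x) 1 - x\<close> reverses products
  and acts on trace-zero matrices as \<open>-1\<close>, so it would be sent to the identity.

  It remains to see that every automorphism in either group arises in this way.

  For a Jordan automorphism (\<open>jordan_automorphism\<close>) the images of the \<open>E i i\<close> are \<open>n\<close> nonzero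
  orthogonal idempotents, so a conjugation by an invertible matrix (which need not lie in \<open>U\<close>)
  brings them back to the \<open>E i i\<close>. The Peirce relations then put the image of \<open>E i j\<close> into the span
  of \<open>E i j\<close> and \<open>E j i\<close>; it has square zero, hence is a multiple of one of the two, and the relations
  between composable units force the same choice for all of them.

  For a Lie automorphism (\<open>lie_automorphism\<close>), extended to \<open>F\<close> on \<open>U\<close> by \<open>F 1 = 1\<close>, take a diagonal
  matrix \<open>h\<close> whose entries have pairwise distinct differences. The crucial point is that \<open>F h\<close> is
  diagonalizable with \<open>n\<close> distinct eigenvalues (\<open>F_regular_diagonalizable\<close>). The leading diagonal
  block of \<open>F h\<close> has an eigenvector \<open>c\<close>, and \<open>U\<close> contains \<open>c r\<close> for every row vector \<open>r\<close>. On these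
  matrices the bracket with \<open>F h\<close> is, up to a shift and a sign, the multiplication of \<open>r\<close> by \<open>F h\<close>.
  So \<open>F\<close> identifies this multiplication with the bracket with \<open>h\<close> on an invariant subspace of \<open>U\<close>,
  and the latter is diagonal in the basis of matrix units, with simple nonzero eigenvalues and an
  abelian null space. In an eigenbasis of \<open>F h\<close> diagonal matrices stay diagonal and every \<open>E i j\<close>
  goes to a multiple of some unit. The units \<open>E 0 j\<close> go to one row or to one column
  (\<open>psi_first_row\<close>), which yields a permutation \<open>\<sigma>\<close> such that \<open>E i j\<close> goes to a multiple of
  \<open>E (\<sigma> i) (\<sigma> j)\<close>, or to one of \<open>E (\<sigma> j) (\<sigma> i)\<close>. In the second case \<open>x \<mapsto> (2 tr(x) / n) 1 - F x\<close> takes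
  the place of \<open>F\<close>; it agrees with \<open>-F\<close> on \<open>U0\<close>.
\<close>

section \<open>Matrix units, conjugation and trace\<close>

definition mat_unit :: "nat \<Rightarrow> nat \<Rightarrow> nat \<Rightarrow> 'a::{zero,one} mat" where
  "mat_unit n i j = mat n n (\<lambda>(p, q). if p = i \<and> q = j then 1 else 0)"

text \<open>An entry of a product stays an atomic term until it is expanded into a sum over \<open>k < n\<close>.\<close>

declare index_mult_mat(1) [simp del]

lemma mat_unit_carrier [simp]: "mat_unit n i j \<in> carrier_mat n n"
  by (simp add: mat_unit_def)

lemma mat_unit_dims [simp]: "dim_row (mat_unit n i j) = n" "dim_col (mat_unit n i j) = n"
  by (simp_all add: mat_unit_def)

lemma mat_unit_index [simp]:
  "p < n \<Longrightarrow> q < n \<Longrightarrow> mat_unit n i j $$ (p, q) = (if p = i \<and> q = j then 1 else 0)"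
  by (simp add: mat_unit_def)

lemma mat_mult_index:
  fixes A B :: "'a::semiring_0 mat"
  assumes "A \<in> carrier_mat n n" "B \<in> carrier_mat n n" "i < n" "j < n"
  shows "(A * B) $$ (i, j) = (\<Sum>k<n. A $$ (i, k) * B $$ (k, j))"
  using assms by (auto simp: index_mult_mat(1) scalar_prod_def atLeast0LessThan intro!: sum.cong)

lemma mult_mat_unit_index:
  fixes A :: "'a::semiring_1 mat"
  assumes "A \<in> carrier_mat n n" "i < n" "p < n" "q < n"
  shows "(A * mat_unit n i j) $$ (p, q) = (if q = j then A $$ (p, i) else 0)"
proof -
  have "(\<Sum>k<n. A $$ (p, k) * mat_unit n i j $$ (k, q))
      = (\<Sum>k<n. if k = i then (if q = j then A $$ (p, i) else 0) else 0)"
    using assms by (intro sum.cong) auto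
  then show ?thesis using assms by (simp add: mat_mult_index[of _ n])
qed

lemma mat_unit_mult_index:
  fixes A :: "'a::semiring_1 mat"
  assumes "A \<in> carrier_mat n n" "j < n" "p < n" "q < n"
  shows "(mat_unit n i j * A) $$ (p, q) = (if p = i then A $$ (j, q) else 0)"
proof -
  have "(\<Sum>k<n. mat_unit n i j $$ (p, k) * A $$ (k, q))
      = (\<Sum>k<n. if k = j then (if p = i then A $$ (j, q) else 0) else 0)"
    using assms by (intro sum.cong) auto
  then show ?thesis using assms by (simp add: mat_mult_index[of _ n])
qed

lemma mat_unit_mult:
  assumes "j < n" "k < n"
  shows "mat_unit n i j * mat_unit n k l
    = (if j = k then mat_unit n i l else (0\<^sub>m n n :: 'a::semiring_1 mat))"
  using assms by (intro eq_matI) (auto simp: mult_mat_unit_index)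

lemma mat_diag_index [simp]: "i < n \<Longrightarrow> j < n \<Longrightarrow> mat_diag n t $$ (i, j) = (if i = j then t j else 0)"
  by (simp add: mat_diag_def)

lemma mat_diag_dims [simp]: "dim_row (mat_diag n t) = n" "dim_col (mat_diag n t) = n"
  by (simp_all add: mat_diag_def)

lemma mat_unit_diag: "mat_unit n i i = mat_diag n (\<lambda>k. if k = i then 1 else 0)"
  by (rule eq_matI) auto

lemma mat_minus_zero: "A \<in> carrier_mat n n \<Longrightarrow> A - 0\<^sub>m n n = (A :: 'a::group_add mat)"
  by (intro eq_matI) auto

lemma one_smult_mat: "1 \<cdot>\<^sub>m A = (A :: 'a::monoid_mult mat)"
  by (intro eq_matI) auto

lemma mat_smult_smult: "a \<cdot>\<^sub>m (c \<cdot>\<^sub>m A) = (a * c) \<cdot>\<^sub>m (A :: 'a::semigroup_mult mat)"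
  by (intro eq_matI) (auto simp: mult.assoc)

lemma mat_diff_eq_add_smult:
  fixes A B C :: "'a::ring_1 mat"
  assumes "A \<in> carrier_mat n n" "B \<in> carrier_mat n n"
  shows "A - B = A + (-1) \<cdot>\<^sub>m B"
  using assms by (intro eq_matI) auto

text \<open>Matrices of all sizes share one type, so linearity is relative to a set of matrices of fixed
  size.\<close>

definition mat_linear_on :: "nat \<Rightarrow> 'a::semiring_1 mat set \<Rightarrow> ('a mat \<Rightarrow> 'a mat) \<Rightarrow> bool" where
  "mat_linear_on n V F \<longleftrightarrow> (\<forall>x\<in>V. F x \<in> carrier_mat n n)
     \<and> (\<forall>x\<in>V. \<forall>y\<in>V. F (x + y) = F x + F y) \<and> (\<forall>c. \<forall>x\<in>V. F (c \<cdot>\<^sub>m x) = c \<cdot>\<^sub>m F x)"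

lemma mat_linear_onD:
  assumes "mat_linear_on n V F"
  shows "x \<in> V \<Longrightarrow> F x \<in> carrier_mat n n"
    and "x \<in> V \<Longrightarrow> y \<in> V \<Longrightarrow> F (x + y) = F x + F y"
    and "x \<in> V \<Longrightarrow> F (c \<cdot>\<^sub>m x) = c \<cdot>\<^sub>m F x"
  using assms by (auto simp: mat_linear_on_def)

definition inverse_pair :: "nat \<Rightarrow> 'a::semiring_1 mat \<Rightarrow> 'a mat \<Rightarrow> bool" where
  "inverse_pair n P Q \<longleftrightarrow> P \<in> carrier_mat n n \<and> Q \<in> carrier_mat n n \<and> P * Q = 1\<^sub>m n \<and> Q * P = 1\<^sub>m n"

lemma inverse_pair_sym: "inverse_pair n P Q \<Longrightarrow> inverse_pair n Q P"
  by (auto simp: inverse_pair_def)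

lemma inverse_pair_carrier: "inverse_pair n P Q \<Longrightarrow> P \<in> carrier_mat n n"
  "inverse_pair n P Q \<Longrightarrow> Q \<in> carrier_mat n n"
  by (auto simp: inverse_pair_def)

lemma conj_carrier:
  "inverse_pair n P Q \<Longrightarrow> x \<in> carrier_mat n n \<Longrightarrow> Q * x * P \<in> carrier_mat n n"
  by (auto simp: inverse_pair_def intro!: mult_carrier_mat[of _ n n _ n])

lemma conj_mult:
  fixes x y :: "'a::semiring_1 mat"
  assumes "inverse_pair n P Q" "x \<in> carrier_mat n n" "y \<in> carrier_mat n n"
  shows "(Q * x * P) * (Q * y * P) = Q * (x * y) * P"
proof -
  have c: "P \<in> carrier_mat n n" "Q \<in> carrier_mat n n" "P * Q = 1\<^sub>m n"
    using assms by (auto simp: inverse_pair_def)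
  have "P * (Q * (y * P)) = P * Q * (y * P)"
    using assms c by (intro assoc_mult_mat[symmetric]) (auto intro: mult_carrier_mat)
  then have PQ: "P * (Q * (y * P)) = y * P" using assms c by (simp add: mult_carrier_mat[of _ n n _ n])
  show ?thesis
    using assms c by (simp add: assoc_mult_mat[of _ n n _ n _ n] mult_carrier_mat[of _ n n _ n] PQ)
qed

lemma conj_cancel:
  fixes x :: "'a::semiring_1 mat"
  assumes "inverse_pair n P Q" "x \<in> carrier_mat n n"
  shows "P * (Q * x * P) * Q = x"
proof -
  have c: "P \<in> carrier_mat n n" "Q \<in> carrier_mat n n" "P * Q = 1\<^sub>m n"
    using assms by (auto simp: inverse_pair_def)
  have "P * (Q * x * P) * Q = (P * Q) * (x * (P * Q))"
    using assms(2) c(1,2) by (simp add: assoc_mult_mat[of _ n n _ n _ n] mult_carrier_mat[of _ n n _ n])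
  then show ?thesis using c assms(2) by simp
qed

lemma conj_inject:
  fixes x y :: "'a::semiring_1 mat"
  assumes "inverse_pair n P Q" "x \<in> carrier_mat n n" "y \<in> carrier_mat n n"
    and "Q * x * P = Q * y * P"
  shows "x = y"
proof -
  have "P * (Q * x * P) * Q = P * (Q * y * P) * Q" by (simp only: assms(4))
  then show ?thesis by (simp only: conj_cancel[OF assms(1,2)] conj_cancel[OF assms(1,3)])
qed

lemma conj_add:
  fixes x y :: "'a::semiring_1 mat"
  assumes "inverse_pair n P Q" "x \<in> carrier_mat n n" "y \<in> carrier_mat n n"
  shows "Q * (x + y) * P = Q * x * P + Q * y * P"
proof -
  have c: "P \<in> carrier_mat n n" "Q \<in> carrier_mat n n"
    using assms by (auto simp: inverse_pair_def)
  then have "Q * (x + y) = Q * x + Q * y" using assms by (simp add: mult_add_distrib_mat)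
  then show ?thesis using c assms add_mult_distrib_mat[of "Q * x" n n "Q * y" P n]
    by (simp add: mult_carrier_mat[of _ n n _ n])
qed

lemma conj_smult:
  fixes x :: "'a::comm_semiring_1 mat"
  assumes "inverse_pair n P Q" "x \<in> carrier_mat n n"
  shows "Q * (c \<cdot>\<^sub>m x) * P = c \<cdot>\<^sub>m (Q * x * P)"
proof -
  have c: "P \<in> carrier_mat n n" "Q \<in> carrier_mat n n"
    using assms by (auto simp: inverse_pair_def)
  then have "Q * (c \<cdot>\<^sub>m x) = c \<cdot>\<^sub>m (Q * x)" using assms by (simp add: mult_smult_distrib)
  then show ?thesis using c assms mult_smult_assoc_mat[of "Q * x" n n P n]
    by (simp add: mult_carrier_mat[of _ n n _ n])
qed

lemma conj_diff:
  fixes x y :: "'a::comm_ring_1 mat"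
  assumes "inverse_pair n P Q" "x \<in> carrier_mat n n" "y \<in> carrier_mat n n"
  shows "Q * (x - y) * P = Q * x * P - Q * y * P"
  using assms conj_carrier[OF assms(1)]
  by (simp add: mat_diff_eq_add_smult[of _ n] conj_add conj_smult)

lemma conj_linear:
  fixes F :: "'a::comm_semiring_1 mat \<Rightarrow> 'a mat"
  assumes "inverse_pair n P Q" "mat_linear_on n V F"
  shows "mat_linear_on n V (\<lambda>x. Q * F x * P)"
  using assms conj_carrier[OF assms(1)]
  by (auto simp: mat_linear_on_def conj_add conj_smult)

lemma mat_trace_comm:
  fixes A B :: "'a::comm_semiring_1 mat"
  assumes A: "A \<in> carrier_mat n n" and B: "B \<in> carrier_mat n n"
  shows "mat_trace (A * B) = mat_trace (B * A)"
proof -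
  have "mat_trace (A * B) = (\<Sum>i<n. \<Sum>k<n. A $$ (i, k) * B $$ (k, i))"
    using A B by (simp add: mat_trace_def mat_mult_index[of _ n])
  also have "\<dots> = (\<Sum>k<n. \<Sum>i<n. B $$ (k, i) * A $$ (i, k))"
    by (subst sum.swap) (simp add: mult.commute)
  also have "\<dots> = mat_trace (B * A)"
    using A B by (simp add: mat_trace_def mat_mult_index[of _ n])
  finally show ?thesis .
qed

lemma mat_trace_conj:
  fixes x :: "'a::comm_semiring_1 mat"
  assumes "inverse_pair n P Q" "x \<in> carrier_mat n n"
  shows "mat_trace (Q * x * P) = mat_trace x"
proof -
  have c: "P \<in> carrier_mat n n" "Q \<in> carrier_mat n n" "P * Q = 1\<^sub>m n"
    using assms by (auto simp: inverse_pair_def)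
  have "mat_trace (Q * x * P) = mat_trace (P * (Q * x))"
    using c assms by (intro mat_trace_comm[of _ n]) auto
  also have "P * (Q * x) = P * Q * x"
    using c assms by (intro assoc_mult_mat[symmetric]) auto
  finally show ?thesis using c assms by simp
qed

lemma mat_trace_add_diff:
  fixes x y :: "'a::comm_ring_1 mat"
  assumes "x \<in> carrier_mat n n" "y \<in> carrier_mat n n"
  shows "mat_trace (x + y) = mat_trace x + mat_trace y"
    "mat_trace (x - y) = mat_trace x - mat_trace y"
  using assms by (auto simp: mat_trace_def sum.distrib sum_subtractf)

lemma mat_trace_smult:
  fixes x :: "'a::comm_ring_1 mat"
  shows "x \<in> carrier_mat n n \<Longrightarrow> mat_trace (c \<cdot>\<^sub>m x) = c * mat_trace x"
  by (auto simp: mat_trace_def sum_distrib_left)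

lemma mat_trace_one: "mat_trace (1\<^sub>m n :: 'a::semiring_1 mat) = of_nat n"
  by (simp add: mat_trace_def)

lemma mat_trace_transpose: "x \<in> carrier_mat n n \<Longrightarrow> mat_trace (transpose_mat x) = mat_trace x"
  by (auto simp: mat_trace_def)

lemma ex_inverse_pair:
  fixes P :: "'a::field mat"
  assumes P: "P \<in> carrier_mat n n"
    and inj: "\<And>v. v \<in> carrier_vec n \<Longrightarrow> P *\<^sub>v v = 0\<^sub>v n \<Longrightarrow> v = 0\<^sub>v n"
  shows "\<exists>Q. inverse_pair n P Q"
proof -
  have "det P \<noteq> 0" using det_0_iff_vec_prod_zero_field[OF P] inj by blast
  from det_non_zero_imp_unit[OF P this, of "()"] show ?thesis
    using P by (auto simp: Units_def ring_mat_def inverse_pair_def)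
qed

lemma conj_one: "inverse_pair n P Q \<Longrightarrow> Q * 1\<^sub>m n * P = (1\<^sub>m n :: 'a::semiring_1 mat)"
  using right_mult_one_mat[of Q n n] by (simp add: inverse_pair_def)

text \<open>A nonzero column of each idempotent is fixed by this idempotent and killed by the others, so
  these columns form a basis in which all of them are diagonal.\<close>

lemma orthogonal_idempotents_diagonal:
  fixes f :: "nat \<Rightarrow> 'a::field mat"
  assumes c: "\<And>i. i < n \<Longrightarrow> f i \<in> carrier_mat n n"
    and idem: "\<And>i. i < n \<Longrightarrow> f i * f i = f i"
    and orth: "\<And>i j. i < n \<Longrightarrow> j < n \<Longrightarrow> i \<noteq> j \<Longrightarrow> f i * f j = 0\<^sub>m n n"
    and nz: "\<And>i. i < n \<Longrightarrow> f i \<noteq> 0\<^sub>m n n"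
  shows "\<exists>P Q. inverse_pair n P Q \<and> (\<forall>i<n. Q * f i * P = mat_unit n i i)"
proof -
  have "\<exists>q<n. \<exists>p<n. f i $$ (p, q) \<noteq> 0" if "i < n" for i
    using nz[OF that] c[OF that] by (metis eq_matI carrier_matD index_zero_mat)
  then obtain q where q: "\<And>i. i < n \<Longrightarrow> q i < n \<and> (\<exists>p<n. f i $$ (p, q i) \<noteq> 0)" by metis
  define P where "P = mat n n (\<lambda>(p, i). f i $$ (p, q i))"
  have P: "P \<in> carrier_mat n n" by (simp add: P_def)
  have fP: "f j * P = P * mat_unit n j j" if j: "j < n" for j
  proof (rule eq_matI)
    fix p i assume "p < dim_row (P * mat_unit n j j)" "i < dim_col (P * mat_unit n j j)"
    then have pi: "p < n" "i < n" using P by auto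
    have "(f j * P) $$ (p, i) = (\<Sum>k<n. f j $$ (p, k) * f i $$ (k, q i))"
      using c[OF j] P pi by (simp add: mat_mult_index[of _ n]) (simp add: P_def)
    also have "\<dots> = (f j * f i) $$ (p, q i)"
      using c j pi q by (simp add: mat_mult_index[of _ n])
    also have "\<dots> = (P * mat_unit n j j) $$ (p, i)"
      using P pi j q idem orth by (auto simp: mult_mat_unit_index) (auto simp: P_def)
    finally show "(f j * P) $$ (p, i) = (P * mat_unit n j j) $$ (p, i)" .
  qed (use c[OF j] P in auto)
  have "\<exists>Q. inverse_pair n P Q"
  proof (rule ex_inverse_pair[OF P])
    fix v assume v: "v \<in> carrier_vec n" "P *\<^sub>v v = 0\<^sub>v n"
    have "v $ j = 0" if j: "j < n" for j
    proof -
      obtain p where p: "p < n" "f j $$ (p, q j) \<noteq> 0" using q[OF j] by blast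
      have "(P * mat_unit n j j) *\<^sub>v v = f j *\<^sub>v (P *\<^sub>v v)"
        unfolding fP[OF j, symmetric] by (rule assoc_mult_mat_vec[OF c[OF j] P v(1)])
      also have "\<dots> = 0\<^sub>v n" using v c[OF j] by auto
      finally have "((P * mat_unit n j j) *\<^sub>v v) $ p = 0" using p by simp
      moreover have "((P * mat_unit n j j) *\<^sub>v v) $ p = (\<Sum>k<n. (P * mat_unit n j j) $$ (p, k) * v $ k)"
        using P v p by (auto simp: scalar_prod_def atLeast0LessThan intro!: sum.cong)
      moreover have "\<dots> = (\<Sum>k<n. if k = j then P $$ (p, j) * v $ j else 0)"
        using P p j by (intro sum.cong) (auto simp: mult_mat_unit_index)
      ultimately have "P $$ (p, j) * v $ j = 0" using j by simp
      then show ?thesis using p j by (simp add: P_def)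
    qed
    then show "v = 0\<^sub>v n" using v by auto
  qed
  then obtain Q where Q: "inverse_pair n P Q" by blast
  then have "Q * f i * P = mat_unit n i i" if "i < n" for i
    using fP[OF that] c[OF that] P
    by (auto simp: inverse_pair_def assoc_mult_mat[of _ n n _ n _ n] simp flip: assoc_mult_mat[of Q n n P n "mat_unit n i i" n])
  with Q show ?thesis by blast
qed

section \<open>Block-triangular algebras\<close>

text \<open>The blocks enter through a monotone function \<open>b\<close>. Monotonicity gives \<open>U\<close> all units \<open>E i j\<close> with
  \<open>i \<le> j\<close>, so any two indices are joined by a unit of \<open>U\<close>.\<close>

locale block_triangular =
  fixes n :: nat and b :: "nat \<Rightarrow> nat" and U :: "'a::{alg_closed_field,field_char_0} mat set"
  assumes b_mono: "i \<le> j \<Longrightarrow> b i \<le> b j"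
    and U_eq: "U = {A \<in> carrier_mat n n. \<forall>i<n. \<forall>j<n. b j < b i \<longrightarrow> A $$ (i, j) = 0}"
begin

abbreviation E :: "nat \<Rightarrow> nat \<Rightarrow> 'a mat" where "E \<equiv> mat_unit n"

text \<open>The positions at which the elements of \<open>U\<close> may be nonzero; the corresponding units are a
  basis of \<open>U\<close>.\<close>

definition arrow :: "nat \<Rightarrow> nat \<Rightarrow> bool" where
  "arrow i j \<longleftrightarrow> i < n \<and> j < n \<and> b i \<le> b j"

lemma arrow_trans: "arrow i j \<Longrightarrow> arrow j k \<Longrightarrow> arrow i k"
  by (auto simp: arrow_def)

lemma arrowD: "arrow i j \<Longrightarrow> i < n" "arrow i j \<Longrightarrow> j < n"
  by (auto simp: arrow_def)

lemma arrowI: "i \<le> j \<Longrightarrow> j < n \<Longrightarrow> arrow i j"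
  by (auto simp: arrow_def b_mono)

lemma U_carrier: "A \<in> U \<Longrightarrow> A \<in> carrier_mat n n"
  by (auto simp: U_eq)

lemma U_dims: "A \<in> U \<Longrightarrow> dim_row A = n" "A \<in> U \<Longrightarrow> dim_col A = n"
  by (auto simp: U_eq)

lemma U_zero_entry: "A \<in> U \<Longrightarrow> i < n \<Longrightarrow> j < n \<Longrightarrow> \<not> arrow i j \<Longrightarrow> A $$ (i, j) = 0"
  by (auto simp: U_eq arrow_def)

lemma U_memI: "A \<in> carrier_mat n n \<Longrightarrow> (\<And>i j. i < n \<Longrightarrow> j < n \<Longrightarrow> \<not> arrow i j \<Longrightarrow> A $$ (i, j) = 0) \<Longrightarrow> A \<in> U"
  by (auto simp: U_eq arrow_def)

lemma U_add: "A \<in> U \<Longrightarrow> B \<in> U \<Longrightarrow> A + B \<in> U"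
  and U_diff: "A \<in> U \<Longrightarrow> B \<in> U \<Longrightarrow> A - B \<in> U"
  and U_smult: "A \<in> U \<Longrightarrow> c \<cdot>\<^sub>m A \<in> U"
  by (auto simp: U_eq)

lemma U_mult: assumes "A \<in> U" "B \<in> U" shows "A * B \<in> U"
proof (rule U_memI)
  show "A * B \<in> carrier_mat n n" using assms[THEN U_carrier] by auto
  fix i j assume ij: "i < n" "j < n" "\<not> arrow i j"
  have "A $$ (i, k) * B $$ (k, j) = 0" if "k < n" for k
  proof -
    have "\<not> arrow i k \<or> \<not> arrow k j" using ij arrow_trans by blast
    then show ?thesis using assms ij that U_zero_entry by auto
  qed
  then have "(\<Sum>k<n. A $$ (i, k) * B $$ (k, j)) = 0" by (intro sum.neutral) auto
  then show "(A * B) $$ (i, j) = 0"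
    using assms[THEN U_carrier] ij by (simp add: mat_mult_index[of _ n])
qed

lemma U_one: "1\<^sub>m n \<in> U"
  by (rule U_memI) (auto simp: arrow_def)

lemma U_unit: "arrow i j \<Longrightarrow> E i j \<in> U"
  by (rule U_memI) (auto simp: arrow_def)

lemma U_zero: "0\<^sub>m n n \<in> U"
  by (rule U_memI) auto

lemma linear_zero:
  assumes "mat_linear_on n U F"
  shows "F (0\<^sub>m n n) = 0\<^sub>m n n"
proof -
  have "F (0 \<cdot>\<^sub>m 0\<^sub>m n n) = 0 \<cdot>\<^sub>m F (0\<^sub>m n n)"
    using mat_linear_onD(3)[OF assms U_zero] .
  also have "\<dots> = 0\<^sub>m n n" using mat_linear_onD(1)[OF assms U_zero] by auto
  finally show ?thesis by simp
qed

lemma linear_diff: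
  assumes F: "mat_linear_on n U F" and "x \<in> U" "y \<in> U"
  shows "F (x - y) = F x - F y"
proof -
  have "F (x - y) = F (x + (-1) \<cdot>\<^sub>m y)"
    using assms by (subst mat_diff_eq_add_smult[of x n y]) (auto simp: U_carrier)
  also have "\<dots> = F x + (-1) \<cdot>\<^sub>m F y"
    using assms mat_linear_onD[OF F] by (simp add: U_smult)
  also have "\<dots> = F x - F y"
    using assms mat_linear_onD[OF F] by (subst mat_diff_eq_add_smult[of "F x" n]) auto
  finally show ?thesis .
qed

text \<open>Induction on the number of nonzero entries: subtracting a multiple of a unit clears one
  entry.\<close>

lemma linear_ext:
  assumes F: "mat_linear_on n U F" and G: "mat_linear_on n U G"
    and eq: "\<And>i j. arrow i j \<Longrightarrow> F (E i j) = G (E i j)"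
    and "A \<in> U"
  shows "F A = G A"
  using \<open>A \<in> U\<close>
proof (induction "card {(i, j). i < n \<and> j < n \<and> A $$ (i, j) \<noteq> 0}" arbitrary: A rule: less_induct)
  case less
  let ?S = "\<lambda>A. {(i, j). i < n \<and> j < n \<and> A $$ (i, j) \<noteq> 0}"
  have fin: "finite (?S A)"
    by (rule finite_subset[of _ "{..<n} \<times> {..<n}"]) auto
  show ?case
  proof (cases "?S A = {}")
    case True
    then have "A = 0\<^sub>m n n" using U_carrier[OF less.prems] by (intro eq_matI) auto
    then show ?thesis using linear_zero[OF F] linear_zero[OF G] by simp
  next
    case False
    then obtain i j where ij: "i < n" "j < n" "A $$ (i, j) \<noteq> 0" by auto
    then have a: "arrow i j" using U_zero_entry less.prems by blast
    define B where "B = A - A $$ (i, j) \<cdot>\<^sub>m E i j"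
    have B: "B \<in> U" using less.prems a by (auto simp: B_def intro: U_diff U_smult U_unit)
    have ent: "B $$ (p, q) = (if (p, q) = (i, j) then 0 else A $$ (p, q))" if "p < n" "q < n" for p q
      using that U_carrier[OF less.prems] by (auto simp: B_def)
    have SB: "?S B = ?S A - {(i, j)}" using ent by (auto split: if_splits)
    have "card (?S B) < card (?S A)"
      unfolding SB by (rule card_Diff1_less[OF fin]) (use ij in simp)
    then have IH: "F B = G B" using less.hyps B by blast
    have AB: "A = B + A $$ (i, j) \<cdot>\<^sub>m E i j"
      using U_carrier[OF less.prems] unfolding B_def by (intro eq_matI) auto
    have "H A = H B + A $$ (i, j) \<cdot>\<^sub>m H (E i j)" if "mat_linear_on n U H" for H
      using mat_linear_onD(2)[OF that B U_smult[OF U_unit[OF a]]] mat_linear_onD(3)[OF that U_unit[OF a]] AB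
      by metis
    from this[OF F] this[OF G] show ?thesis using IH eq[OF a] by simp
  qed
qed

text \<open>Both sides are linear in each factor, so \<open>linear_ext\<close> applies to one factor at a time.\<close>

lemma mult_ext:
  assumes F: "mat_linear_on n U F"
    and eq: "\<And>i j k. arrow i j \<Longrightarrow> arrow j k \<Longrightarrow> F (E i j) * F (E j k) = F (E i k)"
    and zero: "\<And>i j k l. arrow i j \<Longrightarrow> arrow k l \<Longrightarrow> j \<noteq> k \<Longrightarrow> F (E i j) * F (E k l) = 0\<^sub>m n n"
    and "A \<in> U" "B \<in> U"
  shows "F (A * B) = F A * F B"
proof -
  note F' = mat_linear_onD[OF F]
  have units: "F (E i j * E k l) = F (E i j) * F (E k l)" if "arrow i j" "arrow k l" for i j k l
    using that eq[of i j l] zero[of i j k l] linear_zero[OF F] by (auto simp: mat_unit_mult arrow_def)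
  have left: "F (A * E k l) = F A * F (E k l)" if kl: "arrow k l" for k l
  proof (rule linear_ext[OF _ _ _ \<open>A \<in> U\<close>])
    note c = U_unit[OF kl] F'(1)[OF U_unit[OF kl]]
    show "mat_linear_on n U (\<lambda>x. F (x * E k l))"
      using c F' U_carrier U_mult U_smult
      by (auto simp: mat_linear_on_def add_mult_distrib_mat[of _ n n _ _ n] mult_smult_assoc_mat[of _ n n _ n]
        intro!: mult_carrier_mat[of _ n n _ n])
    show "mat_linear_on n U (\<lambda>x. F x * F (E k l))"
      using c F' by (auto simp: mat_linear_on_def add_mult_distrib_mat[of _ n n _ _ n] mult_smult_assoc_mat[of _ n n _ n]
        intro!: mult_carrier_mat[of _ n n _ n])
  qed (use units kl in auto)
  show ?thesis
  proof (rule linear_ext[OF _ _ _ \<open>B \<in> U\<close>])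
    note c = \<open>A \<in> U\<close> F'(1)[OF \<open>A \<in> U\<close>] U_carrier[OF \<open>A \<in> U\<close>]
    show "mat_linear_on n U (\<lambda>x. F (A * x))"
      using c F' U_carrier U_mult U_smult
      by (auto simp: mat_linear_on_def mult_add_distrib_mat[of _ n n _ n] mult_smult_distrib[of _ n n _ n] intro!: mult_carrier_mat[of _ n n _ n])
    show "mat_linear_on n U (\<lambda>x. F A * F x)"
      using c F' by (auto simp: mat_linear_on_def mult_add_distrib_mat[of _ n n _ n] mult_smult_distrib[of _ n n _ n] intro!: mult_carrier_mat[of _ n n _ n])
  qed (use left in auto)
qed

lemma Bij_U:
  assumes "f \<in> Bij U"
  shows "x \<in> U \<Longrightarrow> f x \<in> U" "x \<in> U \<Longrightarrow> y \<in> U \<Longrightarrow> f x = f y \<Longrightarrow> x = y"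
    "y \<in> U \<Longrightarrow> \<exists>x\<in>U. f x = y"
  using assms unfolding Bij_def bij_betw_def by (auto dest: inj_onD) (metis imageE)

lemma lie_bracket_carrier:
  "A \<in> carrier_mat n n \<Longrightarrow> B \<in> carrier_mat n n \<Longrightarrow> lie_bracket A (B :: 'a mat) \<in> carrier_mat n n"
  by (auto simp: lie_bracket_def intro!: mult_carrier_mat[of _ n n _ n])

lemma U_lie: "A \<in> U \<Longrightarrow> B \<in> U \<Longrightarrow> lie_bracket A B \<in> U"
  by (simp add: lie_bracket_def U_diff U_mult)

lemma lie_bracket_diag_index:
  assumes "A \<in> carrier_mat n n" "i < n" "j < n"
  shows "lie_bracket (mat_diag n t) A $$ (i, j) = (t i - t j) * (A $$ (i, j) :: 'a)"
proof -
  have "(mat_diag n t * A - A * mat_diag n t) $$ (i, j) = (mat_diag n t * A) $$ (i, j) - (A * mat_diag n t) $$ (i, j)"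
    using assms by (intro index_minus_mat(1)) (auto simp: carrier_matD[OF mat_diag_dim])
  then show ?thesis using assms
    by (simp add: lie_bracket_def mat_diag_mult_left[of _ n n] mat_diag_mult_right[of _ n n] algebra_simps)
qed

lemma mat_diag_U: "mat_diag n t \<in> U"
  unfolding mat_diag_def by (rule U_memI) (auto simp: arrow_def)

lemma lie_bracket_units:
  assumes "i < n" "j < n" "k < n" "l < n"
  shows "lie_bracket (E i j) (E k l) = (if j = k then E i l else 0\<^sub>m n n) - (if l = i then E k j else 0\<^sub>m n n)"
  using assms by (simp add: lie_bracket_def mat_unit_mult)

lemma lie_bracket_diag_unit:
  "lie_bracket (mat_diag n t) (E i j) = (t i - t j) \<cdot>\<^sub>m E i j"
  by (rule eq_matI) (use lie_bracket_diag_index[OF mat_unit_carrier, of _ _ t i j]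
      lie_bracket_carrier[OF mat_diag_dim mat_unit_carrier, of t i j] in auto)

lemma mat_linear_transpose:
  "mat_linear_on n V F \<Longrightarrow> mat_linear_on n V (\<lambda>x. transpose_mat (F x :: 'a mat))"
  by (auto simp: mat_linear_on_def transpose_add[of _ n n] intro!: eq_matI)

end

section \<open>Jordan automorphisms\<close>

lemma jordan_mult_unit_index:
  fixes Y :: "'a::semiring_1 mat"
  assumes "Y \<in> carrier_mat n n" "i < n" "j < n" "p < n" "q < n"
  shows "jordan_mult (mat_unit n i j) Y $$ (p, q)
    = (if p = i then Y $$ (j, q) else 0) + (if q = j then Y $$ (p, i) else 0)"
proof -
  have "(mat_unit n i j * Y + Y * mat_unit n i j) $$ (p, q)
      = (mat_unit n i j * Y) $$ (p, q) + (Y * mat_unit n i j) $$ (p, q)"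
    using assms by (intro index_add_mat(1)) auto
  then show ?thesis using assms by (simp add: jordan_mult_def mat_unit_mult_index mult_mat_unit_index)
qed

lemma jordan_mult_carrier:
  "A \<in> carrier_mat n n \<Longrightarrow> B \<in> carrier_mat n n \<Longrightarrow> jordan_mult A B \<in> carrier_mat n n"
  by (auto simp: jordan_mult_def)

lemma jordan_mult_smult_left:
  fixes A B :: "'a::comm_semiring_1 mat"
  assumes "A \<in> carrier_mat n n" "B \<in> carrier_mat n n"
  shows "jordan_mult (c \<cdot>\<^sub>m A) B = c \<cdot>\<^sub>m jordan_mult A B"
  using assms
  by (simp add: jordan_mult_def mult_smult_assoc_mat[of _ n n _ n] mult_smult_distrib[of _ n n _ n]
      add_smult_distrib_left_mat[of _ n n] mult_carrier_mat[of _ n n _ n])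

context block_triangular
begin

lemma jordan_mult_transpose:
  assumes "A \<in> carrier_mat n n" "B \<in> carrier_mat n n"
  shows "transpose_mat (jordan_mult A B) = jordan_mult (transpose_mat A) (transpose_mat (B :: 'a mat))"
  using assms by (simp add: jordan_mult_def transpose_add[of _ n n] transpose_mult[of _ n n _ n] mult_carrier_mat[of _ n n _ n]
      comm_add_mat[of _ n n])

lemma jordan_conj:
  assumes "inverse_pair n P Q" "A \<in> carrier_mat n n" "B \<in> carrier_mat n n"
  shows "Q * jordan_mult A B * P = jordan_mult (Q * A * P) (Q * (B :: 'a mat) * P)"
  using assms by (simp add: jordan_mult_def conj_mult conj_add mult_carrier_mat[of _ n n _ n])

context
  fixes \<psi> :: "'a mat \<Rightarrow> 'a mat"
  assumes lin: "mat_linear_on n U \<psi>"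
    and inj_all: "\<forall>x\<in>U. \<psi> x = 0\<^sub>m n n \<longrightarrow> x = 0\<^sub>m n n"
    and jordan_all: "\<forall>x\<in>U. \<forall>y\<in>U. \<psi> (jordan_mult x y) = jordan_mult (\<psi> x) (\<psi> y)"
    and diag_all: "\<forall>i<n. \<psi> (E i i) = E i i"
begin

lemmas inj = inj_all[rule_format] and jordan = jordan_all[rule_format] and diag = diag_all[rule_format]

lemma jordan_unit_image_carrier: "arrow i j \<Longrightarrow> \<psi> (E i j) \<in> carrier_mat n n"
  by (rule mat_linear_onD(1)[OF lin U_unit])

text \<open>In \<open>E i i \<circ> Y\<close> the entry \<open>(p, q)\<close> of \<open>Y\<close> is multiplied by the number of indices among \<open>p\<close> and \<open>q\<close>
  that equal \<open>i\<close>. As \<open>E i j\<close> is reproduced by the Jordan product with \<open>E i i\<close> and with \<open>E j j\<close>, each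
  of \<open>i\<close> and \<open>j\<close> occurs exactly once.\<close>

lemma jordan_unit_image_support:
  assumes a: "arrow i j" "i \<noteq> j" and pq: "p < n" "q < n" "\<psi> (E i j) $$ (p, q) \<noteq> 0"
  shows "(p, q) = (i, j) \<or> (p, q) = (j, i)"
proof -
  let ?Y = "\<psi> (E i j)"
  note c = jordan_unit_image_carrier[OF a(1)] arrowD[OF a(1)]
  have "jordan_mult (E i i) (E i j) = E i j" "jordan_mult (E j j) (E i j) = E i j"
    by (rule eq_matI; use c a(2) in \<open>auto simp: jordan_mult_unit_index jordan_mult_carrier carrier_matD[OF jordan_mult_carrier[of _ n]]\<close>)+
  then have J: "jordan_mult (E i i) ?Y = ?Y" "jordan_mult (E j j) ?Y = ?Y"
    using jordan[OF U_unit U_unit[OF a(1)], of i i] jordan[OF U_unit U_unit[OF a(1)], of j j] c diag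
    by (simp_all add: arrow_def)
  have count: "jordan_mult (E k k) ?Y $$ (p, q) = ((if p = k then 1 else 0) + (if q = k then 1 else 0)) * ?Y $$ (p, q)"
    if "k < n" for k
    using that pq c by (simp add: jordan_mult_unit_index)
  have "((if p = i then 1 else 0) + (if q = i then 1 else 0)) * ?Y $$ (p, q) = 1 * ?Y $$ (p, q)"
    "((if p = j then 1 else 0) + (if q = j then 1 else 0)) * ?Y $$ (p, q) = 1 * ?Y $$ (p, q)"
    unfolding count[OF c(2), symmetric] count[OF c(3), symmetric] by (simp_all only: J mult_1)
  then have "(if p = i then 1 else 0) + (if q = i then 1 else 0) = (1 :: 'a)"
    "(if p = j then 1 else 0) + (if q = j then 1 else 0) = (1 :: 'a)"
    using pq(3) by (simp_all only: mult_cancel_right simp_thms)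
  then show ?thesis using a(2) by (auto split: if_splits)
qed

text \<open>The image of \<open>E i j\<close> has square zero, and the product of the two entries is a diagonal entry
  of this square.\<close>

lemma jordan_unit_image_one_sided:
  assumes a: "arrow i j" "i \<noteq> j"
  shows "\<psi> (E i j) $$ (i, j) = 0 \<or> \<psi> (E i j) $$ (j, i) = 0"
proof -
  let ?Y = "\<psi> (E i j)"
  note c = jordan_unit_image_carrier[OF a(1)] arrowD[OF a(1)]
  have "jordan_mult (E i j) (E i j) = 0\<^sub>m n n"
    using c a(2) by (auto simp: jordan_mult_def mat_unit_mult)
  then have "jordan_mult ?Y ?Y = 0\<^sub>m n n"
    using jordan[OF U_unit[OF a(1)] U_unit[OF a(1)]] linear_zero[OF lin] by simp
  moreover have "jordan_mult ?Y ?Y $$ (i, i) = (?Y * ?Y) $$ (i, i) + (?Y * ?Y) $$ (i, i)"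
    unfolding jordan_mult_def using c by (intro index_add_mat(1)) auto
  moreover have "(?Y * ?Y) $$ (i, i) = (\<Sum>k<n. ?Y $$ (i, k) * ?Y $$ (k, i))"
    using c by (simp add: mat_mult_index[of _ n])
  moreover have "\<dots> = (\<Sum>k<n. if k = j then ?Y $$ (i, j) * ?Y $$ (j, i) else 0)"
    using jordan_unit_image_support[OF a] c a(2) by (intro sum.cong) auto
  ultimately have "?Y $$ (i, j) * ?Y $$ (j, i) + ?Y $$ (i, j) * ?Y $$ (j, i) = 0"
    using c by simp
  then show ?thesis by (simp flip: mult_2)
qed

lemma jordan_unit_image_nonzero:
  assumes a: "arrow i j" "i \<noteq> j"
  shows "\<psi> (E i j) $$ (i, j) \<noteq> 0 \<or> \<psi> (E i j) $$ (j, i) \<noteq> 0"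
proof (rule ccontr)
  assume z: "\<not> ?thesis"
  have "\<psi> (E i j) $$ (p, q) = 0" if "p < n" "q < n" for p q
    using jordan_unit_image_support[OF a that] z by auto
  then have "\<psi> (E i j) = 0\<^sub>m n n" using jordan_unit_image_carrier[OF a(1)] by (intro eq_matI) auto
  from inj[OF U_unit[OF a(1)] this] have "E i j $$ (i, j) = (0\<^sub>m n n :: 'a mat) $$ (i, j)" by simp
  then show False using arrowD[OF a(1)] by simp
qed

text \<open>An image at the position \<open>(i, j)\<close> is called straight, in contrast to one at the transposed
  position \<open>(j, i)\<close>.\<close>

lemma jordan_unit_image_straight:
  assumes a: "arrow i j" "i \<noteq> j" and "\<psi> (E i j) $$ (i, j) \<noteq> 0"
  shows "\<psi> (E i j) = \<psi> (E i j) $$ (i, j) \<cdot>\<^sub>m E i j"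
proof (rule eq_matI)
  fix p q assume "p < dim_row (\<psi> (E i j) $$ (i, j) \<cdot>\<^sub>m E i j)" "q < dim_col (\<psi> (E i j) $$ (i, j) \<cdot>\<^sub>m E i j)"
  then show "\<psi> (E i j) $$ (p, q) = (\<psi> (E i j) $$ (i, j) \<cdot>\<^sub>m E i j) $$ (p, q)"
    using jordan_unit_image_support[OF a, of p q] jordan_unit_image_one_sided[OF a] assms(3) by auto
qed (use jordan_unit_image_carrier[OF a(1)] in auto)

lemma jordan_straight_mult_index:
  assumes a: "arrow i j" "i \<noteq> j" "\<psi> (E i j) $$ (i, j) \<noteq> 0" and jk: "arrow j k" and pq: "p < n" "q < n"
  shows "\<psi> (jordan_mult (E i j) (E j k)) $$ (p, q) = \<psi> (E i j) $$ (i, j)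
    * ((if p = i then \<psi> (E j k) $$ (j, q) else 0) + (if q = j then \<psi> (E j k) $$ (p, i) else 0))"
proof -
  have "\<psi> (jordan_mult (E i j) (E j k)) = jordan_mult (\<psi> (E i j) $$ (i, j) \<cdot>\<^sub>m E i j) (\<psi> (E j k))"
    using jordan_unit_image_straight[OF a] jordan[OF U_unit[OF a(1)] U_unit[OF jk]] by simp
  also have "\<dots> = \<psi> (E i j) $$ (i, j) \<cdot>\<^sub>m jordan_mult (E i j) (\<psi> (E j k))"
    using jordan_unit_image_carrier[OF jk] by (intro jordan_mult_smult_left) auto
  finally show ?thesis
    using jordan_unit_image_carrier[OF jk] arrowD[OF a(1)] pq
      jordan_mult_carrier[OF mat_unit_carrier jordan_unit_image_carrier[OF jk], of i j]
    by (simp add: jordan_mult_unit_index)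
qed

text \<open>The unit \<open>E i k\<close> is the Jordan product of \<open>E i j\<close> and \<open>E j k\<close>. Multiplication by a multiple of
  \<open>E i j\<close> leaves no entry at \<open>(k, i)\<close>, so the image of \<open>E i k\<close> has to live at \<open>(i, k)\<close>, and its entry
  there comes from the entry at \<open>(j, k)\<close> of the image of \<open>E j k\<close>.\<close>

lemma jordan_straight_path:
  assumes a: "arrow i j" "i \<noteq> j" "\<psi> (E i j) $$ (i, j) \<noteq> 0" and jk: "arrow j k" "j \<noteq> k" "i \<noteq> k"
  shows "\<psi> (E i k) $$ (i, k) = \<psi> (E i j) $$ (i, j) * \<psi> (E j k) $$ (j, k)" (is ?eq)
    and "\<psi> (E i k) $$ (i, k) \<noteq> 0" "\<psi> (E j k) $$ (j, k) \<noteq> 0"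
proof -
  note lt = arrowD[OF a(1)] arrowD[OF jk(1)]
  have "jordan_mult (E i j) (E j k) = E i k"
    by (rule eq_matI) (use lt a(2) jk in \<open>auto simp: jordan_mult_unit_index jordan_mult_carrier carrier_matD[OF jordan_mult_carrier[of _ n]]\<close>)
  then have e: "\<psi> (E i k) $$ (p, q) = \<psi> (E i j) $$ (i, j)
    * ((if p = i then \<psi> (E j k) $$ (j, q) else 0) + (if q = j then \<psi> (E j k) $$ (p, i) else 0))"
    if "p < n" "q < n" for p q
    using jordan_straight_mult_index[OF a jk(1) that] by simp
  show eq: ?eq using e[of i k] lt jk by simp
  have "\<psi> (E i k) $$ (k, i) = 0" using e[of k i] lt jk a by simp
  then show "\<psi> (E i k) $$ (i, k) \<noteq> 0"
    using jordan_unit_image_nonzero[OF arrow_trans[OF a(1) jk(1)] jk(3)] by simp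
  then show "\<psi> (E j k) $$ (j, k) \<noteq> 0" using eq by auto
qed

lemma jordan_straight_inverse:
  assumes a: "arrow i j" "i \<noteq> j" "\<psi> (E i j) $$ (i, j) \<noteq> 0" and ji: "arrow j i"
  shows "\<psi> (E i j) $$ (i, j) * \<psi> (E j i) $$ (j, i) = 1"
proof -
  note lt = arrowD[OF a(1)]
  have "jordan_mult (E i j) (E j i) = E i i + E j j"
    by (rule eq_matI) (use lt a(2) in \<open>auto simp: jordan_mult_unit_index jordan_mult_carrier carrier_matD[OF jordan_mult_carrier[of _ n]]\<close>)
  then have "\<psi> (jordan_mult (E i j) (E j i)) = E i i + E j j"
    using mat_linear_onD(2)[OF lin] U_unit lt diag by (simp add: arrow_def)
  then have "\<psi> (jordan_mult (E i j) (E j i)) $$ (i, i) = 1"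
    using lt a(2) by simp
  then show ?thesis using jordan_straight_mult_index[OF a ji, of i i] lt a(2) by simp
qed

text \<open>Any unit is linked to \<open>E 0 1\<close> by composable pairs: \<open>(0, 1)\<close> and \<open>(1, j)\<close> lead to \<open>E 0 j\<close>, then
  \<open>(0, i)\<close> and \<open>(i, j)\<close> lead to \<open>E i j\<close>.\<close>

lemma jordan_straight_everywhere:
  assumes n: "1 < n" and orient: "\<psi> (E 0 1) $$ (0, 1) \<noteq> 0" and a: "arrow i j"
  shows "\<psi> (E i j) $$ (i, j) \<noteq> 0"
proof -
  have first: "\<psi> (E 0 j) $$ (0, j) \<noteq> 0" if "0 < j" "j < n" for j
  proof (cases "j = 1")
    case False
    then show ?thesis
      using jordan_straight_path(2)[of 0 1 j] orient that n arrowI[of 0 1] arrowI[of 1 j] by simp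
  qed (use orient in simp)
  note lt = arrowD[OF a]
  consider "i = j" | "i = 0" "j \<noteq> 0" | "j = 0" "i \<noteq> 0" | "i \<noteq> 0" "j \<noteq> 0" "i \<noteq> j" by force
  then show ?thesis
  proof cases
    case 1
    then show ?thesis using diag lt by simp
  next
    case 2
    then show ?thesis using first lt by simp
  next
    case 3
    then have "\<psi> (E 0 i) $$ (0, i) * \<psi> (E i j) $$ (i, j) = 1"
      using jordan_straight_inverse[of 0 i] first[of i] a lt arrowI[of 0 i] by simp
    then show ?thesis by auto
  next
    case 4
    then show ?thesis using jordan_straight_path(3)[of 0 i j] first[of i] a lt arrowI[of 0 i] by simp
  qed
qed

lemma jordan_straight_multiplicative:
  assumes n: "1 < n" and orient: "\<psi> (E 0 1) $$ (0, 1) \<noteq> 0"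
  shows "x \<in> U \<Longrightarrow> y \<in> U \<Longrightarrow> \<psi> (x * y) = \<psi> x * \<psi> y"
    and "x \<in> U \<Longrightarrow> mat_trace (\<psi> x) = mat_trace x"
proof -
  define c where "c i j = \<psi> (E i j) $$ (i, j)" for i j
  have c_diag: "c i i = 1" if "i < n" for i using that diag by (simp add: c_def)
  have img: "\<psi> (E i j) = c i j \<cdot>\<^sub>m E i j" if "arrow i j" for i j
    using jordan_unit_image_straight[OF that] jordan_straight_everywhere[OF n orient that] diag c_diag[of i] arrowD[OF that]
    by (cases "i = j") (auto simp: c_def)
  have c_mult: "c i j * c j k = c i k" if a: "arrow i j" "arrow j k" for i j k
  proof -
    note nz = jordan_straight_everywhere[OF n orient a(1)]
    consider "i = j" | "j = k" | "i \<noteq> j" "i = k" | "i \<noteq> j" "j \<noteq> k" "i \<noteq> k" by blast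
    then show ?thesis
    proof cases
      case 3
      then show ?thesis
        using jordan_straight_inverse[OF a(1) _ nz] a(2) c_diag[OF arrowD(1)[OF a(1)]] unfolding c_def by simp
    next
      case 4
      then show ?thesis using jordan_straight_path(1)[OF a(1) _ nz a(2)] unfolding c_def by simp
    qed (use c_diag arrowD[OF a(1)] arrowD[OF a(2)] in simp_all)
  qed
  have prod: "\<psi> (E i j) * \<psi> (E k l) = (c i j * c k l) \<cdot>\<^sub>m (E i j * E k l)"
    if "arrow i j" "arrow k l" for i j k l
    using img[OF that(1)] img[OF that(2)]
    by (simp add: mult_smult_assoc_mat[of _ n n _ n] mult_smult_distrib[of _ n n _ n] mat_smult_smult mult.commute)
  show "\<psi> (x * y) = \<psi> x * \<psi> y" if "x \<in> U" "y \<in> U" for x y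
  proof (rule mult_ext[OF lin _ _ that])
    fix i j k assume a: "arrow i j" "arrow j k"
    then have "\<psi> (E i j) * \<psi> (E j k) = c i k \<cdot>\<^sub>m E i k"
      using prod[OF a] c_mult[OF a] arrowD[OF a(1)] by (simp add: mat_unit_mult)
    then show "\<psi> (E i j) * \<psi> (E j k) = \<psi> (E i k)" using img[OF arrow_trans[OF a]] by simp
  next
    fix i j k l assume a: "arrow i j" "arrow k l" and "j \<noteq> k"
    then show "\<psi> (E i j) * \<psi> (E k l) = 0\<^sub>m n n"
      using prod[OF a] arrowD[OF a(1)] arrowD[OF a(2)] by (simp add: mat_unit_mult)
  qed
  show "mat_trace (\<psi> x) = mat_trace x" if x: "x \<in> U" for x
  proof (cases "n = 0")
    case False
    have "mat_trace (\<psi> x) \<cdot>\<^sub>m 1\<^sub>m n = mat_trace x \<cdot>\<^sub>m 1\<^sub>m n"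
    proof (rule linear_ext[OF _ _ _ x, where F = "\<lambda>x. mat_trace (\<psi> x) \<cdot>\<^sub>m 1\<^sub>m n"])
      show "mat_linear_on n U (\<lambda>x. mat_trace (\<psi> x) \<cdot>\<^sub>m 1\<^sub>m n)"
        "mat_linear_on n U (\<lambda>x. mat_trace x \<cdot>\<^sub>m 1\<^sub>m n)"
        using mat_linear_onD[OF lin] U_carrier
        by (auto simp: mat_linear_on_def mat_trace_add_diff[of _ n] mat_trace_smult[of _ n] add_smult_distrib_right_mat[of _ n n] mat_smult_smult)
      show "mat_trace (\<psi> (E i j)) \<cdot>\<^sub>m 1\<^sub>m n = mat_trace (E i j) \<cdot>\<^sub>m 1\<^sub>m n" if "arrow i j" for i j
        using img[OF that] diag arrowD[OF that]
        by (cases "i = j") (auto simp: mat_trace_def intro!: arg_cong2[where f = smult_mat] sum.cong)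
    qed
    then have "(mat_trace (\<psi> x) \<cdot>\<^sub>m 1\<^sub>m n) $$ (0, 0) = (mat_trace x \<cdot>\<^sub>m 1\<^sub>m n) $$ (0, 0)" by simp
    then show ?thesis using False by simp
  qed (use n in simp)
qed

end

lemma mat_double_cancel:
  assumes A: "(A :: 'a mat) \<in> carrier_mat n n" and B: "B \<in> carrier_mat n n" and "A + A = B + B"
  shows "A = B"
proof (rule eq_matI)
  fix i j assume "i < dim_row B" "j < dim_col B"
  then have ij: "i < n" "j < n" using B by auto
  have "(A + A) $$ (i, j) = (B + B) $$ (i, j)" by (simp only: assms(3))
  then have "2 * A $$ (i, j) = 2 * B $$ (i, j)"
    using A B ij unfolding mult_2 by simp
  then show "A $$ (i, j) = B $$ (i, j)" unfolding mult_cancel_left by simp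
qed (use A B in auto)

lemma jordan_idempotent:
  assumes A: "(A :: 'a mat) \<in> carrier_mat n n" and "jordan_mult A A = A + A"
  shows "A * A = A"
proof (rule mat_double_cancel[OF _ A])
  show "A * A + A * A = A + A" using assms(2) by (simp only: jordan_mult_def)
qed (use A in auto)

text \<open>From \<open>e f = - f e\<close> one gets \<open>e f = e e f = - e f e = f e e = f e\<close>, so \<open>e f\<close> is its own
  negative.\<close>

lemma jordan_orthogonal_idempotents:
  assumes A: "(A :: 'a mat) \<in> carrier_mat n n" and B: "B \<in> carrier_mat n n"
    and AA: "A * A = A" and J: "jordan_mult A B = 0\<^sub>m n n"
  shows "A * B = 0\<^sub>m n n"
proof -
  have c: "A * B \<in> carrier_mat n n" "B * A \<in> carrier_mat n n" using A B by auto
  have anti: "A * B = (-1) \<cdot>\<^sub>m (B * A)"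
  proof (rule eq_matI)
    fix i j assume "i < dim_row ((-1) \<cdot>\<^sub>m (B * A))" "j < dim_col ((-1) \<cdot>\<^sub>m (B * A))"
    then have ij: "i < n" "j < n" using c by auto
    have "(A * B + B * A) $$ (i, j) = 0" using J ij by (simp add: jordan_mult_def)
    then show "(A * B) $$ (i, j) = ((-1) \<cdot>\<^sub>m (B * A)) $$ (i, j)"
      using c ij A B by (simp add: eq_neg_iff_add_eq_0)
  qed (use A B in auto)
  have "A * B = A * (A * B)" using A B AA by (simp flip: assoc_mult_mat[of A n n A n B n])
  also have "\<dots> = (-1) \<cdot>\<^sub>m (A * (B * A))"
    using A c by (subst anti) (simp add: mult_smult_distrib[of _ n n _ n])
  also have "A * (B * A) = (A * B) * A" using A B by simp
  also have "\<dots> = (-1) \<cdot>\<^sub>m ((B * A) * A)"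
    using A c by (subst anti) (simp add: mult_smult_assoc_mat[of _ n n _ n])
  also have "(B * A) * A = B * A" using A B AA by simp
  finally have BA: "A * B = B * A" by (simp add: mat_smult_smult one_smult_mat)
  show ?thesis
  proof (rule eq_matI)
    fix i j assume "i < dim_row (0\<^sub>m n n :: 'a mat)" "j < dim_col (0\<^sub>m n n :: 'a mat)"
    then have ij: "i < n" "j < n" by auto
    have "(A * B) $$ (i, j) = ((-1) \<cdot>\<^sub>m (A * B)) $$ (i, j)"
      using anti by (simp only: BA)
    then show "(A * B) $$ (i, j) = (0\<^sub>m n n :: 'a mat) $$ (i, j)"
      using ij A B by (simp add: equal_neg_zero)
  qed (use c in auto)
qed

text \<open>After conjugation the image of \<open>E 0 1\<close> is a multiple of \<open>E 0 1\<close> or of \<open>E 1 0\<close>; composing with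
  the transposition reduces the second case to the first and reverses products.\<close>

theorem jordan_automorphism:
  assumes f: "f \<in> alg_auto U jordan_mult" and n: "1 < n"
  shows "f (1\<^sub>m n) = 1\<^sub>m n" and "\<forall>x\<in>U. mat_trace (f x) = mat_trace x"
    and "(\<forall>x\<in>U. \<forall>y\<in>U. f (x * y) = f x * f y) \<or> (\<forall>x\<in>U. \<forall>y\<in>U. f (x * y) = f y * f x)"
proof -
  have B: "f \<in> Bij U" and jord: "\<And>x y. x \<in> U \<Longrightarrow> y \<in> U \<Longrightarrow> f (jordan_mult x y) = jordan_mult (f x) (f y)"
    using f by (auto simp: alg_auto_def)
  have lin: "mat_linear_on n U f"
    using f Bij_U(1)[OF B] U_carrier by (auto simp: alg_auto_def mat_linear_on_def)
  note fc = mat_linear_onD(1)[OF lin]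
  note f0 = linear_zero[OF lin]
  have finj: "x = 0\<^sub>m n n" if "x \<in> U" "f x = 0\<^sub>m n n" for x
    using Bij_U(2)[OF B that(1) U_zero] that(2) f0 by simp
  obtain x where x: "x \<in> U" "f x = 1\<^sub>m n" using Bij_U(3)[OF B U_one] by blast
  have "jordan_mult x (1\<^sub>m n) = x + x" using U_carrier[OF x(1)] by (simp add: jordan_mult_def)
  then have "f x + f x = jordan_mult (f x) (f (1\<^sub>m n))"
    using jord[OF x(1) U_one] mat_linear_onD(2)[OF lin x(1) x(1)] by simp
  also have "\<dots> = f (1\<^sub>m n) + f (1\<^sub>m n)"
    using fc[OF U_one] by (simp add: x jordan_mult_def)
  finally have two: "f (1\<^sub>m n) + f (1\<^sub>m n) = 1\<^sub>m n + 1\<^sub>m n" by (simp only: x)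
  show "f (1\<^sub>m n) = 1\<^sub>m n" by (rule mat_double_cancel[OF fc[OF U_one] _ two]) simp

  have EU: "E i i \<in> U" if "i < n" for i using that by (intro U_unit) (simp add: arrow_def)
  note ec = fc[OF EU]
  have idem: "f (E i i) * f (E i i) = f (E i i)" if "i < n" for i
  proof (rule jordan_idempotent[OF ec[OF that]])
    have "jordan_mult (E i i) (E i i) = E i i + E i i" using that by (simp add: jordan_mult_def mat_unit_mult)
    then show "jordan_mult (f (E i i)) (f (E i i)) = f (E i i) + f (E i i)"
      using jord[OF EU[OF that] EU[OF that]] mat_linear_onD(2)[OF lin EU[OF that] EU[OF that]] by simp
  qed
  have orth: "f (E i i) * f (E j j) = 0\<^sub>m n n" if "i < n" "j < n" "i \<noteq> j" for i j
  proof (rule jordan_orthogonal_idempotents[OF ec[OF that(1)] ec[OF that(2)] idem[OF that(1)]])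
    have "jordan_mult (E i i) (E j j) = 0\<^sub>m n n" using that by (simp add: jordan_mult_def mat_unit_mult)
    then show "jordan_mult (f (E i i)) (f (E j j)) = 0\<^sub>m n n"
      using jord[OF EU[OF that(1)] EU[OF that(2)]] f0 by simp
  qed
  have nz: "f (E i i) \<noteq> 0\<^sub>m n n" if "i < n" for i
  proof
    assume "f (E i i) = 0\<^sub>m n n"
    then have "E i i $$ (i, i) = (0\<^sub>m n n :: 'a mat) $$ (i, i)" using finj[OF EU[OF that]] by simp
    then show False using that by simp
  qed
  obtain P Q where PQ: "inverse_pair n P Q" and diag: "\<And>i. i < n \<Longrightarrow> Q * f (E i i) * P = E i i"
    using orthogonal_idempotents_diagonal[of n "\<lambda>i. f (E i i)", OF ec idem orth nz] by blast
  define \<psi> where "\<psi> x = Q * f x * P" for x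
  have lin\<psi>: "mat_linear_on n U \<psi>" unfolding \<psi>_def by (rule conj_linear[OF PQ lin])
  have inj\<psi>: "\<forall>x\<in>U. \<psi> x = 0\<^sub>m n n \<longrightarrow> x = 0\<^sub>m n n"
  proof (intro ballI impI)
    fix x assume that: "x \<in> U" "\<psi> x = 0\<^sub>m n n"
    have "f x = P * 0\<^sub>m n n * Q" using conj_cancel[OF PQ fc[OF that(1)]] that(2) by (simp add: \<psi>_def)
    also have "\<dots> = 0\<^sub>m n n" using inverse_pair_carrier[OF PQ] by simp
    finally show "x = 0\<^sub>m n n" using finj that by blast
  qed
  have jord\<psi>: "\<forall>x\<in>U. \<forall>y\<in>U. \<psi> (jordan_mult x y) = jordan_mult (\<psi> x) (\<psi> y)"
    unfolding \<psi>_def using jord fc jordan_conj[OF PQ] by simp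
  have diag\<psi>: "\<forall>i<n. \<psi> (E i i) = E i i" using diag by (simp add: \<psi>_def)
  note \<psi>c = mat_linear_onD(1)[OF lin\<psi>]
  have \<psi>_trace: "mat_trace (f x) = mat_trace (\<psi> x)" if "x \<in> U" for x
    using mat_trace_conj[OF PQ fc[OF that]] by (simp add: \<psi>_def)
  have \<psi>_inj: "f x = y" if "x \<in> U" "y \<in> carrier_mat n n" "\<psi> x = Q * y * P" for x y
    using conj_inject[OF PQ fc[OF that(1)] that(2)] that(3) by (simp add: \<psi>_def)
  have "(\<forall>x\<in>U. mat_trace (f x) = mat_trace x) \<and> ((\<forall>x\<in>U. \<forall>y\<in>U. f (x * y) = f x * f y) \<or> (\<forall>x\<in>U. \<forall>y\<in>U. f (x * y) = f y * f x))"
  proof (cases "\<psi> (E 0 1) $$ (0, 1) = 0")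
    case False
    note M = jordan_straight_multiplicative[OF lin\<psi> inj\<psi> jord\<psi> diag\<psi> n False]
    have "f (x * y) = f x * f y" if "x \<in> U" "y \<in> U" for x y
      using M(1)[OF that] U_mult[OF that] fc that
      by (intro \<psi>_inj) (auto simp: \<psi>_def conj_mult[OF PQ] intro!: mult_carrier_mat[of _ n n _ n])
    moreover have "mat_trace (f x) = mat_trace x" if "x \<in> U" for x
      using M(2)[OF that] \<psi>_trace that by simp
    ultimately show ?thesis by blast
  next
    case True
    define \<tau> where "\<tau> x = transpose_mat (\<psi> x)" for x
    have lin\<tau>: "mat_linear_on n U \<tau>" unfolding \<tau>_def by (rule mat_linear_transpose[OF lin\<psi>])
    have inj\<tau>: "\<forall>x\<in>U. \<tau> x = 0\<^sub>m n n \<longrightarrow> x = 0\<^sub>m n n"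
      using inj\<psi> transpose_transpose[of "\<psi> _"] unfolding \<tau>_def by (metis zero_transpose_mat)
    have jord\<tau>: "\<forall>x\<in>U. \<forall>y\<in>U. \<tau> (jordan_mult x y) = jordan_mult (\<tau> x) (\<tau> y)"
      using \<psi>c jord\<psi> by (simp add: \<tau>_def jordan_mult_transpose)
    have diag\<tau>: "\<forall>i<n. \<tau> (E i i) = E i i"
      using diag\<psi> by (auto simp: \<tau>_def intro!: eq_matI)
    have a01: "arrow 0 1" using n by (simp add: arrowI)
    have "\<tau> (E 0 1) $$ (0, 1) \<noteq> 0"
      using jordan_unit_image_nonzero[OF lin\<psi> inj\<psi> jord\<psi> diag\<psi> a01] True n \<psi>c[OF U_unit[OF a01]]
      by (simp add: \<tau>_def)
    note M = jordan_straight_multiplicative[OF lin\<tau> inj\<tau> jord\<tau> diag\<tau> n this]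
    have "f (x * y) = f y * f x" if "x \<in> U" "y \<in> U" for x y
    proof (rule \<psi>_inj)
      have "\<psi> (x * y) = transpose_mat (\<tau> x * \<tau> y)"
        unfolding M(1)[OF that, symmetric] by (simp add: \<tau>_def)
      also have "\<dots> = \<psi> y * \<psi> x"
        using \<psi>c that by (simp add: \<tau>_def transpose_mult[of _ n n _ n])
      finally show "\<psi> (x * y) = Q * (f y * f x) * P"
        using fc that by (simp add: \<psi>_def conj_mult[OF PQ])
    qed (use U_mult[OF that] fc that in \<open>auto intro!: mult_carrier_mat[of _ n n _ n]\<close>)
    moreover have "mat_trace (f x) = mat_trace x" if "x \<in> U" for x
      using M(2)[OF that] \<psi>_trace that \<psi>c by (simp add: \<tau>_def mat_trace_transpose[of _ n])
    ultimately show ?thesis by blast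
  qed
  then show "\<forall>x\<in>U. mat_trace (f x) = mat_trace x"
    "(\<forall>x\<in>U. \<forall>y\<in>U. f (x * y) = f x * f y) \<or> (\<forall>x\<in>U. \<forall>y\<in>U. f (x * y) = f y * f x)"
    by blast+
qed

end

section \<open>Matrices with simple spectrum\<close>

text \<open>The vector \<open>(A - \<nu>\<^sub>1) \<cdots> (A - \<nu>\<^sub>m) v\<close>.\<close>

fun shift_prod :: "'a::comm_ring_1 mat \<Rightarrow> 'a list \<Rightarrow> 'a vec \<Rightarrow> 'a vec" where
  "shift_prod A [] v = v"
| "shift_prod A (\<nu> # l) v = A *\<^sub>v shift_prod A l v - \<nu> \<cdot>\<^sub>v shift_prod A l v"

lemma shift_prod_carrier:
  "A \<in> carrier_mat n n \<Longrightarrow> v \<in> carrier_vec n \<Longrightarrow> shift_prod A l v \<in> carrier_vec n"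
  by (induction l) auto

lemma shift_prod_add_smult:
  fixes A :: "'a::field mat"
  assumes A: "A \<in> carrier_mat n n" and v: "v \<in> carrier_vec n" and u: "u \<in> carrier_vec n"
  shows "shift_prod A l (v + c \<cdot>\<^sub>v u) = shift_prod A l v + c \<cdot>\<^sub>v shift_prod A l u"
proof (induction l)
  case (Cons \<nu> l)
  let ?v = "shift_prod A l v" and ?u = "shift_prod A l u"
  have c: "?v \<in> carrier_vec n" "?u \<in> carrier_vec n" by (simp_all add: shift_prod_carrier A v u)
  have "A *\<^sub>v (?v + c \<cdot>\<^sub>v ?u) = A *\<^sub>v ?v + c \<cdot>\<^sub>v (A *\<^sub>v ?u)"
    using A c by (simp add: mult_add_distrib_mat_vec[of _ n n] mult_mat_vec[OF A])
  then have "shift_prod A (\<nu> # l) (v + c \<cdot>\<^sub>v u)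
      = A *\<^sub>v ?v + c \<cdot>\<^sub>v (A *\<^sub>v ?u) - \<nu> \<cdot>\<^sub>v (?v + c \<cdot>\<^sub>v ?u)"
    by (simp add: Cons)
  also have "\<dots> = A *\<^sub>v ?v - \<nu> \<cdot>\<^sub>v ?v + c \<cdot>\<^sub>v (A *\<^sub>v ?u - \<nu> \<cdot>\<^sub>v ?u)"
    using A c by (intro eq_vecI) (auto simp: algebra_simps simp del: index_mult_mat_vec)
  finally show ?case by simp
qed simp

lemma shift_prod_eigenvector:
  fixes A :: "'a::field mat"
  assumes A: "A \<in> carrier_mat n n" and u: "u \<in> carrier_vec n" and "A *\<^sub>v u = \<nu> \<cdot>\<^sub>v u"
  shows "shift_prod A l u = (\<Prod>\<kappa>\<leftarrow>l. \<nu> - \<kappa>) \<cdot>\<^sub>v u"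
proof (induction l)
  case (Cons \<kappa> l)
  define g where "g = (\<Prod>\<kappa>\<leftarrow>l. \<nu> - \<kappa>)"
  have "A *\<^sub>v (g \<cdot>\<^sub>v u) = g \<cdot>\<^sub>v (\<nu> \<cdot>\<^sub>v u)" using mult_mat_vec[OF A u] assms(3) by simp
  then have "shift_prod A (\<kappa> # l) u = g \<cdot>\<^sub>v (\<nu> \<cdot>\<^sub>v u) - \<kappa> \<cdot>\<^sub>v (g \<cdot>\<^sub>v u)"
    using Cons by (simp add: g_def)
  also have "\<dots> = ((\<nu> - \<kappa>) * g) \<cdot>\<^sub>v u" using u by (intro eq_vecI) (auto simp: algebra_simps)
  finally show ?case by (simp add: g_def)
qed (use u in auto)

text \<open>A vector killed by a product of distinct linear factors in \<open>A\<close> is a sum of eigenvectors. The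
  statement speaks of orthogonality to \<open>w\<close> instead of spans, which is the form in which it shows that
  a matrix of eigenvectors is invertible.\<close>

lemma orthogonal_to_eigenvectors:
  fixes A :: "'a::field mat"
  assumes A: "A \<in> carrier_mat n n" and w: "w \<in> carrier_vec n"
    and eig: "\<And>\<nu> u. u \<in> carrier_vec n \<Longrightarrow> A *\<^sub>v u = \<nu> \<cdot>\<^sub>v u \<Longrightarrow> u \<bullet> w = 0"
    and "distinct l" "v \<in> carrier_vec n" "shift_prod A l v = 0\<^sub>v n"
  shows "v \<bullet> w = 0"
  using assms(4-)
proof (induction l arbitrary: v)
  case Nil
  then show ?case using w by simp
next
  case (Cons \<nu> l)
  define u where "u = shift_prod A l v"
  have u: "u \<in> carrier_vec n" using Cons.prems by (simp add: u_def shift_prod_carrier A)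
  have Au: "A *\<^sub>v u = \<nu> \<cdot>\<^sub>v u"
  proof (rule eq_vecI)
    fix i assume "i < dim_vec (\<nu> \<cdot>\<^sub>v u)"
    then have i: "i < n" using u by simp
    have "(A *\<^sub>v u - \<nu> \<cdot>\<^sub>v u) $ i = 0" using Cons.prems(3) i by (simp add: u_def)
    then show "(A *\<^sub>v u) $ i = (\<nu> \<cdot>\<^sub>v u) $ i" using A u i by simp
  qed (use A u in auto)
  define g where "g = (\<Prod>\<kappa>\<leftarrow>l. \<nu> - \<kappa>)"
  have g: "g \<noteq> 0" using Cons.prems(1) by (auto simp: g_def prod_list_zero_iff)
  \<comment> \<open>\<open>u\<close> is \<open>g\<close> times the component of \<open>v\<close> for the eigenvalue \<open>\<nu>\<close>; removing it leaves a vector killed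
    by the remaining factors\<close>
  define v' where "v' = v + (- 1 / g) \<cdot>\<^sub>v u"
  have v': "v' \<in> carrier_vec n" using Cons.prems u by (simp add: v'_def)
  have "shift_prod A l v' = u + (- 1 / g) \<cdot>\<^sub>v (g \<cdot>\<^sub>v u)"
    using Cons.prems u A by (simp add: v'_def shift_prod_add_smult[of _ n] shift_prod_eigenvector[OF A u Au] g_def flip: u_def)
  also have "\<dots> = 0\<^sub>v n" using u g by (intro eq_vecI) auto
  finally have "v' \<bullet> w = 0" using Cons.IH Cons.prems v' by simp
  then show ?case using Cons.prems u w eig[OF u Au] by (simp add: v'_def add_scalar_prod_distrib[of _ n])
qed

text \<open>One eigenvector for each eigenvalue gives the first rows of a square matrix \<open>M\<close>, completed by
  zero rows. As the eigenspaces are lines, a vector in the kernel of \<open>M\<close> is orthogonal to all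
  eigenvectors; these span, so it vanishes. Hence \<open>M\<close> is invertible and has no zero row, that is,
  there are \<open>n\<close> eigenvalues.\<close>

lemma simple_eigenvalues_diagonalize:
  fixes A :: "'a::field mat"
  assumes A: "A \<in> carrier_mat n n"
    and ann: "distinct l" "\<And>v. v \<in> carrier_vec n \<Longrightarrow> shift_prod A l v = 0\<^sub>v n"
    and simple: "\<And>\<nu> u v. u \<in> carrier_vec n \<Longrightarrow> v \<in> carrier_vec n \<Longrightarrow> u \<noteq> 0\<^sub>v n
      \<Longrightarrow> A *\<^sub>v u = \<nu> \<cdot>\<^sub>v u \<Longrightarrow> A *\<^sub>v v = \<nu> \<cdot>\<^sub>v v \<Longrightarrow> \<exists>k. v = k \<cdot>\<^sub>v u"
  shows "\<exists>M N d. inverse_pair n M N \<and> inj_on d {..<n} \<and> (\<forall>k<n. A *\<^sub>v row M k = d k \<cdot>\<^sub>v row M k)"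
proof -
  define S where "S = {\<nu>. poly (char_poly A) \<nu> = 0}"
  have deg: "degree (char_poly A) = n" "char_poly A \<noteq> 0" using degree_monic_char_poly[OF A] by auto
  have S: "finite S" "card S \<le> n"
    using deg card_poly_roots_bound[of "char_poly A"] poly_roots_finite[of "char_poly A"] by (auto simp: S_def)
  have "\<exists>u. u \<in> carrier_vec n \<and> u \<noteq> 0\<^sub>v n \<and> A *\<^sub>v u = \<nu> \<cdot>\<^sub>v u" if "\<nu> \<in> S" for \<nu>
    using that A eigenvalue_root_char_poly[OF A] by (auto simp: S_def eigenvalue_def eigenvector_def)
  then obtain u where u: "\<And>\<nu>. \<nu> \<in> S \<Longrightarrow> u \<nu> \<in> carrier_vec n \<and> u \<nu> \<noteq> 0\<^sub>v n \<and> A *\<^sub>v u \<nu> = \<nu> \<cdot>\<^sub>v u \<nu>"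
    by metis
  obtain d where d: "bij_betw d {..<card S} S"
    using ex_bij_betw_nat_finite[OF S(1)] by (auto simp: atLeast0LessThan)
  define M where "M = mat n n (\<lambda>(k, j). if k < card S then u (d k) $ j else 0)"
  have M: "M \<in> carrier_mat n n" by (simp add: M_def)
  have rowM: "row M k = u (d k)" if "k < card S" for k
  proof -
    have "u (d k) \<in> carrier_vec n" using u d that by (auto simp: bij_betw_def)
    then show ?thesis using that S(2) by (auto simp: M_def intro!: eq_vecI)
  qed
  have "\<exists>N. inverse_pair n M N"
  proof (rule ex_inverse_pair[OF M])
    fix w assume w: "w \<in> carrier_vec n" "M *\<^sub>v w = 0\<^sub>v n"
    have uw: "u \<nu> \<bullet> w = 0" if "\<nu> \<in> S" for \<nu>
    proof -
      have "\<nu> \<in> d ` {..<card S}" using d that by (simp add: bij_betw_def)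
      then obtain k where k: "k < card S" "\<nu> = d k" by auto
      have "row M k \<bullet> w = (M *\<^sub>v w) $ k" using M k S(2) by simp
      then show ?thesis using w k S(2) rowM by simp
    qed
    have eig: "v \<bullet> w = 0" if v: "v \<in> carrier_vec n" "A *\<^sub>v v = \<nu> \<cdot>\<^sub>v v" for \<nu> v
    proof (cases "v = 0\<^sub>v n")
      case False
      then have "\<nu> \<in> S" using v A eigenvalue_root_char_poly[OF A] by (auto simp: S_def eigenvalue_def eigenvector_def)
      then obtain k where "v = k \<cdot>\<^sub>v u \<nu>" using simple[of "u \<nu>" v \<nu>] u v by blast
      then show ?thesis using uw[OF \<open>\<nu> \<in> S\<close>] u[OF \<open>\<nu> \<in> S\<close>] w by simp
    qed (use w in simp)
    have "w $ i = 0" if "i < n" for i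
    proof -
      have "unit_vec n i \<bullet> w = 0"
        by (rule orthogonal_to_eigenvectors[OF A w(1) _ ann(1)]) (use eig ann(2) in auto)
      then show ?thesis using that w by simp
    qed
    then show "w = 0\<^sub>v n" using w by auto
  qed
  then obtain N where N: "inverse_pair n M N" by blast
  have "card S = n"
  proof (rule ccontr)
    assume "card S \<noteq> n"
    then have lt: "card S < n" using S(2) by simp
    let ?m = "card S"
    have "(M * N) $$ (?m, ?m) = (\<Sum>k<n. M $$ (?m, k) * N $$ (k, ?m))"
      using inverse_pair_carrier[OF N] lt by (simp add: mat_mult_index[of _ n])
    also have "\<dots> = 0" using lt by (intro sum.neutral) (simp add: M_def)
    finally show False using N lt by (simp add: inverse_pair_def)
  qed
  then show ?thesis using N d u rowM by (intro exI[of _ M] exI[of _ N] exI[of _ d]) (auto simp: bij_betw_def)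
qed

section \<open>The image of a regular diagonal matrix under a Lie automorphism\<close>

text \<open>The larger exponent of a sum of two powers of 3 can be read off from the size of the sum. So
  the powers of 3 have pairwise distinct differences.\<close>

lemma power3_sum_nat:
  assumes "3 ^ i + 3 ^ l = 3 ^ k + (3 ^ j :: nat)" "i \<noteq> j"
  shows "i = k \<and> l = j"
proof -
  have top: "max p q = m" if "3 ^ p + (3 ^ q :: nat) = s" "3 ^ m < s" "s < 3 ^ Suc m" for p q m s
  proof -
    have "(3 ^ max p q :: nat) < 3 ^ Suc m" using that by (auto simp: max_def)
    then have le: "max p q \<le> m" by (metis less_Suc_eq_le one_less_numeral_iff power_less_imp_less_exp semiring_norm(77))
    have "(3 ^ m :: nat) < 2 * 3 ^ max p q"
    proof -
      have "(3 ^ p :: nat) \<le> 3 ^ max p q" "(3 ^ q :: nat) \<le> 3 ^ max p q" by (auto intro: power_increasing)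
      then show ?thesis using that by linarith
    qed
    also have "\<dots> < (3 ^ Suc (max p q) :: nat)" by simp
    finally have "m \<le> max p q" by (metis less_Suc_eq_le one_less_numeral_iff power_less_imp_less_exp semiring_norm(77))
    with le show ?thesis by (rule antisym)
  qed
  have bounds: "3 ^ max p q < 3 ^ p + (3 ^ q :: nat)" "3 ^ p + (3 ^ q :: nat) < 3 ^ Suc (max p q)" for p q
  proof -
    have "(3 ^ p :: nat) \<le> 3 ^ max p q" "(3 ^ q :: nat) \<le> 3 ^ max p q" by (auto intro: power_increasing)
    moreover have "(0 :: nat) < 3 ^ max p q" by simp
    ultimately show "3 ^ p + (3 ^ q :: nat) < 3 ^ Suc (max p q)" unfolding power_Suc by linarith
    show "3 ^ max p q < 3 ^ p + (3 ^ q :: nat)" by (simp add: max_def)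
  qed
  have "max i l = max k j"
    using top[OF assms(1)] bounds[of k j] by simp
  then consider "i = k" | "i = j" | "l = k" "i \<noteq> k" | "l = j" by (auto simp: max_def split: if_splits)
  then show ?thesis
  proof cases
    case 3
    then have "(3 ^ i :: nat) = 3 ^ j" using assms(1) by simp
    then show ?thesis using assms(2) by simp
  qed (use assms in auto)
qed

context block_triangular
begin

definition gap_weight :: "nat \<Rightarrow> 'a" where "gap_weight i = of_nat (3 ^ i)"

lemma gap_weight_inj: "gap_weight i = gap_weight j \<longleftrightarrow> i = j"
  unfolding gap_weight_def of_nat_eq_iff by simp

lemma gap_weight_differences:
  assumes "gap_weight i - gap_weight j = gap_weight k - gap_weight l" "i \<noteq> j"
  shows "i = k" "j = l"
proof -
  have "of_nat (3 ^ i + 3 ^ l) = (of_nat (3 ^ k + 3 ^ j) :: 'a)"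
    using assms(1) unfolding gap_weight_def of_nat_add by (simp only: diff_eq_eq) (simp add: algebra_simps)
  then have "(3 ^ i + 3 ^ l :: nat) = 3 ^ k + 3 ^ j" unfolding of_nat_eq_iff .
  from power3_sum_nat[OF this assms(2)] show "i = k" "j = l" by auto
qed

text \<open>The first block is invariant, so an eigenvector of the leading diagonal block of \<open>x\<close>, extended
  by zeros, is an eigenvector of \<open>x\<close>.\<close>

lemma first_block_eigenvector:
  assumes x: "x \<in> U" and n: "0 < n"
  shows "\<exists>c \<mu>. c \<in> carrier_vec n \<and> c \<noteq> 0\<^sub>v n \<and> x *\<^sub>v c = \<mu> \<cdot>\<^sub>v c
    \<and> (\<forall>i<n. b 0 < b i \<longrightarrow> c $ i = 0)"
proof -
  define m where "m = Suc (Max {j. j < n \<and> b j = b 0})"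
  have fin: "finite {j. j < n \<and> b j = b 0}" by simp
  have m0: "Max {j. j < n \<and> b j = b 0} \<in> {j. j < n \<and> b j = b 0}"
    using n by (intro Max_in[OF fin]) auto
  then have mn: "m \<le> n" "0 < m" by (auto simp: m_def)
  have block: "j < m \<longleftrightarrow> b j = b 0" if "j < n" for j
  proof
    assume "j < m"
    then have "b j \<le> b (Max {j. j < n \<and> b j = b 0})" by (intro b_mono) (simp add: m_def)
    then show "b j = b 0" using m0 b_mono[of 0 j] by auto
  next
    assume "b j = b 0"
    then have "j \<le> Max {j. j < n \<and> b j = b 0}" using that by (intro Max_ge[OF fin]) simp
    then show "j < m" unfolding m_def by (rule le_imp_less_Suc)
  qed
  define X where "X = mat m m (\<lambda>(i, j). x $$ (i, j))"
  have X: "X \<in> carrier_mat m m" by (simp add: X_def)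
  have "degree (char_poly X) > 0" using degree_monic_char_poly[OF X] mn by simp
  then obtain \<mu> where "poly (char_poly X) \<mu> = 0" using alg_closed_imp_poly_has_root by blast
  then obtain v where v: "v \<in> carrier_vec m" "v \<noteq> 0\<^sub>v m" "X *\<^sub>v v = \<mu> \<cdot>\<^sub>v v"
    using eigenvalue_root_char_poly[OF X] X by (auto simp: eigenvalue_def eigenvector_def)
  define c where "c = vec n (\<lambda>i. if i < m then v $ i else 0)"
  have "c \<noteq> 0\<^sub>v n"
  proof
    assume "c = 0\<^sub>v n"
    then have "c $ i = 0" if "i < m" for i using that mn by simp
    then have "v $ i = 0" if "i < m" for i using that mn by (simp add: c_def)
    then show False using v by auto
  qed
  moreover have "x *\<^sub>v c = \<mu> \<cdot>\<^sub>v c"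
  proof (rule eq_vecI)
    fix i assume "i < dim_vec (\<mu> \<cdot>\<^sub>v c)"
    then have i: "i < n" by (simp add: c_def)
    have "(x *\<^sub>v c) $ i = (\<Sum>k\<in>{0..<n}. x $$ (i, k) * c $ k)"
      using U_carrier[OF x] i by (auto simp: scalar_prod_def c_def)
    also have "\<dots> = (\<Sum>k\<in>{0..<m}. x $$ (i, k) * v $ k)"
      using mn by (intro sum.mono_neutral_cong_right) (auto simp: c_def)
    also have "\<dots> = \<mu> * c $ i"
    proof (cases "i < m")
      case True
      have "(\<Sum>k\<in>{0..<m}. x $$ (i, k) * v $ k) = (X *\<^sub>v v) $ i"
        using True v(1) by (auto simp: X_def scalar_prod_def)
      then show ?thesis using True v mn by (simp add: c_def)
    next
      case False
      have "x $$ (i, k) = 0" if "k < m" for k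
        using False that mn block[OF i] block[of k] b_mono[of 0 i] x i by (auto simp: U_eq)
      then show ?thesis using False i by (simp add: c_def)
    qed
    finally show "(x *\<^sub>v c) $ i = (\<mu> \<cdot>\<^sub>v c) $ i" using i by (simp add: c_def)
  qed (use U_carrier[OF x] in \<open>simp add: c_def\<close>)
  moreover have "c $ i = 0" if "i < n" "b 0 < b i" for i
    using that block[OF that(1)] by (simp add: c_def)
  moreover have "c \<in> carrier_vec n" by (simp add: c_def)
  ultimately show ?thesis by blast
qed

context
  fixes F :: "'a mat \<Rightarrow> 'a mat"
  assumes n: "1 < n"
    and lin: "mat_linear_on n U F"
    and bij: "bij_betw F U U"
    and lie: "\<forall>x\<in>U. \<forall>y\<in>U. F (lie_bracket x y) = lie_bracket (F x) (F y)"
begin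

lemma F_closed: "x \<in> U \<Longrightarrow> F x \<in> U"
  using bij by (auto simp: bij_betw_def)

lemma F_inj: "x \<in> U \<Longrightarrow> y \<in> U \<Longrightarrow> F x = F y \<Longrightarrow> x = y"
  using bij by (auto simp: bij_betw_def dest: inj_onD)

lemma F_surj: "y \<in> U \<Longrightarrow> \<exists>x\<in>U. F x = y"
  using bij unfolding bij_betw_def by (metis imageE)

text \<open>Let \<open>A\<close> be the transpose of \<open>x = F h\<close>, let \<open>x c = \<mu> c\<close> with \<open>c\<close> supported in the first block, and let
  \<open>z r\<close> be the preimage of \<open>c r\<close> under \<open>F\<close>. Then \<open>r \<mapsto> z r\<close> is linear and injective, and it turns \<open>A\<close>
  into the diagonal operator that multiplies the entry \<open>(i, j)\<close> by \<open>\<mu> - (h i - h j)\<close>. So \<open>A\<close> is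
  killed by a product of distinct linear factors. An eigenspace for \<open>\<nu> \<noteq> \<mu>\<close> lives at a single
  position \<open>(i, j)\<close>, so it has dimension at most 1. For \<open>\<nu> = \<mu>\<close> the matrices \<open>z r\<close> are diagonal and
  commute, hence so do the matrices \<open>c r\<close>, and comparing \<open>c (r c) s\<close> with \<open>c (s c) r\<close> shows that \<open>r\<close>
  and \<open>s\<close> are proportional unless \<open>c\<close> is orthogonal to the whole eigenspace. This cannot happen: \<open>c\<close>
  is orthogonal to the other eigenspaces as well, and together they span.\<close>

lemma F_regular_diagonalizable:
  "\<exists>P Q d. inverse_pair n P Q \<and> inj_on d {..<n} \<and> Q * F (mat_diag n gap_weight) * P = mat_diag n d"
proof -
  define h where "h = mat_diag n gap_weight"
  define x where "x = F h"
  have h: "h \<in> U" by (simp add: h_def mat_diag_U)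
  have xU: "x \<in> U" unfolding x_def by (rule F_closed[OF h])
  note x = U_carrier[OF xU]
  define A where "A = transpose_mat x"
  have A: "A \<in> carrier_mat n n" using x by (simp add: A_def)
  obtain c \<mu> where c: "c \<in> carrier_vec n" "c \<noteq> 0\<^sub>v n" "x *\<^sub>v c = \<mu> \<cdot>\<^sub>v c"
    and c0: "\<And>i. i < n \<Longrightarrow> b 0 < b i \<Longrightarrow> c $ i = 0"
    using first_block_eigenvector[OF xU] n by auto
  obtain i0 where i0: "i0 < n" "c $ i0 \<noteq> 0" using c(1,2) by (metis eq_vecI carrier_vecD index_zero_vec)
  \<comment> \<open>the matrix \<open>c r\<close>, a column times a row\<close>
  define C where "C r = mat n n (\<lambda>(i, j). c $ i * r $ j)" for r
  have Cc [simp]: "C r \<in> carrier_mat n n" for r by (simp add: C_def)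
  have CU: "C r \<in> U" for r
  proof (rule U_memI)
    fix i j assume ij: "i < n" "j < n" "\<not> arrow i j"
    then have "b 0 < b i" using b_mono[of 0 j] by (auto simp: arrow_def)
    then show "C r $$ (i, j) = 0" using c0 ij by (simp add: C_def)
  qed simp
  have C_eq: "r = s" if "r \<in> carrier_vec n" "s \<in> carrier_vec n" "C r = C s" for r s
  proof (rule eq_vecI)
    fix j assume "j < dim_vec s"
    then have j: "j < n" using that by simp
    have "C r $$ (i0, j) = C s $$ (i0, j)" by (simp only: that)
    then show "r $ j = s $ j" using i0 j by (simp add: C_def)
  qed (use that in auto)
  have xC: "lie_bracket x (C r) = C (\<mu> \<cdot>\<^sub>v r - A *\<^sub>v r)" if r: "r \<in> carrier_vec n" for r
  proof (rule eq_matI)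
    fix i j assume "i < dim_row (C (\<mu> \<cdot>\<^sub>v r - A *\<^sub>v r))" "j < dim_col (C (\<mu> \<cdot>\<^sub>v r - A *\<^sub>v r))"
    then have ij: "i < n" "j < n" by (simp_all add: C_def)
    have "(x * C r) $$ (i, j) = (\<Sum>k<n. x $$ (i, k) * c $ k) * r $ j"
      using ij x by (simp add: mat_mult_index[of _ n] C_def sum_distrib_right mult.assoc)
    also have "(\<Sum>k<n. x $$ (i, k) * c $ k) = (x *\<^sub>v c) $ i"
      using ij x c(1) by (auto simp: scalar_prod_def atLeast0LessThan intro!: sum.cong)
    finally have 1: "(x * C r) $$ (i, j) = \<mu> * c $ i * r $ j" using c ij by simp
    have "(C r * x) $$ (i, j) = c $ i * (\<Sum>k<n. x $$ (k, j) * r $ k)"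
      using ij x by (simp add: mat_mult_index[of _ n] C_def sum_distrib_left mult_ac)
    also have "(\<Sum>k<n. x $$ (k, j) * r $ k) = (A *\<^sub>v r) $ j"
      using ij x r by (auto simp: A_def scalar_prod_def atLeast0LessThan intro!: sum.cong)
    finally have 2: "(C r * x) $$ (i, j) = c $ i * (A *\<^sub>v r) $ j" .
    have "lie_bracket x (C r) $$ (i, j) = (x * C r) $$ (i, j) - (C r * x) $$ (i, j)"
      unfolding lie_bracket_def using ij x by (intro index_minus_mat(1)) (auto simp: C_def)
    also have "\<dots> = c $ i * (\<mu> * r $ j - (A *\<^sub>v r) $ j)"
      unfolding 1 2 by (simp add: algebra_simps)
    also have "\<dots> = C (\<mu> \<cdot>\<^sub>v r - A *\<^sub>v r) $$ (i, j)"
      using ij r A by (simp add: C_def del: index_mult_mat_vec)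
    finally show "lie_bracket x (C r) $$ (i, j) = C (\<mu> \<cdot>\<^sub>v r - A *\<^sub>v r) $$ (i, j)" .
  qed (use lie_bracket_carrier[OF x Cc[of r]] in \<open>auto simp: C_def\<close>)
  have "\<forall>r. \<exists>z\<in>U. F z = C r" using F_surj CU by blast
  then obtain z where zU: "\<And>r. z r \<in> U" and Fz: "\<And>r. F (z r) = C r" by metis
  have z_shift: "z (A *\<^sub>v r - \<nu> \<cdot>\<^sub>v r) $$ (i, j) = (\<mu> - (gap_weight i - gap_weight j) - \<nu>) * z r $$ (i, j)"
    if r: "r \<in> carrier_vec n" and ij: "i < n" "j < n" for r \<nu> i j
  proof -
    have hz: "lie_bracket h (z r) \<in> U" by (rule U_lie[OF h zU])
    have "F ((\<mu> - \<nu>) \<cdot>\<^sub>m z r - lie_bracket h (z r)) = (\<mu> - \<nu>) \<cdot>\<^sub>m C r - lie_bracket x (C r)"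
      using linear_diff[OF lin U_smult[OF zU] hz] mat_linear_onD(3)[OF lin zU] lie h zU Fz by (simp add: x_def)
    also have "\<dots> = C (A *\<^sub>v r - \<nu> \<cdot>\<^sub>v r)"
      unfolding xC[OF r] using r A by (intro eq_matI) (auto simp: C_def algebra_simps simp del: index_mult_mat_vec)
    finally have "F ((\<mu> - \<nu>) \<cdot>\<^sub>m z r - lie_bracket h (z r)) = F (z (A *\<^sub>v r - \<nu> \<cdot>\<^sub>v r))"
      unfolding Fz .
    from F_inj[OF U_diff[OF U_smult[OF zU] hz] zU this] have "z (A *\<^sub>v r - \<nu> \<cdot>\<^sub>v r) $$ (i, j) = ((\<mu> - \<nu>) \<cdot>\<^sub>m z r - lie_bracket h (z r)) $$ (i, j)"
      by (simp only:)
    also have "\<dots> = (\<mu> - \<nu>) * z r $$ (i, j) - (gap_weight i - gap_weight j) * z r $$ (i, j)"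
      using U_carrier[OF zU] U_carrier[OF hz] ij lie_bracket_diag_index[OF U_carrier[OF zU] ij, of gap_weight r]
      by (simp add: h_def U_dims[OF zU] carrier_matD[OF U_carrier[OF hz[unfolded h_def]]])
    finally show ?thesis by (simp add: algebra_simps)
  qed
  have z_zero: "r = 0\<^sub>v n" if r: "r \<in> carrier_vec n" and "\<And>i j. i < n \<Longrightarrow> j < n \<Longrightarrow> z r $$ (i, j) = 0" for r
  proof (rule C_eq[OF r])
    have "z r = 0\<^sub>m n n" using that U_carrier[OF zU] by (intro eq_matI) (auto simp: U_dims[OF zU])
    then have "C r = 0\<^sub>m n n" using Fz[of r] linear_zero[OF lin] by simp
    also have "\<dots> = C (0\<^sub>v n)" by (rule eq_matI) (auto simp: C_def)
    finally show "C r = C (0\<^sub>v n)" .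
  qed simp

  define N where "N = (\<lambda>(i, j). \<mu> - (gap_weight i - gap_weight j)) ` ({..<n} \<times> {..<n})"
  have "finite N" unfolding N_def by (intro finite_imageI finite_cartesian_product finite_lessThan)
  then obtain l where l: "set l = N" "distinct l" using finite_distinct_list by blast
  have ann: "shift_prod A l v = 0\<^sub>v n" if v: "v \<in> carrier_vec n" for v
  proof (rule z_zero[OF shift_prod_carrier[OF A v]])
    fix i j assume ij: "i < n" "j < n"
    have "z (shift_prod A l v) $$ (i, j) = (\<Prod>\<nu>\<leftarrow>l. \<mu> - (gap_weight i - gap_weight j) - \<nu>) * z v $$ (i, j)" for l
      by (induction l) (auto simp: z_shift[OF shift_prod_carrier[OF A v] ij])
    moreover have "\<mu> - (gap_weight i - gap_weight j) \<in> set l" using ij by (auto simp: l N_def)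
    then have "(\<Prod>\<nu>\<leftarrow>l. \<mu> - (gap_weight i - gap_weight j) - \<nu>) = 0"
      by (force simp: prod_list_zero_iff)
    ultimately show "z (shift_prod A l v) $$ (i, j) = 0" by simp
  qed

  have z_eig: "\<mu> - (gap_weight i - gap_weight j) = \<nu> \<or> z r $$ (i, j) = 0"
    if r: "r \<in> carrier_vec n" "A *\<^sub>v r = \<nu> \<cdot>\<^sub>v r" and ij: "i < n" "j < n" for r \<nu> i j
  proof -
    have z0: "z (0\<^sub>v n) = 0\<^sub>m n n"
    proof (rule F_inj[OF zU U_zero])
      show "F (z (0\<^sub>v n)) = F (0\<^sub>m n n)"
        unfolding Fz linear_zero[OF lin] by (rule eq_matI) (auto simp: C_def)
    qed
    have "A *\<^sub>v r - \<nu> \<cdot>\<^sub>v r = 0\<^sub>v n" using r by auto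
    then have "(\<mu> - (gap_weight i - gap_weight j) - \<nu>) * z r $$ (i, j) = 0"
      using z_shift[OF r(1) ij, of \<nu>] z0 ij by simp
    then show ?thesis by auto
  qed

  have simple: "\<exists>k. v = k \<cdot>\<^sub>v u"
    if u: "u \<in> carrier_vec n" "u \<noteq> 0\<^sub>v n" "A *\<^sub>v u = \<nu> \<cdot>\<^sub>v u"
    and v: "v \<in> carrier_vec n" "A *\<^sub>v v = \<nu> \<cdot>\<^sub>v v" for \<nu> u v
  proof (cases "\<nu> = \<mu>")
    case False
    obtain p q where pq: "p < n" "q < n" "z u $$ (p, q) \<noteq> 0" using z_zero[OF u(1)] u(2) by blast
    have w: "gap_weight p - gap_weight q = \<mu> - \<nu>" using z_eig[OF u(1,3) pq(1,2)] pq(3) by (auto simp: algebra_simps)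
    then have "p \<noteq> q" using False by auto
    have only: "(i, j) = (p, q) \<or> z r $$ (i, j) = 0"
      if "r \<in> carrier_vec n" "A *\<^sub>v r = \<nu> \<cdot>\<^sub>v r" "i < n" "j < n" for r i j
      using z_eig[OF that] gap_weight_differences[of p q i j] w \<open>p \<noteq> q\<close> by (auto simp: algebra_simps)
    define k where "k = z v $$ (p, q) / z u $$ (p, q)"
    have "z v = k \<cdot>\<^sub>m z u"
    proof (rule eq_matI)
      fix i j assume "i < dim_row (k \<cdot>\<^sub>m z u)" "j < dim_col (k \<cdot>\<^sub>m z u)"
      then have ij: "i < n" "j < n" using U_dims[OF zU] by auto
      show "z v $$ (i, j) = (k \<cdot>\<^sub>m z u) $$ (i, j)"
        using only[OF u(1,3) ij] only[OF v ij] ij pq(3) by (auto simp: k_def U_dims[OF zU])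
    qed (use U_dims[OF zU] in auto)
    then have "C v = k \<cdot>\<^sub>m C u" using mat_linear_onD(3)[OF lin zU] Fz by metis
    also have "\<dots> = C (k \<cdot>\<^sub>v u)" using u by (intro eq_matI) (auto simp: C_def)
    finally have "v = k \<cdot>\<^sub>v u" using u(1) by (intro C_eq[OF v(1)]) simp_all
    then show ?thesis by blast
  next
    case True
    have cross: "(r \<bullet> c) \<cdot>\<^sub>v s = (s \<bullet> c) \<cdot>\<^sub>v r"
      if r: "r \<in> carrier_vec n" "A *\<^sub>v r = \<mu> \<cdot>\<^sub>v r" and s: "s \<in> carrier_vec n" "A *\<^sub>v s = \<mu> \<cdot>\<^sub>v s" for r s
    proof (rule eq_vecI)
      fix j assume "j < dim_vec ((s \<bullet> c) \<cdot>\<^sub>v r)"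
      then have j: "j < n" using r by simp
      have diag: "z t $$ (i, j) = 0" if "t \<in> carrier_vec n" "A *\<^sub>v t = \<mu> \<cdot>\<^sub>v t" "i < n" "j < n" "i \<noteq> j" for t i j
        using z_eig[OF that(1-4)] that(5) by (auto simp: gap_weight_inj)
      have zd: "z t = mat_diag n (\<lambda>i. z t $$ (i, i))" if "t \<in> carrier_vec n" "A *\<^sub>v t = \<mu> \<cdot>\<^sub>v t" for t
        using diag[OF that] U_dims[OF zU] by (intro eq_matI) auto
      have "z r * z s = z s * z r"
        by (subst (1 2) zd[OF r], subst (1 2) zd[OF s]) (simp add: mult.commute)
      then have "lie_bracket (z r) (z s) = 0\<^sub>m n n"
        using U_mult[OF zU zU, of s r, THEN U_carrier] unfolding lie_bracket_def by (intro eq_matI) auto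
      then have "lie_bracket (C r) (C s) = 0\<^sub>m n n"
        using lie zU Fz linear_zero[OF lin] by metis
      moreover have "lie_bracket (C r) (C s) $$ (i0, j) = (C r * C s) $$ (i0, j) - (C s * C r) $$ (i0, j)"
        unfolding lie_bracket_def using i0 j by (intro index_minus_mat(1)) (auto simp: C_def)
      moreover have "(C t * C t') $$ (i0, j) = c $ i0 * ((t \<bullet> c) * t' $ j)" for t t'
        using i0 j c(1)
        by (simp add: mat_mult_index[of _ n] C_def scalar_prod_def atLeast0LessThan sum_distrib_left sum_distrib_right mult_ac)
      ultimately have "c $ i0 * ((r \<bullet> c) * s $ j) = c $ i0 * ((s \<bullet> c) * r $ j)" using i0 j by simp
      then show "((r \<bullet> c) \<cdot>\<^sub>v s) $ j = ((s \<bullet> c) \<cdot>\<^sub>v r) $ j" using i0 j r s by simp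
    qed (use r s in auto)
    \<comment> \<open>otherwise \<open>c\<close> is orthogonal to all eigenvectors of \<open>A\<close>\<close>
    have "u \<bullet> c \<noteq> 0"
    proof
      assume uc: "u \<bullet> c = 0"
      have eig: "y \<bullet> c = 0" if y: "y \<in> carrier_vec n" "A *\<^sub>v y = \<kappa> \<cdot>\<^sub>v y" for \<kappa> y
      proof (cases "\<kappa> = \<mu>")
        case True
        obtain j where j: "j < n" "u $ j \<noteq> 0" using u(1,2) by (metis eq_vecI carrier_vecD index_zero_vec)
        have "((u \<bullet> c) \<cdot>\<^sub>v y) $ j = ((y \<bullet> c) \<cdot>\<^sub>v u) $ j"
          using cross[of u y] u y \<open>\<nu> = \<mu>\<close> True by simp
        then show ?thesis using uc j u y by simp
      next
        case False
        have "\<kappa> * (y \<bullet> c) = (A *\<^sub>v y) \<bullet> c" using y c by simp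
        also have "\<dots> = y \<bullet> (x *\<^sub>v c)"
          unfolding A_def by (rule transpose_vec_mult_scalar[OF x c(1) y(1)])
        also have "\<dots> = \<mu> * (y \<bullet> c)" using y c by simp
        finally show ?thesis using False by simp
      qed
      have "unit_vec n i0 \<bullet> c = 0"
        by (rule orthogonal_to_eigenvectors[OF A c(1) _ l(2)]) (use eig ann in auto)
      then show False using i0 c(1) by simp
    qed
    moreover have "(u \<bullet> c) \<cdot>\<^sub>v v = (v \<bullet> c) \<cdot>\<^sub>v u" using cross[of u v] u v True by simp
    ultimately have "v = ((v \<bullet> c) / (u \<bullet> c)) \<cdot>\<^sub>v u"
    proof -
      assume nz: "u \<bullet> c \<noteq> 0" and eq: "(u \<bullet> c) \<cdot>\<^sub>v v = (v \<bullet> c) \<cdot>\<^sub>v u"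
      have "v = (1 / (u \<bullet> c)) \<cdot>\<^sub>v ((u \<bullet> c) \<cdot>\<^sub>v v)" using nz by (simp add: smult_smult_assoc)
      also have "\<dots> = ((v \<bullet> c) / (u \<bullet> c)) \<cdot>\<^sub>v u" unfolding eq by (simp add: smult_smult_assoc)
      finally show ?thesis .
    qed
    then show ?thesis by blast
  qed

  obtain M R d where MR: "inverse_pair n M R" and d: "inj_on d {..<n}"
    and rows: "\<And>k. k < n \<Longrightarrow> A *\<^sub>v row M k = d k \<cdot>\<^sub>v row M k"
    using simple_eigenvalues_diagonalize[OF A l(2) ann] simple by blast
  note Mc = inverse_pair_carrier[OF MR]
  have "M * x = mat_diag n d * M"
  proof (rule eq_matI)
    fix k j assume "k < dim_row (mat_diag n d * M)" "j < dim_col (mat_diag n d * M)"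
    then have kj: "k < n" "j < n" using Mc by auto
    have "(M * x) $$ (k, j) = (A *\<^sub>v row M k) $ j"
      using kj Mc x by (auto simp: mat_mult_index[of _ n] A_def scalar_prod_def atLeast0LessThan mult.commute intro!: sum.cong)
    also have "\<dots> = (mat_diag n d * M) $$ (k, j)"
      unfolding rows[OF kj(1)] using kj Mc by (simp add: mat_diag_mult_left[of _ n n])
    finally show "(M * x) $$ (k, j) = (mat_diag n d * M) $$ (k, j)" .
  qed (use Mc x in auto)
  then have "M * x * R = mat_diag n d"
    using MR Mc by (simp add: inverse_pair_def assoc_mult_mat[of _ n n _ n _ n])
  then show ?thesis using inverse_pair_sym[OF MR] d unfolding x_def h_def by blast
qed

end

end

section \<open>Lie automorphisms\<close>

text \<open>A set of cells of a grid, any two of which share a row or a column, lies in one line.\<close>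

lemma row_or_column_constant:
  assumes "\<forall>j\<in>S. \<forall>k\<in>S. p j = p k \<or> q j = q k"
  shows "(\<forall>j\<in>S. \<forall>k\<in>S. p j = p k) \<or> (\<forall>j\<in>S. \<forall>k\<in>S. q j = q k)"
  using assms by metis

lemma lie_conj:
  assumes "inverse_pair n P Q" "A \<in> carrier_mat n n" "B \<in> carrier_mat n n"
  shows "Q * lie_bracket A B * P = lie_bracket (Q * A * P) (Q * (B :: 'a::comm_ring_1 mat) * P)"
  using assms by (simp add: lie_bracket_def conj_mult conj_diff mult_carrier_mat[of _ n n _ n])

context block_triangular
begin

context
  fixes \<psi> :: "'a mat \<Rightarrow> 'a mat" and \<sigma> :: "nat \<Rightarrow> nat"
  assumes lin: "mat_linear_on n U \<psi>"
    and lie: "\<forall>x\<in>U. \<forall>y\<in>U. \<psi> (lie_bracket x y) = lie_bracket (\<psi> x) (\<psi> y)"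
    and trace: "\<forall>x\<in>U. mat_trace (\<psi> x) = mat_trace x"
    and diagonal: "\<forall>t. \<exists>s. \<psi> (mat_diag n t) = mat_diag n s"
    and \<sigma>: "bij_betw \<sigma> {..<n} {..<n}"
    and star: "\<forall>j. 0 < j \<and> j < n \<longrightarrow> (\<exists>g. g \<noteq> 0 \<and> \<psi> (E 0 j) = g \<cdot>\<^sub>m E (\<sigma> 0) (\<sigma> j))"
begin

lemma sigma_less: "i < n \<Longrightarrow> \<sigma> i < n"
  using \<sigma> by (auto simp: bij_betw_def)

lemma sigma_eq: "i < n \<Longrightarrow> j < n \<Longrightarrow> \<sigma> i = \<sigma> j \<longleftrightarrow> i = j"
  using \<sigma> by (auto simp: bij_betw_def dest: inj_onD)

lemma sigma_surj: "p < n \<Longrightarrow> \<exists>i<n. p = \<sigma> i"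
  using \<sigma> by (auto simp: bij_betw_def image_iff set_eq_iff)

text \<open>The brackets with the images of the \<open>E 0 j\<close> determine the differences of the diagonal entries,
  and the trace determines their sum.\<close>

lemma star_diagonal:
  assumes s: "\<psi> (mat_diag n t) = mat_diag n s" and i: "i < n"
  shows "s (\<sigma> i) = t i"
proof -
  have diff: "s (\<sigma> j) = s (\<sigma> 0) - t 0 + t j" if j: "j < n" for j
  proof (cases "j = 0")
    case False
    then obtain g where g: "g \<noteq> 0" "\<psi> (E 0 j) = g \<cdot>\<^sub>m E (\<sigma> 0) (\<sigma> j)" using star j by auto
    have a: "E 0 j \<in> U" using j by (intro U_unit arrowI) simp_all
    have "lie_bracket (mat_diag n t) (E 0 j) = (t 0 - t j) \<cdot>\<^sub>m E 0 j"
      by (rule lie_bracket_diag_unit)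
    then have "\<psi> (lie_bracket (mat_diag n t) (E 0 j)) = (t 0 - t j) \<cdot>\<^sub>m \<psi> (E 0 j)"
      using mat_linear_onD(3)[OF lin a] by simp
    then have "lie_bracket (mat_diag n s) (\<psi> (E 0 j)) = (t 0 - t j) \<cdot>\<^sub>m \<psi> (E 0 j)"
      using lie mat_diag_U a s by simp
    then have "lie_bracket (mat_diag n s) (\<psi> (E 0 j)) $$ (\<sigma> 0, \<sigma> j) = ((t 0 - t j) \<cdot>\<^sub>m \<psi> (E 0 j)) $$ (\<sigma> 0, \<sigma> j)"
      by (simp only:)
    then have "(s (\<sigma> 0) - s (\<sigma> j)) * g = (t 0 - t j) * g"
      using mat_linear_onD(1)[OF lin a] sigma_less[OF j] sigma_less[of 0] j g(2)
      by (simp add: lie_bracket_diag_index)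
    then have "s (\<sigma> 0) - s (\<sigma> j) = t 0 - t j" using g(1) by simp
    then show ?thesis by (simp add: algebra_simps)
  qed simp
  have "(\<Sum>i<n. s i) = (\<Sum>i<n. t i)"
    using trace mat_diag_U[of t] s by (auto simp: mat_trace_def)
  also have "(\<Sum>i<n. s i) = (\<Sum>i<n. s (\<sigma> i))"
    using sum.reindex_bij_betw[OF \<sigma>, of s] by simp
  also have "\<dots> = (\<Sum>i<n. (s (\<sigma> 0) - t 0) + t i)" by (intro sum.cong) (auto intro: diff)
  also have "\<dots> = of_nat n * (s (\<sigma> 0) - t 0) + (\<Sum>i<n. t i)" by (simp add: sum.distrib)
  finally have "s (\<sigma> 0) = t 0" using i by simp
  then show ?thesis using diff[OF i] by simp
qed

text \<open>By \<open>star_diagonal\<close> the image of \<open>E i j\<close> is an eigenvector for the brackets with a diagonal matrix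
  of weights, which distinguish the position \<open>(i, j)\<close> from all others.\<close>

lemma star_unit_image:
  assumes a: "arrow i j"
  shows "\<psi> (E i j) = (if i = j then 1 else \<psi> (E i j) $$ (\<sigma> i, \<sigma> j)) \<cdot>\<^sub>m E (\<sigma> i) (\<sigma> j)"
proof (cases "i = j")
  case True
  define t :: "nat \<Rightarrow> 'a" where "t k = (if k = i then 1 else 0)" for k
  obtain s where s: "\<psi> (mat_diag n t) = mat_diag n s" using diagonal by blast
  have "mat_diag n s = E (\<sigma> i) (\<sigma> i)"
  proof (rule eq_matI)
    fix p q assume "p < dim_row (E (\<sigma> i) (\<sigma> i))" "q < dim_col (E (\<sigma> i) (\<sigma> i))"
    then have pq: "p < n" "q < n" by auto
    obtain u where u: "u < n" "p = \<sigma> u" using sigma_surj[OF pq(1)] by blast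
    show "mat_diag n s $$ (p, q) = E (\<sigma> i) (\<sigma> i) $$ (p, q)"
      using star_diagonal[OF s u(1)] u pq sigma_eq[OF u(1) arrowD(1)[OF a]] by (auto simp: t_def)
  qed auto
  moreover have "E i i = mat_diag n t" unfolding mat_unit_diag t_def ..
  ultimately show ?thesis using True s by (simp add: one_smult_mat)
next
  case False
  let ?Y = "\<psi> (E i j)"
  have Y: "?Y \<in> carrier_mat n n" by (rule mat_linear_onD(1)[OF lin U_unit[OF a]])
  note lt = arrowD[OF a]
  obtain s where s: "\<psi> (mat_diag n gap_weight) = mat_diag n s" using diagonal by blast
  have "lie_bracket (mat_diag n gap_weight) (E i j) = (gap_weight i - gap_weight j) \<cdot>\<^sub>m E i j"
    by (rule lie_bracket_diag_unit)
  then have "\<psi> (lie_bracket (mat_diag n gap_weight) (E i j)) = (gap_weight i - gap_weight j) \<cdot>\<^sub>m ?Y"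
    using mat_linear_onD(3)[OF lin U_unit[OF a]] by simp
  then have br: "lie_bracket (mat_diag n s) ?Y = (gap_weight i - gap_weight j) \<cdot>\<^sub>m ?Y"
    using lie mat_diag_U U_unit[OF a] s by simp
  \<comment> \<open>an entry elsewhere would belong to an eigenvalue different from that of \<open>E i j\<close>\<close>
  have zero: "?Y $$ (\<sigma> u, \<sigma> v) = 0" if uv: "u < n" "v < n" "(u, v) \<noteq> (i, j)" for u v
  proof -
    have "lie_bracket (mat_diag n s) ?Y $$ (\<sigma> u, \<sigma> v) = ((gap_weight i - gap_weight j) \<cdot>\<^sub>m ?Y) $$ (\<sigma> u, \<sigma> v)"
      by (simp only: br)
    then have "(gap_weight u - gap_weight v) * ?Y $$ (\<sigma> u, \<sigma> v) = (gap_weight i - gap_weight j) * ?Y $$ (\<sigma> u, \<sigma> v)"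
      using Y sigma_less uv star_diagonal[OF s] by (simp add: lie_bracket_diag_index)
    moreover have "gap_weight i - gap_weight j \<noteq> gap_weight u - gap_weight v"
      using gap_weight_differences[OF _ False] uv(3) by blast
    ultimately show ?thesis by simp
  qed
  show ?thesis
  proof (rule eq_matI)
    fix p q assume "p < dim_row ((if i = j then 1 else ?Y $$ (\<sigma> i, \<sigma> j)) \<cdot>\<^sub>m E (\<sigma> i) (\<sigma> j))"
      "q < dim_col ((if i = j then 1 else ?Y $$ (\<sigma> i, \<sigma> j)) \<cdot>\<^sub>m E (\<sigma> i) (\<sigma> j))"
    then have pq: "p < n" "q < n" by auto
    obtain u where u: "u < n" "p = \<sigma> u" using sigma_surj[OF pq(1)] by blast
    obtain v where v: "v < n" "q = \<sigma> v" using sigma_surj[OF pq(2)] by blast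
    show "?Y $$ (p, q) = ((if i = j then 1 else ?Y $$ (\<sigma> i, \<sigma> j)) \<cdot>\<^sub>m E (\<sigma> i) (\<sigma> j)) $$ (p, q)"
      using zero[OF u(1) v(1)] u v pq False sigma_eq[OF u(1) lt(1)] sigma_eq[OF v(1) lt(2)] by auto
  qed (use Y in auto)
qed

text \<open>For \<open>i \<noteq> k\<close> the bracket of \<open>E i j\<close> and \<open>E j k\<close> is \<open>E i k\<close>, and the images of the two units have
  product zero in the other order. For \<open>i = k \<noteq> j\<close> the bracket is \<open>E i i - E j j\<close>, whose image is
  known from \<open>star_unit_image\<close>.\<close>

lemma star_multiplicative:
  assumes "x \<in> U" "y \<in> U"
  shows "\<psi> (x * y) = \<psi> x * \<psi> y"
proof -
  define c where "c i j = (if i = j then 1 else \<psi> (E i j) $$ (\<sigma> i, \<sigma> j))" for i j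
  have img: "\<psi> (E i j) = c i j \<cdot>\<^sub>m E (\<sigma> i) (\<sigma> j)" if "arrow i j" for i j
    unfolding c_def by (rule star_unit_image[OF that])
  have prod: "\<psi> (E i j) * \<psi> (E k l) = (if j = k then (c i j * c k l) \<cdot>\<^sub>m E (\<sigma> i) (\<sigma> l) else 0\<^sub>m n n)"
    if "arrow i j" "arrow k l" for i j k l
  proof -
    have "\<psi> (E i j) * \<psi> (E k l) = (c i j * c k l) \<cdot>\<^sub>m (E (\<sigma> i) (\<sigma> j) * E (\<sigma> k) (\<sigma> l))"
      unfolding img[OF that(1)] img[OF that(2)]
      by (simp add: mult_smult_assoc_mat[of _ n n _ n] mult_smult_distrib[of _ n n _ n] mat_smult_smult mult.commute)
    then show ?thesis
      using arrowD[OF that(1)] arrowD[OF that(2)] by (auto simp: mat_unit_mult sigma_less sigma_eq)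
  qed
  have path: "\<psi> (E i j) * \<psi> (E j k) = \<psi> (E i k)" if a: "arrow i j" "arrow j k" for i j k
  proof -
    note lt = arrowD[OF a(1)] arrowD[OF a(2)]
    have br: "\<psi> (lie_bracket (E i j) (E j k)) = \<psi> (E i j) * \<psi> (E j k) - \<psi> (E j k) * \<psi> (E i j)"
      using lie U_unit[OF a(1)] U_unit[OF a(2)] by (simp add: lie_bracket_def)
    note cE = mat_linear_onD(1)[OF lin U_unit]
    consider "i = j \<or> j = k" | "i \<noteq> k" | "i = k" "i \<noteq> j" by blast
    then show ?thesis
    proof cases
      case 1
      then show ?thesis using prod[OF a] img[OF arrow_trans[OF a]] by (auto simp: c_def)
    next
      case 2
      then have "lie_bracket (E i j) (E j k) = E i k" "\<psi> (E j k) * \<psi> (E i j) = 0\<^sub>m n n"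
        using lt prod[OF a(2,1)] by (auto simp: lie_bracket_units)
      then show ?thesis
        using br mat_minus_zero[OF mult_carrier_mat[OF cE[OF a(1)] cE[OF a(2)]]] by simp
    next
      case 3
      have d: "arrow i i" "arrow j j" using lt by (auto simp: arrow_def)
      have "lie_bracket (E i j) (E j k) = E i i - E j j" using 3 lt by (simp add: lie_bracket_units)
      then have "\<psi> (E i i) - \<psi> (E j j) = \<psi> (E i j) * \<psi> (E j k) - \<psi> (E j k) * \<psi> (E i j)"
        using br linear_diff[OF lin U_unit[OF d(1)] U_unit[OF d(2)]] by simp
      then have "(\<psi> (E i i) - \<psi> (E j j)) $$ (\<sigma> i, \<sigma> i) = (\<psi> (E i j) * \<psi> (E j k) - \<psi> (E j k) * \<psi> (E i j)) $$ (\<sigma> i, \<sigma> i)"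
        by (simp only:)
      then have "c i j * c j i = 1"
        using 3 lt sigma_less prod[OF a] prod[OF a(2,1)] sigma_eq[of i j] img[OF d(1)] img[OF d(2)] by (simp add: c_def)
      then show ?thesis using prod[OF a] img[OF d(1)] 3 by (simp add: c_def)
    qed
  qed
  show ?thesis
    by (rule mult_ext[OF lin path _ assms]) (simp_all add: prod)
qed

end

context
  fixes F :: "'a mat \<Rightarrow> 'a mat" and P Q d
  assumes n: "1 < n"
    and lin: "mat_linear_on n U F"
    and bij: "bij_betw F U U"
    and lie: "\<forall>x\<in>U. \<forall>y\<in>U. F (lie_bracket x y) = lie_bracket (F x) (F y)"
    and trace: "\<forall>x\<in>U. mat_trace (F x) = mat_trace x"
    and PQ: "inverse_pair n P Q" and d: "inj_on d {..<n}"
    and Fh: "Q * F (mat_diag n gap_weight) * P = mat_diag n d"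
begin

abbreviation \<psi> :: "'a mat \<Rightarrow> 'a mat" where "\<psi> x \<equiv> Q * F x * P"

lemma psi_linear: "mat_linear_on n U \<psi>"
  by (rule conj_linear[OF PQ lin])

lemma psi_lie: "\<forall>x\<in>U. \<forall>y\<in>U. \<psi> (lie_bracket x y) = lie_bracket (\<psi> x) (\<psi> y)"
  using lie mat_linear_onD(1)[OF lin] by (simp add: lie_conj[OF PQ])

lemma psi_inj:
  assumes "x \<in> U" "y \<in> U" "\<psi> x = \<psi> y"
  shows "x = y"
  using conj_inject[OF PQ mat_linear_onD(1)[OF lin] mat_linear_onD(1)[OF lin] assms(3)] assms(1,2)
    bij_betw_imp_inj_on[OF bij] by (auto dest: inj_onD)

lemma psi_trace: "\<forall>x\<in>U. mat_trace (\<psi> x) = mat_trace x"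
  using trace mat_linear_onD(1)[OF lin] by (simp add: mat_trace_conj[OF PQ])

text \<open>The image commutes with a diagonal matrix that has distinct entries.\<close>

lemma psi_diagonal: "\<exists>s. \<psi> (mat_diag n t) = mat_diag n s"
proof -
  let ?Y = "\<psi> (mat_diag n t)"
  have Y: "?Y \<in> carrier_mat n n" by (rule mat_linear_onD(1)[OF psi_linear mat_diag_U])
  have "lie_bracket (mat_diag n gap_weight) (mat_diag n t) = 0\<^sub>m n n"
    by (rule eq_matI) (auto simp: lie_bracket_def mult.commute)
  then have "lie_bracket (mat_diag n d) ?Y = 0\<^sub>m n n"
    using psi_lie[rule_format, OF mat_diag_U mat_diag_U, of gap_weight t] linear_zero[OF psi_linear] Fh by simp
  then have zero: "(d i - d j) * ?Y $$ (i, j) = 0" if "i < n" "j < n" for i j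
    using lie_bracket_diag_index[OF Y that, of d] that by simp
  have "?Y = mat_diag n (\<lambda>i. ?Y $$ (i, i))"
  proof (rule eq_matI)
    fix i j assume "i < dim_row (mat_diag n (\<lambda>i. ?Y $$ (i, i)))" "j < dim_col (mat_diag n (\<lambda>i. ?Y $$ (i, i)))"
    then have ij: "i < n" "j < n" by auto
    show "?Y $$ (i, j) = mat_diag n (\<lambda>i. ?Y $$ (i, i)) $$ (i, j)"
      using zero[OF ij] ij d by (auto simp: inj_on_def simp del: index_mult_mat)
  qed (use Y in auto)
  then show ?thesis by blast
qed

text \<open>Polynomials in \<open>F h\<close> lie in \<open>U\<close>; these are the numerators of Lagrange interpolation at the
  eigenvalues.\<close>

lemma U_interpolation:
  assumes "finite S"
  shows "\<exists>X\<in>U. Q * X * P = mat_diag n (\<lambda>i. \<Prod>l\<in>S. d i - d l)"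
  using assms
proof (induction S rule: finite_induct)
  case empty
  show ?case using U_one conj_one[OF PQ] by (intro bexI[of _ "1\<^sub>m n"]) simp_all
next
  case (insert l S)
  then obtain X where X: "X \<in> U" "Q * X * P = mat_diag n (\<lambda>i. \<Prod>l\<in>S. d i - d l)" by blast
  let ?x = "F (mat_diag n gap_weight)"
  have x: "?x \<in> U" using bij mat_diag_U by (auto simp: bij_betw_def)
  define Y where "Y = ?x - d l \<cdot>\<^sub>m 1\<^sub>m n"
  have Y: "Y \<in> U" unfolding Y_def by (intro U_diff U_smult U_one x)
  have "Q * Y * P = mat_diag n d - d l \<cdot>\<^sub>m 1\<^sub>m n"
    unfolding Y_def using U_carrier[OF x] PQ
    by (simp add: conj_diff[OF PQ] conj_smult[OF PQ] Fh conj_one[OF PQ])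
  also have "\<dots> = mat_diag n (\<lambda>i. d i - d l)" by (rule eq_matI) auto
  finally have "Q * (Y * X) * P = mat_diag n (\<lambda>i. (d i - d l) * (\<Prod>l\<in>S. d i - d l))"
    using X by (simp add: U_carrier[OF Y] U_carrier[OF X(1)] flip: conj_mult[OF PQ])
  then show ?case using insert.hyps U_mult[OF Y X(1)] by auto
qed

text \<open>The spectral projections of \<open>F h\<close> are polynomials in \<open>F h\<close>. So they have preimages in \<open>U\<close>, which
  commute with \<open>h\<close> and are therefore diagonal.\<close>

lemma psi_diagonal_unit:
  assumes k: "k < n"
  shows "\<exists>t. \<psi> (mat_diag n t) = E k k"
proof -
  obtain X where X: "X \<in> U" "Q * X * P = mat_diag n (\<lambda>i. \<Prod>l\<in>{..<n} - {k}. d i - d l)"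
    using U_interpolation[of "{..<n} - {k}"] by blast
  define g where "g = (\<Prod>l\<in>{..<n} - {k}. d k - d l)"
  have "g \<noteq> 0" using d k by (auto simp: g_def inj_on_def)
  have "mat_diag n (\<lambda>i. \<Prod>l\<in>{..<n} - {k}. d i - d l) = g \<cdot>\<^sub>m E k k"
    using k by (intro eq_matI) (auto simp: g_def)
  then have "Q * ((1 / g) \<cdot>\<^sub>m X) * P = E k k"
    using \<open>g \<noteq> 0\<close> by (simp add: conj_smult[OF PQ U_carrier[OF X(1)]] X(2) mat_smult_smult one_smult_mat)
  moreover obtain z where z: "z \<in> U" "F z = (1 / g) \<cdot>\<^sub>m X"
    using bij U_smult[OF X(1), of "1 / g"] unfolding bij_betw_def by (metis imageE)
  ultimately have psi_z: "\<psi> z = E k k" by simp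
  have "lie_bracket (mat_diag n d) (E k k) = 0\<^sub>m n n"
    unfolding mat_unit_diag by (rule eq_matI) (auto simp: lie_bracket_def mult.commute)
  then have "\<psi> (lie_bracket (mat_diag n gap_weight) z) = \<psi> (0\<^sub>m n n)"
    using psi_lie mat_diag_U z(1) psi_z Fh linear_zero[OF psi_linear] by simp
  from psi_inj[OF U_lie[OF mat_diag_U z(1)] U_zero this]
  have zero: "(gap_weight i - gap_weight j) * z $$ (i, j) = 0" if "i < n" "j < n" for i j
    using lie_bracket_diag_index[OF U_carrier[OF z(1)] that, of gap_weight] that by simp
  have "z = mat_diag n (\<lambda>i. z $$ (i, i))"
  proof (rule eq_matI)
    fix i j assume "i < dim_row (mat_diag n (\<lambda>i. z $$ (i, i)))" "j < dim_col (mat_diag n (\<lambda>i. z $$ (i, i)))"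
    then have ij: "i < n" "j < n" by auto
    show "z $$ (i, j) = mat_diag n (\<lambda>i. z $$ (i, i)) $$ (i, j)"
      using zero[OF ij] ij by (auto simp: gap_weight_inj)
  qed (use U_dims[OF z(1)] in auto)
  then show ?thesis using psi_z by metis
qed

text \<open>The image is a common eigenvector of the brackets with all \<open>E k k\<close>, with eigenvalues that do not
  depend on the entry considered. For the entry \<open>(p, q)\<close> these are \<open>[k = p] - [k = q]\<close>, which
  determines \<open>p\<close> and \<open>q\<close> once \<open>p \<noteq> q\<close>.\<close>

lemma psi_root_vector:
  assumes a: "arrow i j" and ij: "i \<noteq> j"
  shows "\<exists>p q g. p < n \<and> q < n \<and> p \<noteq> q \<and> g \<noteq> 0 \<and> \<psi> (E i j) = g \<cdot>\<^sub>m E p q"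
proof -
  let ?Y = "\<psi> (E i j)"
  have Y: "?Y \<in> carrier_mat n n" by (rule mat_linear_onD(1)[OF psi_linear U_unit[OF a]])
  have weight: "(s p - s q) * ?Y $$ (p, q) = (t i - t j) * ?Y $$ (p, q)"
    if s: "\<psi> (mat_diag n t) = mat_diag n s" and pq: "p < n" "q < n" for s t p q
  proof -
    have "lie_bracket (mat_diag n s) ?Y = (t i - t j) \<cdot>\<^sub>m ?Y"
      using psi_lie[rule_format, OF mat_diag_U U_unit[OF a], of t] mat_linear_onD(3)[OF psi_linear U_unit[OF a]] s
      by (simp add: lie_bracket_diag_unit)
    then have "lie_bracket (mat_diag n s) ?Y $$ (p, q) = ((t i - t j) \<cdot>\<^sub>m ?Y) $$ (p, q)" by (simp only:)
    then show ?thesis unfolding lie_bracket_diag_index[OF Y pq] using carrier_matD[OF Y] pq by (simp del: index_mult_mat)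
  qed
  have "\<exists>p<n. \<exists>q<n. ?Y $$ (p, q) \<noteq> 0"
  proof (rule ccontr)
    assume "\<not> ?thesis"
    then have "?Y = 0\<^sub>m n n" using Y by (intro eq_matI) auto
    then have "E i j = (0\<^sub>m n n :: 'a mat)"
      using psi_inj[OF U_unit[OF a] U_zero] linear_zero[OF psi_linear] by simp
    then have "E i j $$ (i, j) = (0\<^sub>m n n :: 'a mat) $$ (i, j)" by (simp only:)
    then show False using arrowD[OF a] by simp
  qed
  then obtain p q where pq: "p < n" "q < n" "?Y $$ (p, q) \<noteq> 0" by blast
  have "p \<noteq> q"
    using weight[OF Fh pq(1,2)] pq(3) ij by (auto simp: gap_weight_inj)
  have only: "(u, v) = (p, q)" if uv: "u < n" "v < n" "?Y $$ (u, v) \<noteq> 0" for u v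
  proof -
    have eq: "(if p = k then 1 else 0) - (if q = k then 1 else 0) = (if u = k then 1 else 0) - (if v = k then 1 else 0 :: 'a)"
      if k: "k < n" for k
    proof -
      obtain t where t: "\<psi> (mat_diag n t) = mat_diag n (\<lambda>l. if l = k then 1 else 0)"
        using psi_diagonal_unit[OF k] unfolding mat_unit_diag by blast
      show ?thesis using weight[OF t pq(1,2)] weight[OF t uv(1,2)] pq(3) uv(3)
        by (simp only: mult_cancel_right) simp
    qed
    have "u = p" using eq[OF pq(1)] \<open>p \<noteq> q\<close> by (auto split: if_splits)
    moreover have "v = q" using eq[OF pq(2)] \<open>p \<noteq> q\<close> by (auto split: if_splits)
    ultimately show ?thesis by simp
  qed
  have "?Y = ?Y $$ (p, q) \<cdot>\<^sub>m E p q"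
  proof (rule eq_matI)
    fix u v assume "u < dim_row (?Y $$ (p, q) \<cdot>\<^sub>m E p q)" "v < dim_col (?Y $$ (p, q) \<cdot>\<^sub>m E p q)"
    then have uv: "u < n" "v < n" by auto
    have unit: "(?Y $$ (p, q) \<cdot>\<^sub>m E p q) $$ (u, v) = (if (u, v) = (p, q) then ?Y $$ (p, q) else 0)"
      using uv by simp
    show "?Y $$ (u, v) = (?Y $$ (p, q) \<cdot>\<^sub>m E p q) $$ (u, v)"
      unfolding unit
    proof (cases "(u, v) = (p, q)")
      case False
      then have "?Y $$ (u, v) = 0" using only[OF uv] by blast
      then show "?Y $$ (u, v) = (if (u, v) = (p, q) then ?Y $$ (p, q) else 0)"
        by (simp only: False if_False)
    qed simp
  qed (use Y in auto)
  then show ?thesis using pq \<open>p \<noteq> q\<close> by blast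
qed

text \<open>Since \<open>E 0 k = [E 0 j, E j k]\<close> for \<open>0 < j < k\<close>, the units to which \<open>E 0 j\<close> and \<open>E 0 k\<close> are sent share
  their row or their column. Hence all \<open>E 0 j\<close> are sent to one row \<open>\<sigma> 0\<close> or to one column \<open>\<sigma> 0\<close>, and
  the other index of the image is \<open>\<sigma> j\<close>.\<close>

lemma psi_first_row:
  shows "\<exists>\<sigma> g. bij_betw \<sigma> {..<n} {..<n} \<and> (\<forall>j. 0 < j \<and> j < n \<longrightarrow> g j \<noteq> 0)
    \<and> ((\<forall>j. 0 < j \<and> j < n \<longrightarrow> \<psi> (E 0 j) = g j \<cdot>\<^sub>m E (\<sigma> 0) (\<sigma> j))
      \<or> (\<forall>j. 0 < j \<and> j < n \<longrightarrow> \<psi> (E 0 j) = g j \<cdot>\<^sub>m E (\<sigma> j) (\<sigma> 0)))"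
proof -
  have a0: "arrow 0 j" if "j < n" for j using that by (simp add: arrowI)
  have "\<exists>p q g. p < n \<and> q < n \<and> p \<noteq> q \<and> g \<noteq> 0 \<and> \<psi> (E 0 j) = g \<cdot>\<^sub>m E p q" if "0 < j" "j < n" for j
    using psi_root_vector[OF a0] that by blast
  then obtain p q g where pqg: "\<And>j. 0 < j \<Longrightarrow> j < n \<Longrightarrow>
      p j < n \<and> q j < n \<and> p j \<noteq> q j \<and> g j \<noteq> 0 \<and> \<psi> (E 0 j) = g j \<cdot>\<^sub>m E (p j) (q j)"
    by metis
  have share: "p j = p k \<or> q j = q k" if jk: "0 < j" "j < k" "k < n" for j k
  proof -
    have ajk: "arrow j k" using jk by (simp add: arrowI)
    have j: "0 < j" "j < n" and k: "0 < k" "k < n" using jk by auto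
    obtain p' q' g' where r: "p' < n" "q' < n" "\<psi> (E j k) = g' \<cdot>\<^sub>m E p' q'"
      using psi_root_vector[OF ajk] jk by auto
    have "lie_bracket (E 0 j) (E j k) = E 0 k"
      using jk by (simp add: lie_bracket_units mat_minus_zero)
    then have "\<psi> (E 0 k) = lie_bracket (\<psi> (E 0 j)) (\<psi> (E j k))"
      using psi_lie[rule_format, OF U_unit[OF a0[OF j(2)]] U_unit[OF ajk]] by simp
    also have "\<dots> = (g j * g') \<cdot>\<^sub>m lie_bracket (E (p j) (q j)) (E p' q')"
      using pqg[OF j] r(3)
      by (auto simp: lie_bracket_def mult_smult_assoc_mat[of _ n n _ n] mult_smult_distrib[of _ n n _ n]
          mat_smult_smult mat_unit_mult mult_carrier_mat[of _ n n _ n] algebra_simps intro!: eq_matI)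
    finally have "g k \<cdot>\<^sub>m E (p k) (q k) = (g j * g') \<cdot>\<^sub>m lie_bracket (E (p j) (q j)) (E p' q')"
      using pqg[OF k] by simp
    then have "(g k \<cdot>\<^sub>m E (p k) (q k)) $$ (p k, q k)
        = ((g j * g') \<cdot>\<^sub>m lie_bracket (E (p j) (q j)) (E p' q')) $$ (p k, q k)" by (simp only:)
    then show ?thesis using pqg[OF j] pqg[OF k] r by (auto simp: lie_bracket_units split: if_splits)
  qed
  have distinct: "\<not> (p j = p k \<and> q j = q k)" if jk: "0 < j" "j < n" "0 < k" "k < n" "j \<noteq> k" for j k
  proof
    assume same: "p j = p k \<and> q j = q k"
    note aj = U_unit[OF a0[OF jk(2)]] and ak = U_unit[OF a0[OF jk(4)]]
    have "\<psi> (g k \<cdot>\<^sub>m E 0 j) = \<psi> (g j \<cdot>\<^sub>m E 0 k)"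
      using mat_linear_onD(3)[OF psi_linear aj] mat_linear_onD(3)[OF psi_linear ak] pqg[OF jk(1,2)] pqg[OF jk(3,4)] same
      by (simp add: mat_smult_smult mult.commute)
    from psi_inj[OF U_smult[OF aj] U_smult[OF ak] this]
    have "(g k \<cdot>\<^sub>m E 0 j) $$ (0, j) = (g j \<cdot>\<^sub>m E 0 k) $$ (0, j)" by (simp only:)
    then show False using pqg[OF jk(3,4)] jk by simp
  qed
  have "\<forall>j\<in>{1..<n}. \<forall>k\<in>{1..<n}. p j = p k \<or> q j = q k"
  proof (intro ballI)
    fix j k assume "j \<in> {1..<n}" "k \<in> {1..<n}"
    then show "p j = p k \<or> q j = q k" using share[of j k] share[of k j] by (cases j k rule: linorder_cases) auto
  qed
  then consider "\<forall>j\<in>{1..<n}. \<forall>k\<in>{1..<n}. p j = p k" | "\<forall>j\<in>{1..<n}. \<forall>k\<in>{1..<n}. q j = q k"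
    using row_or_column_constant by blast
  then show ?thesis
  proof cases
    case 1
    then have p1: "p j = p 1" if "0 < j" "j < n" for j using that n by simp
    define \<sigma> where "\<sigma> j = (if j = 0 then p 1 else q j)" for j
    have ne0: "\<sigma> j \<noteq> \<sigma> 0" if "0 < j" "j < n" for j
      using pqg[OF that] p1[OF that] that by (auto simp: \<sigma>_def)
    have ne: "\<sigma> j \<noteq> \<sigma> k" if "0 < j" "j < n" "0 < k" "k < n" "j \<noteq> k" for j k
      using distinct[OF that] p1[OF that(1,2)] p1[OF that(3,4)] that by (simp add: \<sigma>_def)
    have "inj_on \<sigma> {..<n}"
    proof (rule inj_onI, rule ccontr)
      fix j k assume jk: "j \<in> {..<n}" "k \<in> {..<n}" "\<sigma> j = \<sigma> k" "j \<noteq> k"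
      show False
        using ne0[of j] ne0[of k] ne[of j k] jk by (cases "j = 0"; cases "k = 0") simp_all
    qed
    moreover have "\<sigma> ` {..<n} \<subseteq> {..<n}" using pqg n by (auto simp: \<sigma>_def)
    ultimately have "bij_betw \<sigma> {..<n} {..<n}" by (simp add: bij_betw_def endo_inj_surj)
    moreover have "\<psi> (E 0 j) = g j \<cdot>\<^sub>m E (\<sigma> 0) (\<sigma> j)" if "0 < j" "j < n" for j
      using pqg[OF that] p1[OF that] that by (simp add: \<sigma>_def)
    ultimately show ?thesis using pqg by blast
  next
    case 2
    then have q1: "q j = q 1" if "0 < j" "j < n" for j using that n by simp
    define \<sigma> where "\<sigma> j = (if j = 0 then q 1 else p j)" for j
    have ne0: "\<sigma> j \<noteq> \<sigma> 0" if "0 < j" "j < n" for j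
      using pqg[OF that] q1[OF that] that by (auto simp: \<sigma>_def)
    have ne: "\<sigma> j \<noteq> \<sigma> k" if "0 < j" "j < n" "0 < k" "k < n" "j \<noteq> k" for j k
      using distinct[OF that] q1[OF that(1,2)] q1[OF that(3,4)] that by (simp add: \<sigma>_def)
    have "inj_on \<sigma> {..<n}"
    proof (rule inj_onI, rule ccontr)
      fix j k assume jk: "j \<in> {..<n}" "k \<in> {..<n}" "\<sigma> j = \<sigma> k" "j \<noteq> k"
      show False
        using ne0[of j] ne0[of k] ne[of j k] jk by (cases "j = 0"; cases "k = 0") simp_all
    qed
    moreover have "\<sigma> ` {..<n} \<subseteq> {..<n}" using pqg n by (auto simp: \<sigma>_def)
    ultimately have "bij_betw \<sigma> {..<n} {..<n}" by (simp add: bij_betw_def endo_inj_surj)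
    moreover have "\<psi> (E 0 j) = g j \<cdot>\<^sub>m E (\<sigma> j) (\<sigma> 0)" if "0 < j" "j < n" for j
      using pqg[OF that] q1[OF that] that by (simp add: \<sigma>_def)
    ultimately show ?thesis using pqg by blast
  qed
qed

end

lemma lie_bracket_scalar_minus_transpose:
  assumes A: "(A :: 'a mat) \<in> carrier_mat n n" and B: "B \<in> carrier_mat n n"
  shows "lie_bracket (\<alpha> \<cdot>\<^sub>m 1\<^sub>m n - transpose_mat A) (\<beta> \<cdot>\<^sub>m 1\<^sub>m n - transpose_mat B)
    = (-1) \<cdot>\<^sub>m transpose_mat (lie_bracket A B)"
proof -
  let ?X = "transpose_mat A" and ?Y = "transpose_mat B"
  have c: "?X \<in> carrier_mat n n" "?Y \<in> carrier_mat n n" using A B by auto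
  have prod: "(\<alpha> \<cdot>\<^sub>m 1\<^sub>m n - X) * (\<beta> \<cdot>\<^sub>m 1\<^sub>m n - Y) = (\<alpha> * \<beta>) \<cdot>\<^sub>m 1\<^sub>m n - \<alpha> \<cdot>\<^sub>m Y - (\<beta> \<cdot>\<^sub>m X - X * Y)"
    if "X \<in> carrier_mat n n" "Y \<in> carrier_mat n n" for \<alpha> \<beta> and X Y :: "'a mat"
  proof -
    have "(\<alpha> \<cdot>\<^sub>m 1\<^sub>m n - X) * (\<beta> \<cdot>\<^sub>m 1\<^sub>m n - Y) = \<beta> \<cdot>\<^sub>m (\<alpha> \<cdot>\<^sub>m 1\<^sub>m n - X) - (\<alpha> \<cdot>\<^sub>m Y - X * Y)"
      using that by (simp add: minus_mult_distrib_mat[of _ n n _ _ n] mult_minus_distrib_mat[of _ n n _ n]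
          mult_smult_assoc_mat[of _ n n _ n] mult_smult_distrib[of _ n n _ n] minus_carrier_mat)
    also have "\<dots> = (\<alpha> * \<beta>) \<cdot>\<^sub>m 1\<^sub>m n - \<alpha> \<cdot>\<^sub>m Y - (\<beta> \<cdot>\<^sub>m X - X * Y)"
      using that by (intro eq_matI) (auto simp: algebra_simps)
    finally show ?thesis .
  qed
  have "lie_bracket (\<alpha> \<cdot>\<^sub>m 1\<^sub>m n - ?X) (\<beta> \<cdot>\<^sub>m 1\<^sub>m n - ?Y) = ?X * ?Y - ?Y * ?X"
    unfolding lie_bracket_def prod[OF c] prod[OF c(2,1)] using mult_carrier_mat[OF c] mult_carrier_mat[OF c(2,1)] c
    by (intro eq_matI) (auto simp: algebra_simps)
  also have "\<dots> = transpose_mat (B * A) - transpose_mat (A * B)"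
    using A B by (simp add: transpose_mult[of _ n n _ n])
  also have "\<dots> = (-1) \<cdot>\<^sub>m transpose_mat (lie_bracket A B)"
    unfolding lie_bracket_def using A B by (intro eq_matI) auto
  finally show ?thesis .
qed

text \<open>If the units \<open>E 0 j\<close> go to one column, then \<open>\<tau> x = (2 tr(x) / n) 1 - (\<psi> x)\<^sup>T\<close> sends them to one row. It
  preserves brackets, as minus the transposition does, and the scalar term gives it the trace
  \<open>2 tr(x) - tr(x) = tr(x)\<close>.\<close>

theorem lie_automorphism:
  assumes n: "1 < n"
    and lin: "mat_linear_on n U F"
    and bij: "bij_betw F U U"
    and lie: "\<forall>x\<in>U. \<forall>y\<in>U. F (lie_bracket x y) = lie_bracket (F x) (F y)"
    and trace: "\<forall>x\<in>U. mat_trace (F x) = mat_trace x"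
  defines "G \<equiv> \<lambda>x. (2 * mat_trace x / of_nat n) \<cdot>\<^sub>m 1\<^sub>m n - F x"
  shows "(\<forall>x\<in>U. \<forall>y\<in>U. F (x * y) = F x * F y) \<or> (\<forall>x\<in>U. \<forall>y\<in>U. G (x * y) = G y * G x)"
proof -
  obtain P Q d where PQ: "inverse_pair n P Q" and d: "inj_on d {..<n}"
    and Fh: "Q * F (mat_diag n gap_weight) * P = mat_diag n d"
    using F_regular_diagonalizable[OF n lin bij lie] by blast
  note ctx = n lin bij lie trace PQ d Fh
  define \<psi> where "\<psi> x = Q * F x * P" for x
  note Fc = mat_linear_onD(1)[OF lin]
  have lin\<psi>: "mat_linear_on n U \<psi>" unfolding \<psi>_def by (rule psi_linear[OF ctx])
  note \<psi>c = mat_linear_onD(1)[OF lin\<psi>]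
  have lie\<psi>: "\<forall>x\<in>U. \<forall>y\<in>U. \<psi> (lie_bracket x y) = lie_bracket (\<psi> x) (\<psi> y)"
    unfolding \<psi>_def by (rule psi_lie[OF ctx])
  have trace\<psi>: "\<forall>x\<in>U. mat_trace (\<psi> x) = mat_trace x" unfolding \<psi>_def by (rule psi_trace[OF ctx])
  have diag\<psi>: "\<forall>t. \<exists>s. \<psi> (mat_diag n t) = mat_diag n s" unfolding \<psi>_def using psi_diagonal[OF ctx] by blast
  obtain \<sigma> g where \<sigma>: "bij_betw \<sigma> {..<n} {..<n}" and g: "\<forall>j. 0 < j \<and> j < n \<longrightarrow> g j \<noteq> 0"
    and star: "(\<forall>j. 0 < j \<and> j < n \<longrightarrow> \<psi> (E 0 j) = g j \<cdot>\<^sub>m E (\<sigma> 0) (\<sigma> j))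
      \<or> (\<forall>j. 0 < j \<and> j < n \<longrightarrow> \<psi> (E 0 j) = g j \<cdot>\<^sub>m E (\<sigma> j) (\<sigma> 0))"
    using psi_first_row[OF ctx] unfolding \<psi>_def by blast
  from star show ?thesis
  proof
    assume star: "\<forall>j. 0 < j \<and> j < n \<longrightarrow> \<psi> (E 0 j) = g j \<cdot>\<^sub>m E (\<sigma> 0) (\<sigma> j)"
    have M: "\<psi> (x * y) = \<psi> x * \<psi> y" if "x \<in> U" "y \<in> U" for x y
      by (rule star_multiplicative[OF lin\<psi> lie\<psi> trace\<psi> diag\<psi> \<sigma> _ that]) (use star g in blast)
    have "F (x * y) = F x * F y" if "x \<in> U" "y \<in> U" for x y
      by (rule conj_inject[OF PQ Fc[OF U_mult[OF that]] mult_carrier_mat[OF Fc[OF that(1)] Fc[OF that(2)]]])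
        (use M[OF that] Fc that in \<open>simp add: \<psi>_def conj_mult[OF PQ]\<close>)
    then show ?thesis by blast
  next
    assume star: "\<forall>j. 0 < j \<and> j < n \<longrightarrow> \<psi> (E 0 j) = g j \<cdot>\<^sub>m E (\<sigma> j) (\<sigma> 0)"
    define \<tau> where "\<tau> x = (2 * mat_trace x / of_nat n) \<cdot>\<^sub>m 1\<^sub>m n - transpose_mat (\<psi> x)" for x
    have n0: "of_nat n \<noteq> (0 :: 'a)" using n by simp
    have lin\<tau>: "mat_linear_on n U \<tau>"
      unfolding mat_linear_on_def
    proof (intro conjI ballI allI)
      show "\<tau> x \<in> carrier_mat n n" if "x \<in> U" for x using \<psi>c[OF that] by (simp add: \<tau>_def minus_carrier_mat)
      show "\<tau> (x + y) = \<tau> x + \<tau> y" if "x \<in> U" "y \<in> U" for x y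
        using \<psi>c[OF that(1)] \<psi>c[OF that(2)] mat_linear_onD(2)[OF lin\<psi> that]
          mat_trace_add_diff(1)[OF U_carrier[OF that(1)] U_carrier[OF that(2)]]
        by (intro eq_matI) (auto simp: \<tau>_def algebra_simps add_divide_distrib)
      show "\<tau> (c \<cdot>\<^sub>m x) = c \<cdot>\<^sub>m \<tau> x" if "x \<in> U" for c x
        using \<psi>c[OF that] mat_linear_onD(3)[OF lin\<psi> that] mat_trace_smult[OF U_carrier[OF that]]
        by (intro eq_matI) (auto simp: \<tau>_def algebra_simps)
    qed
    have lie\<tau>: "\<forall>x\<in>U. \<forall>y\<in>U. \<tau> (lie_bracket x y) = lie_bracket (\<tau> x) (\<tau> y)"
    proof (intro ballI)
      fix x y assume xy: "x \<in> U" "y \<in> U"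
      note c = U_carrier[OF xy(1)] U_carrier[OF xy(2)]
      have "mat_trace (lie_bracket x y) = 0"
        unfolding lie_bracket_def mat_trace_add_diff(2)[OF mult_carrier_mat[OF c] mult_carrier_mat[OF c(2,1)]]
        using mat_trace_comm[OF c] by simp
      then have "\<tau> (lie_bracket x y) = (-1) \<cdot>\<^sub>m transpose_mat (lie_bracket (\<psi> x) (\<psi> y))"
        using lie\<psi> xy lie_bracket_carrier[OF \<psi>c[OF xy(1)] \<psi>c[OF xy(2)]]
        by (intro eq_matI) (auto simp: \<tau>_def)
      also have "\<dots> = lie_bracket (\<tau> x) (\<tau> y)"
        unfolding \<tau>_def by (rule lie_bracket_scalar_minus_transpose[symmetric, OF \<psi>c[OF xy(1)] \<psi>c[OF xy(2)]])
      finally show "\<tau> (lie_bracket x y) = lie_bracket (\<tau> x) (\<tau> y)" .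
    qed
    have trace\<tau>: "\<forall>x\<in>U. mat_trace (\<tau> x) = mat_trace x"
    proof
      fix x assume x: "x \<in> U"
      have "mat_trace (\<tau> x) = 2 * mat_trace x / of_nat n * of_nat n - mat_trace (\<psi> x)"
        unfolding \<tau>_def using \<psi>c[OF x]
        by (simp add: mat_trace_add_diff[of _ n] mat_trace_smult[of _ n] mat_trace_one mat_trace_transpose[of _ n])
      then show "mat_trace (\<tau> x) = mat_trace x" using trace\<psi> x n0 by simp
    qed
    have diag\<tau>: "\<forall>t. \<exists>s. \<tau> (mat_diag n t) = mat_diag n s"
    proof
      fix t
      obtain s where s: "\<psi> (mat_diag n t) = mat_diag n s" using diag\<psi> by blast
      have "\<tau> (mat_diag n t) = mat_diag n (\<lambda>i. 2 * mat_trace (mat_diag n t) / of_nat n - s i)"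
        unfolding \<tau>_def s by (intro eq_matI) auto
      then show "\<exists>s. \<tau> (mat_diag n t) = mat_diag n s" by blast
    qed
    have star\<tau>: "\<forall>j. 0 < j \<and> j < n \<longrightarrow> (\<exists>g. g \<noteq> 0 \<and> \<tau> (E 0 j) = g \<cdot>\<^sub>m E (\<sigma> 0) (\<sigma> j))"
    proof (intro allI impI)
      fix j assume j: "0 < j \<and> j < n"
      have "mat_trace (E 0 j) = (0 :: 'a)" using j by (auto simp: mat_trace_def intro!: sum.neutral)
      then have "\<tau> (E 0 j) = (- g j) \<cdot>\<^sub>m E (\<sigma> 0) (\<sigma> j)"
        using star j by (intro eq_matI) (auto simp: \<tau>_def)
      then show "\<exists>g. g \<noteq> 0 \<and> \<tau> (E 0 j) = g \<cdot>\<^sub>m E (\<sigma> 0) (\<sigma> j)"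
        using g j by (intro exI[of _ "- g j"]) simp
    qed
    note M = star_multiplicative[OF lin\<tau> lie\<tau> trace\<tau> diag\<tau> \<sigma> star\<tau>]
    have Gc: "G x \<in> carrier_mat n n" if "x \<in> U" for x using Fc[OF that] by (simp add: G_def minus_carrier_mat)
    have G: "Q * G x * P = transpose_mat (\<tau> x)" if "x \<in> U" for x
    proof -
      have "Q * G x * P = (2 * mat_trace x / of_nat n) \<cdot>\<^sub>m 1\<^sub>m n - \<psi> x"
        unfolding G_def \<psi>_def using Fc[OF that] by (simp add: conj_diff[OF PQ] conj_smult[OF PQ] conj_one[OF PQ])
      also have "\<dots> = transpose_mat (\<tau> x)" using \<psi>c[OF that] by (intro eq_matI) (auto simp: \<tau>_def)
      finally show ?thesis .
    qed
    have "G (x * y) = G y * G x" if xy: "x \<in> U" "y \<in> U" for x y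
    proof (rule conj_inject[OF PQ Gc[OF U_mult[OF xy]] mult_carrier_mat[OF Gc[OF xy(2)] Gc[OF xy(1)]]])
      have "Q * G (x * y) * P = transpose_mat (\<tau> x * \<tau> y)" unfolding G[OF U_mult[OF xy]] M[OF xy] ..
      also have "\<dots> = transpose_mat (\<tau> y) * transpose_mat (\<tau> x)"
        by (rule transpose_mult[OF mat_linear_onD(1)[OF lin\<tau> xy(1)] mat_linear_onD(1)[OF lin\<tau> xy(2)]])
      also have "\<dots> = (Q * G y * P) * (Q * G x * P)" by (simp only: G xy)
      also have "\<dots> = Q * (G y * G x) * P" by (rule conj_mult[OF PQ Gc[OF xy(2)] Gc[OF xy(1)]])
      finally show "Q * G (x * y) * P = Q * (G y * G x) * P" .
    qed
    then show ?thesis by blast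
  qed
qed

end

section \<open>The isomorphism between the automorphism groups\<close>

lemma block_index_mono: "i \<le> j \<Longrightarrow> block_index ns i \<le> block_index ns j"
proof (induction ns arbitrary: i j)
  case (Cons m ns)
  then show ?case using Cons.IH[of "i - m" "j - m"] by auto
qed simp

lemma block_triangular_UT:
  "block_triangular (sum_list ns) (block_index ns) (UT ns :: 'a::{alg_closed_field,field_char_0} mat set)"
  by unfold_locales (auto simp: block_index_mono UT_def)

context block_triangular
begin

definition U0 :: "'a mat set" where
  "U0 = {x \<in> U. mat_trace x = 0}"

definition multiplicative :: "('a mat \<Rightarrow> 'a mat) \<Rightarrow> bool" where
  "multiplicative f \<longleftrightarrow> (\<forall>x\<in>U. \<forall>y\<in>U. f (x * y) = f x * f y)"

definition antimultiplicative :: "('a mat \<Rightarrow> 'a mat) \<Rightarrow> bool" where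
  "antimultiplicative f \<longleftrightarrow> (\<forall>x\<in>U. \<forall>y\<in>U. f (x * y) = f y * f x)"

text \<open>The sign that turns an element of \<open>alg_auto U jordan_mult\<close> into a map preserving brackets.\<close>

definition parity :: "('a mat \<Rightarrow> 'a mat) \<Rightarrow> 'a" where
  "parity f = (if multiplicative f then 1 else -1)"

definition lie_of_jordan :: "('a mat \<Rightarrow> 'a mat) \<Rightarrow> 'a mat \<Rightarrow> 'a mat" where
  "lie_of_jordan f = (\<lambda>x\<in>U0. parity f \<cdot>\<^sub>m f x)"

lemma U0_U: "x \<in> U0 \<Longrightarrow> x \<in> U"
  by (simp add: U0_def)

lemma U0_smult: "x \<in> U0 \<Longrightarrow> c \<cdot>\<^sub>m x \<in> U0"
  by (auto simp: U0_def U_smult mat_trace_smult[of _ n] U_carrier)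

lemma U0_add: "x \<in> U0 \<Longrightarrow> y \<in> U0 \<Longrightarrow> x + y \<in> U0"
  by (auto simp: U0_def U_add mat_trace_add_diff[of _ n] U_carrier)

lemma lie_trace: "x \<in> U \<Longrightarrow> y \<in> U \<Longrightarrow> mat_trace (lie_bracket x y) = 0"
  by (simp add: lie_bracket_def mat_trace_add_diff[of _ n] mult_carrier_mat[of _ n n _ n] U_carrier
      mat_trace_comm[of x n y])

lemma U0_lie: "x \<in> U \<Longrightarrow> y \<in> U \<Longrightarrow> lie_bracket x y \<in> U0"
  by (simp add: U0_def U_lie lie_trace)

lemma parity_square: "parity f * parity f = 1"
  by (simp add: parity_def)

lemma alg_auto_linear:
  assumes "f \<in> alg_auto U p"
  shows "f \<in> Bij U" "mat_linear_on n U f"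
  using assms Bij_U(1)[of f] by (auto simp: alg_auto_def mat_linear_on_def U_carrier)

text \<open>For \<open>n > 2\<close> the product of the two units is the unit \<open>E 0 2\<close>, which an injective map cannot send
  to zero.\<close>

lemma unit_product_nonvanishing:
  assumes n: "2 < n" and lin: "mat_linear_on n U f" and f: "f \<in> Bij U"
    and mult: "f (E 0 1 * E 1 2) = f (E 0 1) * f (E 1 2)" and zero: "f (E 0 1) * f (E 1 2) = 0\<^sub>m n n"
  shows False
proof -
  have U02: "E 0 2 \<in> U" using n by (intro U_unit arrowI) simp_all
  have "f (E 0 2) = f (0\<^sub>m n n)" using n mult zero linear_zero[OF lin] by (simp add: mat_unit_mult)
  from Bij_U(2)[OF f U02 U_zero this] have "E 0 2 $$ (0, 2) = (0\<^sub>m n n :: 'a mat) $$ (0, 2)" by (simp only:)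
  then show False using n by simp
qed

lemma units_U: "2 < n \<Longrightarrow> E 0 1 \<in> U" "2 < n \<Longrightarrow> E 1 2 \<in> U"
  by (auto intro!: U_unit arrowI)

lemma antimultiplicative_product_zero:
  assumes "2 < n" "mat_linear_on n U f" "antimultiplicative f"
  shows "f (E 0 1) * f (E 1 2) = 0\<^sub>m n n"
proof -
  have "f (E 0 1) * f (E 1 2) = f (E 1 2 * E 0 1)"
    using assms(3) units_U[OF assms(1)] by (simp add: antimultiplicative_def)
  then show ?thesis using assms(1) linear_zero[OF assms(2)] by (simp add: mat_unit_mult)
qed

lemma not_multiplicative_and_antimultiplicative:
  assumes n: "2 < n" and lin: "mat_linear_on n U f" and f: "f \<in> Bij U" and anti: "antimultiplicative f"
  shows "\<not> multiplicative f"
proof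
  assume "multiplicative f"
  then have "f (E 0 1 * E 1 2) = f (E 0 1) * f (E 1 2)"
    using units_U[OF n] by (simp add: multiplicative_def)
  from unit_product_nonvanishing[OF n lin f this antimultiplicative_product_zero[OF n lin anti]]
  show False .
qed

lemma jordan_auto_parity_cases:
  assumes n: "2 < n" and f: "f \<in> alg_auto U jordan_mult"
  obtains "multiplicative f" "parity f = 1" | "antimultiplicative f" "parity f = -1"
  using jordan_automorphism(3)[OF f] n not_multiplicative_and_antimultiplicative[OF n alg_auto_linear(2,1)[OF f]]
  by (auto simp: multiplicative_def antimultiplicative_def parity_def)

lemma jordan_autoI:
  assumes lin: "mat_linear_on n U f" and bij: "bij_betw f U U"
    and m: "multiplicative f \<or> antimultiplicative f"
  shows "restrict f U \<in> alg_auto U jordan_mult"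
proof -
  have "f (jordan_mult x y) = jordan_mult (f x) (f y)" if xy: "x \<in> U" "y \<in> U" for x y
  proof -
    note c = mat_linear_onD(1)[OF lin xy(1)] mat_linear_onD(1)[OF lin xy(2)]
    have "f (jordan_mult x y) = f (x * y) + f (y * x)"
      unfolding jordan_mult_def by (rule mat_linear_onD(2)[OF lin]) (simp_all add: U_mult xy)
    then show ?thesis
      using m xy mult_carrier_mat[OF c] mult_carrier_mat[OF c(2,1)]
      by (auto simp: multiplicative_def antimultiplicative_def jordan_mult_def comm_add_mat[of _ n n])
  qed
  moreover have "jordan_mult x y \<in> U" if "x \<in> U" "y \<in> U" for x y
    using that by (simp add: jordan_mult_def U_add U_mult)
  moreover have "restrict f U \<in> Bij U"
    using bij by (auto simp: Bij_def bij_betw_def inj_on_def)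
  ultimately show ?thesis
    using mat_linear_onD[OF lin] by (auto simp: alg_auto_def U_add U_smult)
qed

lemma lie_of_jordan_auto:
  assumes n: "2 < n" and f: "f \<in> alg_auto U jordan_mult"
  shows "lie_of_jordan f \<in> alg_auto U0 lie_bracket"
proof -
  note B = alg_auto_linear(1)[OF f] and lin = alg_auto_linear(2)[OF f]
  note L = mat_linear_onD[OF lin]
  have tr: "mat_trace (f x) = mat_trace x" if "x \<in> U" for x
    using jordan_automorphism(2)[OF f] n that by simp
  have U0: "f x \<in> U0" if "x \<in> U0" for x
    using that tr Bij_U(1)[OF B] by (auto simp: U0_def)
  have "bij_betw (lie_of_jordan f) U0 U0"
  proof (rule bij_betwI')
    fix x y assume xy: "x \<in> U0" "y \<in> U0"
    show "lie_of_jordan f x = lie_of_jordan f y \<longleftrightarrow> x = y"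
    proof
      assume "lie_of_jordan f x = lie_of_jordan f y"
      then have "parity f \<cdot>\<^sub>m (parity f \<cdot>\<^sub>m f x) = parity f \<cdot>\<^sub>m (parity f \<cdot>\<^sub>m f y)"
        using xy by (simp add: lie_of_jordan_def)
      then have "f x = f y" by (simp add: mat_smult_smult parity_square one_smult_mat)
      then show "x = y" using Bij_U(2)[OF B] xy U0_U by blast
    qed simp
    show "lie_of_jordan f x \<in> U0" using xy(1) by (simp add: lie_of_jordan_def U0_smult U0)
  next
    fix y assume y: "y \<in> U0"
    obtain x where x: "x \<in> U" "f x = parity f \<cdot>\<^sub>m y"
      using Bij_U(3)[OF B U0_U[OF U0_smult[OF y]]] by blast
    then have "x \<in> U0" using tr[OF x(1)] U0_smult[OF y, of "parity f"] by (auto simp: U0_def)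
    moreover have "y = lie_of_jordan f x"
      using x \<open>x \<in> U0\<close> by (simp add: lie_of_jordan_def mat_smult_smult parity_square one_smult_mat)
    ultimately show "\<exists>x\<in>U0. y = lie_of_jordan f x" by blast
  qed
  then have "lie_of_jordan f \<in> Bij U0" by (simp add: Bij_def lie_of_jordan_def)
  moreover have "lie_of_jordan f (lie_bracket x y) = lie_bracket (lie_of_jordan f x) (lie_of_jordan f y)"
    if xy: "x \<in> U0" "y \<in> U0" for x y
  proof -
    note u = U0_U[OF xy(1)] U0_U[OF xy(2)]
    note c = L(1)[OF u(1)] L(1)[OF u(2)]
    note cm = mult_carrier_mat[OF c] mult_carrier_mat[OF c(2,1)]
    have br: "lie_bracket (parity f \<cdot>\<^sub>m f x) (parity f \<cdot>\<^sub>m f y) = f x * f y - f y * f x"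
      using c by (simp add: lie_bracket_def mult_smult_assoc_mat[of _ n n _ n] mult_smult_distrib[of _ n n _ n]
          mat_smult_smult parity_square one_smult_mat)
    have "f (lie_bracket x y) = f (x * y) - f (y * x)"
      unfolding lie_bracket_def by (rule linear_diff[OF lin U_mult[OF u] U_mult[OF u(2,1)]])
    moreover from n f have "parity f \<cdot>\<^sub>m (f (x * y) - f (y * x)) = f x * f y - f y * f x"
    proof (cases rule: jordan_auto_parity_cases)
      case 1
      then show ?thesis using u by (simp add: multiplicative_def one_smult_mat)
    next
      case 2
      have "(-1) \<cdot>\<^sub>m (f y * f x - f x * f y) = f x * f y - f y * f x"
        using cm c by (intro eq_matI) auto
      then show ?thesis using 2 u by (simp add: antimultiplicative_def)
    qed
    ultimately show ?thesis using br xy U0_lie[OF u] by (simp add: lie_of_jordan_def)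
  qed
  moreover have "lie_of_jordan f (x + y) = lie_of_jordan f x + lie_of_jordan f y" if xy: "x \<in> U0" "y \<in> U0" for x y
    using L(2)[OF U0_U[OF xy(1)] U0_U[OF xy(2)]] L(1)[OF U0_U[OF xy(1)]] L(1)[OF U0_U[OF xy(2)]] xy
    by (simp add: lie_of_jordan_def U0_add add_smult_distrib_left_mat[of _ n n])
  moreover have "lie_of_jordan f (c \<cdot>\<^sub>m x) = c \<cdot>\<^sub>m lie_of_jordan f x" if x: "x \<in> U0" for c x
    using L(3)[OF U0_U[OF x]] x by (simp add: lie_of_jordan_def U0_smult mat_smult_smult mult.commute)
  ultimately show ?thesis by (simp add: alg_auto_def)
qed

lemma parity_compose:
  assumes n: "2 < n" and f: "f \<in> alg_auto U jordan_mult" and g: "g \<in> alg_auto U jordan_mult"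
  shows "parity (compose U f g) = parity f * parity g"
proof -
  let ?h = "compose U f g"
  have gU: "g x \<in> U" if "x \<in> U" for x using Bij_U(1)[OF alg_auto_linear(1)[OF g] that] .
  have h: "?h x = f (g x)" if "x \<in> U" for x using that by (simp add: compose_def)
  have B: "?h \<in> Bij U" by (rule compose_Bij[OF alg_auto_linear(1)[OF f] alg_auto_linear(1)[OF g]])
  have lin: "mat_linear_on n U ?h"
    using mat_linear_onD[OF alg_auto_linear(2)[OF f]] mat_linear_onD[OF alg_auto_linear(2)[OF g]] gU
    by (auto simp: mat_linear_on_def h U_add U_smult)
  have p: "parity ?h = 1" if "multiplicative ?h" using that by (simp add: parity_def)
  have q: "parity ?h = -1" if "antimultiplicative ?h"
    using not_multiplicative_and_antimultiplicative[OF n lin B that] by (simp add: parity_def)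
  from n f show ?thesis
  proof (cases rule: jordan_auto_parity_cases)
    case f: 1
    from n g show ?thesis
    proof (cases rule: jordan_auto_parity_cases)
      case 1
      have "multiplicative ?h" using f(1) 1(1) gU by (simp add: multiplicative_def h U_mult)
      then show ?thesis using p f 1 by simp
    next
      case 2
      have "antimultiplicative ?h" using f(1) 2(1) gU by (simp add: multiplicative_def antimultiplicative_def h U_mult)
      then show ?thesis using q f 2 by simp
    qed
  next
    case f: 2
    from n g show ?thesis
    proof (cases rule: jordan_auto_parity_cases)
      case 1
      have "antimultiplicative ?h" using f(1) 1(1) gU by (simp add: multiplicative_def antimultiplicative_def h U_mult)
      then show ?thesis using q f 1 by simp
    next
      case 2
      have "multiplicative ?h" using f(1) 2(1) gU by (simp add: multiplicative_def antimultiplicative_def h U_mult)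
      then show ?thesis using p f 2 by simp
    qed
  qed
qed

lemma lie_of_jordan_compose:
  assumes n: "2 < n" and f: "f \<in> alg_auto U jordan_mult" and g: "g \<in> alg_auto U jordan_mult"
  shows "lie_of_jordan (compose U f g) = compose U0 (lie_of_jordan f) (lie_of_jordan g)"
proof
  fix x
  show "lie_of_jordan (compose U f g) x = compose U0 (lie_of_jordan f) (lie_of_jordan g) x"
  proof (cases "x \<in> U0")
    case True
    have gx: "g x \<in> U0"
      using True Bij_U(1)[OF alg_auto_linear(1)[OF g]] jordan_automorphism(2)[OF g] n by (auto simp: U0_def)
    have "f (parity g \<cdot>\<^sub>m g x) = parity g \<cdot>\<^sub>m f (g x)"
      by (rule mat_linear_onD(3)[OF alg_auto_linear(2)[OF f] U0_U[OF gx]])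
    then show ?thesis
      using True gx parity_compose[OF n f g]
      by (simp add: lie_of_jordan_def compose_def U0_U U0_smult mat_smult_smult)
  qed (simp add: lie_of_jordan_def compose_def)
qed

lemma trace_free_part:
  assumes n: "0 < n" and x: "x \<in> U"
  shows "x - (mat_trace x / of_nat n) \<cdot>\<^sub>m 1\<^sub>m n \<in> U0"
  using n U_carrier[OF x]
  by (simp add: U0_def U_diff U_smult U_one x mat_trace_add_diff[of _ n] mat_trace_smult[of _ n] mat_trace_one)

lemma trace_split:
  assumes "x \<in> U"
  shows "x = (x - c \<cdot>\<^sub>m 1\<^sub>m n) + c \<cdot>\<^sub>m 1\<^sub>m n"
  using U_carrier[OF assms] by (intro eq_matI) auto

text \<open>Two maps with the same parity agree on \<open>U0\<close> and at 1, hence everywhere. For different parities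
  \<open>f = -g\<close> on \<open>U0\<close>, so \<open>f (E 0 2) = f (E 0 1) * f (E 1 2) = g (E 0 1) * g (E 1 2) = g (E 1 2 * E 0 1) = 0\<close>.\<close>

lemma lie_of_jordan_inj:
  assumes n: "2 < n" and f: "f \<in> alg_auto U jordan_mult" and g: "g \<in> alg_auto U jordan_mult"
    and eq: "lie_of_jordan f = lie_of_jordan g"
  shows "f = g"
proof -
  have eqx: "parity f \<cdot>\<^sub>m f x = parity g \<cdot>\<^sub>m g x" if "x \<in> U0" for x
    using fun_cong[OF eq, of x] that by (simp add: lie_of_jordan_def)
  have units: "E 0 1 \<in> U0" "E 1 2 \<in> U0"
    using units_U[OF n] by (auto simp: U0_def mat_trace_def intro!: sum.neutral)
  \<comment> \<open>stated for arbitrary \<open>f\<close> and \<open>g\<close>, since it is applied with the two roles exchanged as well\<close>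
  have mixed: False if f: "f \<in> alg_auto U jordan_mult" and g: "g \<in> alg_auto U jordan_mult"
    and eqx: "\<And>x. x \<in> U0 \<Longrightarrow> f x = (-1) \<cdot>\<^sub>m g x" and "multiplicative f" "antimultiplicative g" for f g
  proof -
    note gc = mat_linear_onD(1)[OF alg_auto_linear(2)[OF g] U0_U]
    have "f (E 0 1) * f (E 1 2) = g (E 0 1) * g (E 1 2)"
      using eqx units gc[OF units(1)] gc[OF units(2)]
      by (simp add: mult_smult_assoc_mat[of _ n n _ n] mult_smult_distrib[of _ n n _ n] mat_smult_smult one_smult_mat)
    also have "\<dots> = 0\<^sub>m n n" by (rule antimultiplicative_product_zero[OF n alg_auto_linear(2)[OF g] that(5)])
    finally have "f (E 0 1) * f (E 1 2) = 0\<^sub>m n n" .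
    moreover have "f (E 0 1 * E 1 2) = f (E 0 1) * f (E 1 2)"
      using that(4) units_U[OF n] by (simp add: multiplicative_def)
    ultimately show False
      using unit_product_nonvanishing[OF n alg_auto_linear(2,1)[OF f]] by blast
  qed
  have same: "f x = g x" if x: "x \<in> U0" for x
    using n f
  proof (cases rule: jordan_auto_parity_cases)
    case F: 1
    from n g show ?thesis
    proof (cases rule: jordan_auto_parity_cases)
      case 1
      then show ?thesis using eqx[OF x] F by (simp add: one_smult_mat)
    next
      case 2
      then show ?thesis using mixed[OF f g] eqx F by (simp add: one_smult_mat)
    qed
  next
    case F: 2
    have neg: "f x = g x" if "(-1) \<cdot>\<^sub>m f x = (-1) \<cdot>\<^sub>m g x"
    proof -
      have "(-1) \<cdot>\<^sub>m ((-1) \<cdot>\<^sub>m f x) = (-1) \<cdot>\<^sub>m ((-1) \<cdot>\<^sub>m g x)" by (simp only: that)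
      then show ?thesis by (simp add: mat_smult_smult one_smult_mat)
    qed
    from n g show ?thesis
    proof (cases rule: jordan_auto_parity_cases)
      case 1
      have "g x = (-1) \<cdot>\<^sub>m f x" if "x \<in> U0" for x using eqx[OF that] F 1 by (simp add: one_smult_mat)
      then show ?thesis using mixed[OF g f _ 1(1) F(1)] by blast
    next
      case 2
      then show ?thesis using eqx[OF x] F neg by simp
    qed
  qed
  show "f = g"
  proof
    fix x
    show "f x = g x"
    proof (cases "x \<in> U")
      case True
      define c where "c = mat_trace x / of_nat n"
      have y: "x - c \<cdot>\<^sub>m 1\<^sub>m n \<in> U0" unfolding c_def by (rule trace_free_part) (use n True in auto)
      have "h x = h (x - c \<cdot>\<^sub>m 1\<^sub>m n) + c \<cdot>\<^sub>m 1\<^sub>m n" if h: "h \<in> alg_auto U jordan_mult" for h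
      proof -
        note L = mat_linear_onD[OF alg_auto_linear(2)[OF h]]
        have "h x = h ((x - c \<cdot>\<^sub>m 1\<^sub>m n) + c \<cdot>\<^sub>m 1\<^sub>m n)" using trace_split[OF True] by simp
        also have "\<dots> = h (x - c \<cdot>\<^sub>m 1\<^sub>m n) + c \<cdot>\<^sub>m h (1\<^sub>m n)"
          by (simp only: L(2)[OF U0_U[OF y] U_smult[OF U_one]] L(3)[OF U_one])
        finally show ?thesis using jordan_automorphism(1)[OF h] n by simp
      qed
      from this[OF f] this[OF g] show ?thesis using same[OF y] by simp
    next
      case False
      then show ?thesis
        using alg_auto_linear(1)[OF f] alg_auto_linear(1)[OF g] by (auto simp: Bij_def extensional_def)
    qed
  qed
qed

text \<open>A Lie automorphism \<open>k\<close> of \<open>U0\<close> extends to \<open>U\<close> by fixing 1, and \<open>lie_automorphism\<close> applies to the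
  extension \<open>F\<close>. The preimage of \<open>k\<close> is \<open>F\<close> itself, or the map \<open>G\<close> that reverses products; on \<open>U0\<close>
  the latter is \<open>-F\<close>.\<close>

lemma lie_of_jordan_surj:
  assumes n: "2 < n" and k: "k \<in> alg_auto U0 lie_bracket"
  shows "\<exists>f\<in>alg_auto U jordan_mult. lie_of_jordan f = k"
proof -
  have kB: "bij_betw k U0 U0" and kext: "k \<in> extensional U0" and kadd: "\<And>x y. x \<in> U0 \<Longrightarrow> y \<in> U0 \<Longrightarrow> k (x + y) = k x + k y"
    and ksm: "\<And>c x. x \<in> U0 \<Longrightarrow> k (c \<cdot>\<^sub>m x) = c \<cdot>\<^sub>m k x"
    and klie: "\<And>x y. x \<in> U0 \<Longrightarrow> y \<in> U0 \<Longrightarrow> k (lie_bracket x y) = lie_bracket (k x) (k y)"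
    using k by (auto simp: alg_auto_def Bij_def)
  have kU0: "k x \<in> U0" if "x \<in> U0" for x using kB that by (auto simp: bij_betw_def)
  note kU = U0_U[OF kU0]
  note kc = U_carrier[OF kU]
  have n0: "of_nat n \<noteq> (0 :: 'a)" using n by simp
  define m where "m x = mat_trace x / of_nat n" for x :: "'a mat"
  \<comment> \<open>the trace-zero part of \<open>x\<close>; the scalar part is \<open>m x\<close> times the identity\<close>
  define r where "r x = x - m x \<cdot>\<^sub>m 1\<^sub>m n" for x
  define F where "F x = k (r x) + m x \<cdot>\<^sub>m 1\<^sub>m n" for x
  have r: "r x \<in> U0" if "x \<in> U" for x
    unfolding r_def m_def by (rule trace_free_part) (use n that in auto)
  have m_add: "m (x + y) = m x + m y" if "x \<in> U" "y \<in> U" for x y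
    using mat_trace_add_diff(1)[OF U_carrier[OF that(1)] U_carrier[OF that(2)]] by (simp add: m_def add_divide_distrib)
  have m_sm: "m (c \<cdot>\<^sub>m x) = c * m x" if "x \<in> U" for c x
    using mat_trace_smult[OF U_carrier[OF that]] by (simp add: m_def)
  have r_add: "r (x + y) = r x + r y" if "x \<in> U" "y \<in> U" for x y
    using that U_carrier by (intro eq_matI) (auto simp: r_def m_add U_dims algebra_simps)
  have r_sm: "r (c \<cdot>\<^sub>m x) = c \<cdot>\<^sub>m r x" if "x \<in> U" for c x
    using that by (intro eq_matI) (auto simp: r_def m_sm U_dims algebra_simps)
  have FU: "F x \<in> U" if "x \<in> U" for x
    using that by (simp add: F_def U_add U_smult U_one kU r)
  have Fc: "F x \<in> carrier_mat n n" if "x \<in> U" for x using U_carrier[OF FU[OF that]] .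
  have lin: "mat_linear_on n U F"
    unfolding mat_linear_on_def
  proof (intro conjI ballI allI)
    show "F (x + y) = F x + F y" if xy: "x \<in> U" "y \<in> U" for x y
      using kc[OF r[OF xy(1)]] kc[OF r[OF xy(2)]] unfolding F_def r_add[OF xy] m_add[OF xy] kadd[OF r[OF xy(1)] r[OF xy(2)]]
      by (intro eq_matI) (auto simp: algebra_simps)
    show "F (c \<cdot>\<^sub>m x) = c \<cdot>\<^sub>m F x" if x: "x \<in> U" for c x
      using kc[OF r[OF x]] unfolding F_def r_sm[OF x] m_sm[OF x] ksm[OF r[OF x]]
      by (intro eq_matI) (auto simp: algebra_simps)
  qed (rule Fc)
  have trF: "mat_trace (F x) = mat_trace x" if x: "x \<in> U" for x
    unfolding F_def using kc[OF r[OF x]] kU0[OF r[OF x]] n0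
    by (simp add: mat_trace_add_diff[of _ n] mat_trace_smult[of _ n] mat_trace_one U0_def m_def)
  have F0: "F x = k x" if "x \<in> U0" for x
  proof -
    have "m x = 0" using that by (simp add: m_def U0_def)
    then have rx: "r x = x"
      using U_carrier[OF U0_U[OF that]] by (intro eq_matI) (auto simp: r_def)
    show ?thesis unfolding F_def rx \<open>m x = 0\<close> using kc[OF that] by (intro eq_matI) auto
  qed
  have F1: "F (1\<^sub>m n) = 1\<^sub>m n"
  proof -
    have m1: "m (1\<^sub>m n) = 1" using n0 by (simp add: m_def mat_trace_one)
    have z: "0\<^sub>m n n \<in> U0" using U_zero by (simp add: U0_def mat_trace_def)
    have "k (0 \<cdot>\<^sub>m 0\<^sub>m n n) = 0 \<cdot>\<^sub>m k (0\<^sub>m n n)" by (rule ksm[OF z])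
    also have "\<dots> = 0\<^sub>m n n" using kc[OF z] by auto
    finally have "k (0\<^sub>m n n) = 0\<^sub>m n n" by simp
    moreover have "r (1\<^sub>m n) = 0\<^sub>m n n" unfolding r_def m1 by (rule eq_matI) auto
    ultimately show ?thesis by (simp add: F_def m1 one_smult_mat)
  qed
  have Finj: "x = y" if xy: "x \<in> U" "y \<in> U" "F x = F y" for x y
  proof -
    have "m x = m y" using trF[OF xy(1)] trF[OF xy(2)] xy(3) by (simp add: m_def)
    have "k (r x) = F x - m x \<cdot>\<^sub>m 1\<^sub>m n" "k (r y) = F y - m y \<cdot>\<^sub>m 1\<^sub>m n"
      using kc[OF r[OF xy(1)]] kc[OF r[OF xy(2)]] by (auto simp: F_def intro!: eq_matI)
    then have "k (r x) = k (r y)" using \<open>m x = m y\<close> xy(3) by simp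
    then have "r x = r y" using kB r xy by (auto simp: bij_betw_def dest: inj_onD)
    then show ?thesis
      using trace_split[OF xy(1), of "m x"] trace_split[OF xy(2), of "m y"] \<open>m x = m y\<close> unfolding r_def by metis
  qed
  have Fsurj: "\<exists>x\<in>U. F x = y" if y: "y \<in> U" for y
  proof -
    obtain z where z: "z \<in> U0" "k z = r y" using kB r[OF y] unfolding bij_betw_def by (metis imageE)
    have x: "z + m y \<cdot>\<^sub>m 1\<^sub>m n \<in> U" using z by (simp add: U_add U_smult U_one U0_U)
    have "F (z + m y \<cdot>\<^sub>m 1\<^sub>m n) = F z + m y \<cdot>\<^sub>m F (1\<^sub>m n)"
      using mat_linear_onD(2)[OF lin U0_U[OF z(1)] U_smult[OF U_one]] mat_linear_onD(3)[OF lin U_one] by simp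
    also have "\<dots> = y" using trace_split[OF y, of "m y"] by (simp add: F0[OF z(1)] z(2) F1 r_def)
    finally show ?thesis using x by blast
  qed
  have bij: "bij_betw F U U"
    by (rule bij_betwI') (use Finj Fsurj FU in blast)+
  have lie: "\<forall>x\<in>U. \<forall>y\<in>U. F (lie_bracket x y) = lie_bracket (F x) (F y)"
  proof (intro ballI)
    fix x y assume xy: "x \<in> U" "y \<in> U"
    have shift: "lie_bracket (A + \<alpha> \<cdot>\<^sub>m 1\<^sub>m n) (B + \<beta> \<cdot>\<^sub>m 1\<^sub>m n) = lie_bracket A B"
      if "A \<in> carrier_mat n n" "B \<in> carrier_mat n n" for A B :: "'a mat" and \<alpha> \<beta>
    proof -
      have prod: "(A + \<alpha> \<cdot>\<^sub>m 1\<^sub>m n) * (B + \<beta> \<cdot>\<^sub>m 1\<^sub>m n) = (A * B + \<alpha> \<cdot>\<^sub>m B) + (\<beta> \<cdot>\<^sub>m A + (\<alpha> * \<beta>) \<cdot>\<^sub>m 1\<^sub>m n)"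
        if "A \<in> carrier_mat n n" "B \<in> carrier_mat n n" for A B :: "'a mat" and \<alpha> \<beta>
      proof -
        have "(A + \<alpha> \<cdot>\<^sub>m 1\<^sub>m n) * (B + \<beta> \<cdot>\<^sub>m 1\<^sub>m n) = (A + \<alpha> \<cdot>\<^sub>m 1\<^sub>m n) * B + \<beta> \<cdot>\<^sub>m (A + \<alpha> \<cdot>\<^sub>m 1\<^sub>m n)"
          using that by (simp add: mult_add_distrib_mat[of _ n n _ n] mult_smult_distrib[of _ n n _ n])
        also have "\<dots> = (A * B + \<alpha> \<cdot>\<^sub>m B) + \<beta> \<cdot>\<^sub>m (A + \<alpha> \<cdot>\<^sub>m 1\<^sub>m n)"
          using that by (simp add: add_mult_distrib_mat[of _ n n _ _ n] mult_smult_assoc_mat[of _ n n _ n])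
        also have "\<dots> = (A * B + \<alpha> \<cdot>\<^sub>m B) + (\<beta> \<cdot>\<^sub>m A + (\<alpha> * \<beta>) \<cdot>\<^sub>m 1\<^sub>m n)"
          using that by (intro eq_matI) (auto simp: algebra_simps)
        finally show ?thesis .
      qed
      show ?thesis
        unfolding lie_bracket_def prod[OF that] prod[OF that(2,1)]
        using that by (intro eq_matI) (auto simp: algebra_simps)
    qed
    have split: "x = r x + m x \<cdot>\<^sub>m 1\<^sub>m n" "y = r y + m y \<cdot>\<^sub>m 1\<^sub>m n"
      unfolding r_def using trace_split xy by blast+
    have "lie_bracket x y = lie_bracket (r x) (r y)"
      by (subst split(1), subst split(2)) (rule shift[OF U_carrier[OF U0_U[OF r[OF xy(1)]]] U_carrier[OF U0_U[OF r[OF xy(2)]]]])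
    then have "F (lie_bracket x y) = lie_bracket (k (r x)) (k (r y))"
      using F0[OF U0_lie[OF xy]] klie[OF r[OF xy(1)] r[OF xy(2)]] by simp
    also have "\<dots> = lie_bracket (F x) (F y)"
      unfolding F_def by (rule shift[symmetric, OF kc[OF r[OF xy(1)]] kc[OF r[OF xy(2)]]])
    finally show "F (lie_bracket x y) = lie_bracket (F x) (F y)" .
  qed
  define G where "G x = (2 * mat_trace x / of_nat n) \<cdot>\<^sub>m 1\<^sub>m n - F x" for x
  have "multiplicative F \<or> antimultiplicative G"
    using lie_automorphism[OF _ lin bij lie] trF n unfolding multiplicative_def antimultiplicative_def G_def by auto
  then show ?thesis
  proof
    assume mF: "multiplicative F"
    have f: "restrict F U \<in> alg_auto U jordan_mult" using jordan_autoI[OF lin bij] mF by blast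
    have "multiplicative (restrict F U)" using mF by (simp add: multiplicative_def U_mult)
    then have "lie_of_jordan (restrict F U) = k"
      using kext F0 by (auto simp: lie_of_jordan_def parity_def extensional_def U0_U one_smult_mat)
    then show ?thesis using f by blast
  next
    assume aG: "antimultiplicative G"
    have GU: "G x \<in> U" if "x \<in> U" for x using that by (simp add: G_def U_diff U_smult U_one FU)
    have trG: "mat_trace (G x) = mat_trace x" if x: "x \<in> U" for x
      unfolding G_def using Fc[OF x] n0 trF[OF x]
      by (simp add: mat_trace_add_diff[of _ n] mat_trace_smult[of _ n] mat_trace_one)
    have linG: "mat_linear_on n U G"
      unfolding mat_linear_on_def
    proof (intro conjI ballI allI)
      show "G x \<in> carrier_mat n n" if "x \<in> U" for x using U_carrier[OF GU[OF that]] .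
      show "G (x + y) = G x + G y" if xy: "x \<in> U" "y \<in> U" for x y
        using Fc[OF xy(1)] Fc[OF xy(2)] mat_trace_add_diff(1)[OF U_carrier[OF xy(1)] U_carrier[OF xy(2)]]
          mat_linear_onD(2)[OF lin xy] by (intro eq_matI) (auto simp: G_def algebra_simps add_divide_distrib)
      show "G (c \<cdot>\<^sub>m x) = c \<cdot>\<^sub>m G x" if x: "x \<in> U" for c x
        using Fc[OF x] mat_trace_smult[OF U_carrier[OF x]] mat_linear_onD(3)[OF lin x]
        by (intro eq_matI) (auto simp: G_def algebra_simps)
    qed
    have FG: "F x = (2 * mat_trace x / of_nat n) \<cdot>\<^sub>m 1\<^sub>m n - G x" if "x \<in> U" for x
      using Fc[OF that] by (intro eq_matI) (auto simp: G_def)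
    have bijG: "bij_betw G U U"
    proof (rule bij_betwI')
      fix x y assume xy: "x \<in> U" "y \<in> U"
      show "G x = G y \<longleftrightarrow> x = y"
        using trG[OF xy(1)] trG[OF xy(2)] FG[OF xy(1)] FG[OF xy(2)] Finj[OF xy] by auto
      show "G x \<in> U" by (rule GU[OF xy(1)])
    next
      fix y assume y: "y \<in> U"
      define z where "z = (2 * mat_trace y / of_nat n) \<cdot>\<^sub>m 1\<^sub>m n - y"
      have z: "z \<in> U" unfolding z_def by (intro U_diff U_smult U_one y)
      obtain x where x: "x \<in> U" "F x = z" using Fsurj[OF z] by blast
      have "mat_trace x = mat_trace y"
        using trF[OF x(1)] x(2) U_carrier[OF y] n0
        by (simp add: z_def mat_trace_add_diff[of _ n] mat_trace_smult[of _ n] mat_trace_one)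
      then have "y = G x" unfolding G_def x(2) z_def using U_carrier[OF y] by (intro eq_matI) auto
      then show "\<exists>x\<in>U. y = G x" using x by blast
    qed
    have f: "restrict G U \<in> alg_auto U jordan_mult" using jordan_autoI[OF linG bijG] aG by blast
    have "antimultiplicative (restrict G U)" using aG by (simp add: antimultiplicative_def U_mult)
    then have "\<not> multiplicative (restrict G U)"
      using not_multiplicative_and_antimultiplicative[OF n alg_auto_linear(2,1)[OF f]] by blast
    moreover have "(-1) \<cdot>\<^sub>m G x = k x" if "x \<in> U0" for x
      using that kc[OF that] F0[OF that] by (intro eq_matI) (auto simp: G_def U0_def)
    ultimately have "lie_of_jordan (restrict G U) = k"
      using kext by (auto simp: lie_of_jordan_def parity_def extensional_def U0_U)
    then show ?thesis using f by blast
  qed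
qed

theorem lie_of_jordan_iso:
  assumes n: "2 < n"
  shows "lie_of_jordan \<in> iso (AlgAutGroup U jordan_mult) (AlgAutGroup U0 lie_bracket)"
proof (rule isoI)
  have B: "f \<in> Bij V" if "f \<in> alg_auto V p" for f V and p :: "'a mat \<Rightarrow> 'a mat \<Rightarrow> 'a mat"
    using that by (simp add: alg_auto_def)
  note fB = B[of _ U jordan_mult] and kB = B[OF lie_of_jordan_auto[OF n]]
  show "lie_of_jordan \<in> hom (AlgAutGroup U jordan_mult) (AlgAutGroup U0 lie_bracket)"
    using lie_of_jordan_auto[OF n] lie_of_jordan_compose[OF n] fB kB
    by (auto simp: hom_def AlgAutGroup_def BijGroup_def)
  show "bij_betw lie_of_jordan (carrier (AlgAutGroup U jordan_mult)) (carrier (AlgAutGroup U0 lie_bracket))"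
    using lie_of_jordan_inj[OF n] lie_of_jordan_auto[OF n] lie_of_jordan_surj[OF n]
    by (auto simp: AlgAutGroup_def intro!: bij_betwI') metis
qed

end

theorem lemma25:
  fixes ns :: "nat list"
  assumes "\<forall>m \<in> set ns. 1 \<le> m"
    and "sum_list ns > 2"
  shows "AlgAutGroup (UT ns :: 'a::{alg_closed_field, field_char_0} mat set) jordan_mult
       \<cong> AlgAutGroup (UT0 ns :: 'a mat set) lie_bracket"
proof -
  interpret block_triangular "sum_list ns" "block_index ns" "UT ns :: 'a mat set"
    by (rule block_triangular_UT)
  have "UT0 ns = U0" by (simp add: UT0_def U0_def)
  then show ?thesis using lie_of_jordan_iso[OF assms(2)] by (auto simp: is_iso_def)
qed

end
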